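(* Let $(M,F)$ be a Finsler manifold. Suppose that the linear parallel transport along any geodesic of $(M,F)$ preserves the Finsler norm $F$, i.e. for every geodesic $\gamma$ of $(M,F)$ and every linearly parallel vector field $W$ along $\gamma$ the function $t\mapsto F(W(t))$ is constant. Then there exists a Riemannian metric on $M$ affinely equivalent to $F$. In particular $F$ is Berwald.
   Context: Finsler manifold: a smooth finite-dimensional manifold $M$ with a continuous function $F:TM\to[0,\infty)$ which is smooth on $TM\setminus\{0\}$, positive on nonzero vectors, positively homogeneous ($F(\lambda v)=\lambda F(v)$ for $\lambda>0$), and strictly convex in the usual strong sense: for every $p\in M$ and $v\in T_pM\setminus\{0\}$ the second derivative of $F^2|_{T_pM}$ at $v$ is positive definite. $F$ is not assumed reversible. A geodesic of $(M,F)$ is a nonconstant constant-speed Finsler geodesic (a locally length-minimizing curve with $F(\dot\gamma)$ constant, equivalently a nonconstant solution of the Euler–Lagrange equation of $F^2$). Linear parallel transport: for $v\in T_pM\setminus\{0\}$ let $g_v$ be the inner product on $T_pM$ given by $g_v(u,w)=\frac12\frac{\partial^2}{\partial s\,\partial t}\big|_{s=t=0}F^2(v+su+tw)$. For an embedded geodesic $\gamma$ (any geodesic is embedded on short intervals, and the following notions are local along $\gamma$), extend $\dot\gamma$ to a non-vanishing smooth vector field $V$ on a neighborhood of $\gamma$; the Riemannian metric $g^\gamma=g_V:q\mapsto g_{V(q)}$ is called an osculating Riemannian metric for $\gamma$. The covariant derivative $D_\gamma W$ of a vector field $W$ along $\gamma$ is its covariant derivative along $\gamma$ with respect to the Levi-Civita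 connection of $g^\gamma$; it does not depend on the choice of $V$. A vector field $W$ along $\gamma$ is linearly parallel if $D_\gamma W=0$, and the linear parallel transport along $\gamma$ is the resulting family of linear isomorphisms between the tangent spaces $T_{\gamma(t)}M$. Two (Finsler or Riemannian) metrics on $M$ are affinely equivalent if they have the same constant-speed geodesics (up to affine reparametrization). $F$ is Berwald if there exists a symmetric (torsion-free) smooth affine connection on $M$ such that the geodesics of $F$ are also geodesics of this connection. *)

theory Defs
  imports "HOL-Analysis.Analysis"
begin

section \<open>Smooth maps between open subsets of normed spaces\<close>

text \<open>
  \<open>Ck_on k f S\<close>: all iterated directional derivatives of \<open>f\<close> of order at most \<open>k\<close> exist (as values
  of Frechet derivatives) and are continuous on \<open>S\<close>. For open \<open>S\<close> in a finite-dimensional space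
  this is the usual class \<open>C\<^sup>k\<close>.
\<close>

primrec Ck_on ::
  "nat \<Rightarrow> ('x::real_normed_vector \<Rightarrow> 'y::real_normed_vector) \<Rightarrow> 'x set \<Rightarrow> bool" where
  "Ck_on 0 f S \<longleftrightarrow> continuous_on S f"
| "Ck_on (Suc k) f S \<longleftrightarrow>
     (\<forall>x\<in>S. f differentiable (at x)) \<and> (\<forall>v. Ck_on k (\<lambda>x. frechet_derivative f (at x) v) S)"

definition smooth_on ::
  "'x::real_normed_vector set \<Rightarrow> ('x \<Rightarrow> 'y::real_normed_vector) \<Rightarrow> bool" where
  "smooth_on S f \<longleftrightarrow> open S \<and> (\<forall>k. Ck_on k f S)"


section \<open>Smooth manifolds\<close>

text \<open>
  A chart is a pair of its domain and its coordinate map; the values of the map outside the domain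
  are irrelevant. The model space \<open>'e\<close> is an arbitrary Euclidean space, so the dimension
  of the manifold is \<open>DIM('e)\<close>.
\<close>

type_synonym ('a, 'e) chart = "'a set \<times> ('a \<Rightarrow> 'e)"

definition cinv :: "('a, 'e) chart \<Rightarrow> 'e \<Rightarrow> 'a" where
  "cinv c = inv_into (fst c) (snd c)"

definition is_chart :: "'a topology \<Rightarrow> ('a, 'e::euclidean_space) chart \<Rightarrow> bool" where
  "is_chart M c \<longleftrightarrow>
     openin M (fst c) \<and> open (snd c ` fst c) \<and>
     homeomorphic_map (subtopology M (fst c)) (top_of_set (snd c ` fst c)) (snd c)"

definition transition :: "('a, 'e) chart \<Rightarrow> ('a, 'e) chart \<Rightarrow> 'e \<Rightarrow> 'e" where
  "transition c d = snd d \<circ> cinv c"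

definition smooth_manifold :: "'a topology \<Rightarrow> ('a, 'e::euclidean_space) chart set \<Rightarrow> bool" where
  "smooth_manifold M A \<longleftrightarrow>
     Hausdorff_space M \<and> second_countable M \<and>
     (\<forall>c\<in>A. is_chart M c) \<and> (\<Union>c\<in>A. fst c) = topspace M \<and>
     (\<forall>c\<in>A. \<forall>d\<in>A. smooth_on (snd c ` (fst c \<inter> fst d)) (transition c d))"


section \<open>Tangent vectors\<close>

text \<open>
  A tangent vector at \<open>p\<close> is the family of its coordinate vectors in all charts of the atlas
  around \<open>p\<close> (and \<open>0\<close> in the other charts), related by the differentials of the
  transition maps. The vector space operations are pointwise.
\<close>

type_synonym ('a, 'e) tvec = "('a, 'e) chart \<Rightarrow> 'e"

definition dtransition ::
  "('a, 'e::euclidean_space) chart \<Rightarrow> ('a, 'e) chart \<Rightarrow> 'a \<Rightarrow> 'e \<Rightarrow> 'e" where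
  "dtransition c d p = frechet_derivative (transition c d) (at (snd c p))"

definition d2transition ::
  "('a, 'e::euclidean_space) chart \<Rightarrow> ('a, 'e) chart \<Rightarrow> 'a \<Rightarrow> 'e \<Rightarrow> 'e \<Rightarrow> 'e" where
  "d2transition c d p u w =
     frechet_derivative (\<lambda>x. frechet_derivative (transition c d) (at x) w) (at (snd c p)) u"

definition tangent_space ::
  "('a, 'e::euclidean_space) chart set \<Rightarrow> 'a \<Rightarrow> ('a, 'e) tvec set" where
  "tangent_space A p =
     {v. (\<forall>c. c \<notin> A \<or> p \<notin> fst c \<longrightarrow> v c = 0) \<and>
         (\<forall>c\<in>A. \<forall>d\<in>A. p \<in> fst c \<inter> fst d \<longrightarrow> v d = dtransition c d p (v c))}"

definition tzero :: "('a, 'e::euclidean_space) tvec" where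
  "tzero = (\<lambda>_. 0)"

text \<open>For \<open>p \<in> fst c\<close>: the tangent vector at \<open>p\<close> with coordinates \<open>\<xi>\<close> in the chart \<open>c\<close>.\<close>

definition tvec_of ::
  "('a, 'e::euclidean_space) chart set \<Rightarrow> ('a, 'e) chart \<Rightarrow> 'a \<Rightarrow> 'e \<Rightarrow> ('a, 'e) tvec" where
  "tvec_of A c p \<xi> = (\<lambda>d. if d \<in> A \<and> p \<in> fst d then dtransition c d p \<xi> else 0)"

definition smooth_vector_field_on ::
  "('a, 'e::euclidean_space) chart set \<Rightarrow> 'a set \<Rightarrow> ('a \<Rightarrow> ('a, 'e) tvec) \<Rightarrow> bool" where
  "smooth_vector_field_on A U V \<longleftrightarrow>
     (\<forall>p\<in>U. V p \<in> tangent_space A p) \<and>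
     (\<forall>c\<in>A. smooth_on (snd c ` (U \<inter> fst c)) (\<lambda>x. V (cinv c x) c))"


section \<open>Curves and vector fields along curves\<close>

definition smooth_curve ::
  "'a topology \<Rightarrow> ('a, 'e::euclidean_space) chart set \<Rightarrow> real set \<Rightarrow> (real \<Rightarrow> 'a) \<Rightarrow> bool" where
  "smooth_curve M A I \<gamma> \<longleftrightarrow>
     open I \<and> is_interval I \<and> continuous_map (top_of_set I) M \<gamma> \<and>
     (\<forall>c\<in>A. smooth_on {t\<in>I. \<gamma> t \<in> fst c} (\<lambda>t. snd c (\<gamma> t)))"

definition velocity ::
  "('a, 'e::euclidean_space) chart set \<Rightarrow> (real \<Rightarrow> 'a) \<Rightarrow> real \<Rightarrow> ('a, 'e) tvec" where
  "velocity A \<gamma> t =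
     (\<lambda>c. if c \<in> A \<and> \<gamma> t \<in> fst c then vector_derivative (\<lambda>s. snd c (\<gamma> s)) (at t) else 0)"

definition smooth_field_along ::
  "('a, 'e::euclidean_space) chart set \<Rightarrow> real set \<Rightarrow> (real \<Rightarrow> 'a) \<Rightarrow> (real \<Rightarrow> ('a, 'e) tvec) \<Rightarrow> bool"
  where
  "smooth_field_along A I \<gamma> W \<longleftrightarrow>
     (\<forall>t\<in>I. W t \<in> tangent_space A (\<gamma> t)) \<and>
     (\<forall>c\<in>A. smooth_on {t\<in>I. \<gamma> t \<in> fst c} (\<lambda>t. W t c))"


section \<open>Affine connections\<close>

text \<open>
  A smooth affine connection on an open set \<open>U\<close>, given by its Christoffel symbols:
  \<open>\<Gamma> c x u w\<close> is the vector with components \<open>\<Gamma>\<^sup>k\<^sub>i\<^sub>j(x) u\<^sup>i w\<^sup>j\<close> in the chart \<open>c\<close>,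
  subject to the usual transformation law. It is torsion-free iff the symbols are symmetric.
\<close>

type_synonym ('a, 'e) christoffel = "('a, 'e) chart \<Rightarrow> 'e \<Rightarrow> 'e \<Rightarrow> 'e \<Rightarrow> 'e"

definition affine_connection ::
  "('a, 'e::euclidean_space) chart set \<Rightarrow> 'a set \<Rightarrow> ('a, 'e) christoffel \<Rightarrow> bool" where
  "affine_connection A U \<Gamma> \<longleftrightarrow>
     (\<forall>c\<in>A. \<forall>p\<in>U \<inter> fst c. bilinear (\<Gamma> c (snd c p))) \<and>
     (\<forall>c\<in>A. \<forall>u w. smooth_on (snd c ` (U \<inter> fst c)) (\<lambda>x. \<Gamma> c x u w)) \<and>
     (\<forall>c\<in>A. \<forall>d\<in>A. \<forall>p\<in>U \<inter> fst c \<inter> fst d. \<forall>u w.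
        dtransition c d p (\<Gamma> c (snd c p) u w) =
        \<Gamma> d (snd d p) (dtransition c d p u) (dtransition c d p w) + d2transition c d p u w)"

definition torsion_free ::
  "('a, 'e::euclidean_space) chart set \<Rightarrow> 'a set \<Rightarrow> ('a, 'e) christoffel \<Rightarrow> bool" where
  "torsion_free A U \<Gamma> \<longleftrightarrow>
     (\<forall>c\<in>A. \<forall>p\<in>U \<inter> fst c. \<forall>u w. \<Gamma> c (snd c p) u w = \<Gamma> c (snd c p) w u)"

definition cov_deriv_along ::
  "('a, 'e::euclidean_space) chart set \<Rightarrow> ('a, 'e) christoffel \<Rightarrow> (real \<Rightarrow> 'a) \<Rightarrow>
   (real \<Rightarrow> ('a, 'e) tvec) \<Rightarrow> real \<Rightarrow> ('a, 'e) tvec" where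
  "cov_deriv_along A \<Gamma> \<gamma> W t =
     (\<lambda>c. if c \<in> A \<and> \<gamma> t \<in> fst c
          then vector_derivative (\<lambda>s. W s c) (at t) + \<Gamma> c (snd c (\<gamma> t)) (velocity A \<gamma> t c) (W t c)
          else 0)"

definition connection_geodesic ::
  "'a topology \<Rightarrow> ('a, 'e::euclidean_space) chart set \<Rightarrow> ('a, 'e) christoffel \<Rightarrow>
   real set \<Rightarrow> (real \<Rightarrow> 'a) \<Rightarrow> bool" where
  "connection_geodesic M A \<Gamma> I \<gamma> \<longleftrightarrow>
     smooth_curve M A I \<gamma> \<and> (\<forall>t\<in>I. cov_deriv_along A \<Gamma> \<gamma> (velocity A \<gamma>) t = tzero)"


section \<open>Riemannian metrics\<close>

definition riemannian_metric_on ::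
  "('a, 'e::euclidean_space) chart set \<Rightarrow> 'a set \<Rightarrow> ('a \<Rightarrow> ('a, 'e) tvec \<Rightarrow> ('a, 'e) tvec \<Rightarrow> real) \<Rightarrow> bool"
  where
  "riemannian_metric_on A U g \<longleftrightarrow>
     (\<forall>p\<in>U. \<forall>u\<in>tangent_space A p. \<forall>v\<in>tangent_space A p. \<forall>w\<in>tangent_space A p. \<forall>a b.
        g p (\<lambda>c. a *\<^sub>R u c + b *\<^sub>R v c) w = a * g p u w + b * g p v w) \<and>
     (\<forall>p\<in>U. \<forall>u\<in>tangent_space A p. \<forall>w\<in>tangent_space A p. g p u w = g p w u) \<and>
     (\<forall>p\<in>U. \<forall>u\<in>tangent_space A p. u \<noteq> tzero \<longrightarrow> g p u u > 0) \<and>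
     (\<forall>c\<in>A. \<forall>\<xi> \<eta>. smooth_on (snd c ` (U \<inter> fst c))
        (\<lambda>x. g (cinv c x) (tvec_of A c (cinv c x) \<xi>) (tvec_of A c (cinv c x) \<eta>)))"

text \<open>
  The Levi-Civita connection is the (unique) torsion-free connection for which \<open>g\<close> is parallel:
  \<open>\<partial>\<^sub>u (g(v,w)) = g(\<nabla>\<^sub>u v, w) + g(v, \<nabla>\<^sub>u w)\<close> for the coordinate fields \<open>v, w\<close>
  (constant in the chart), where \<open>\<nabla>\<^sub>u v = \<Gamma> u v\<close>.
\<close>

definition levi_civita_on ::
  "('a, 'e::euclidean_space) chart set \<Rightarrow> 'a set \<Rightarrow> ('a \<Rightarrow> ('a, 'e) tvec \<Rightarrow> ('a, 'e) tvec \<Rightarrow> real) \<Rightarrow>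
   ('a, 'e) christoffel \<Rightarrow> bool" where
  "levi_civita_on A U g \<Gamma> \<longleftrightarrow>
     affine_connection A U \<Gamma> \<and> torsion_free A U \<Gamma> \<and>
     (\<forall>c\<in>A. \<forall>p\<in>U \<inter> fst c. \<forall>u v w.
        frechet_derivative
          (\<lambda>x. g (cinv c x) (tvec_of A c (cinv c x) v) (tvec_of A c (cinv c x) w)) (at (snd c p)) u =
        g p (tvec_of A c p (\<Gamma> c (snd c p) u v)) (tvec_of A c p w) +
        g p (tvec_of A c p v) (tvec_of A c p (\<Gamma> c (snd c p) u w)))"


section \<open>Finsler metrics\<close>

definition local_rep ::
  "('a, 'e::euclidean_space) chart set \<Rightarrow> ('a \<Rightarrow> ('a, 'e) tvec \<Rightarrow> real) \<Rightarrow> ('a, 'e) chart \<Rightarrow>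
   'e \<times> 'e \<Rightarrow> real" where
  "local_rep A F c = (\<lambda>(x, \<xi>). F (cinv c x) (tvec_of A c (cinv c x) \<xi>))"

definition fundamental_tensor ::
  "('a \<Rightarrow> ('a, 'e::euclidean_space) tvec \<Rightarrow> real) \<Rightarrow> 'a \<Rightarrow> ('a, 'e) tvec \<Rightarrow>
   ('a, 'e) tvec \<Rightarrow> ('a, 'e) tvec \<Rightarrow> real" where
  "fundamental_tensor F p v u w =
     1/2 * deriv (\<lambda>s. deriv (\<lambda>t. (F p (\<lambda>c. v c + s *\<^sub>R u c + t *\<^sub>R w c))\<^sup>2) 0) 0"

text \<open>
  Continuity and smoothness of \<open>F\<close> on \<open>TM\<close> and on \<open>TM\<close> minus the zero section are expressed in
  the induced charts of \<open>TM\<close>. The last clause says that the second derivative at \<open>v\<close> of \<open>F\<^sup>2\<close>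
  restricted to the tangent space, which is twice the fundamental tensor, is positive definite.
\<close>

definition finsler_metric ::
  "'a topology \<Rightarrow> ('a, 'e::euclidean_space) chart set \<Rightarrow> ('a \<Rightarrow> ('a, 'e) tvec \<Rightarrow> real) \<Rightarrow> bool" where
  "finsler_metric M A F \<longleftrightarrow>
     (\<forall>p\<in>topspace M. \<forall>v\<in>tangent_space A p.
        F p v \<ge> 0 \<and> (v \<noteq> tzero \<longrightarrow> F p v > 0) \<and>
        (\<forall>r>0. F p (\<lambda>c. r *\<^sub>R v c) = r * F p v)) \<and>
     (\<forall>c\<in>A. continuous_on (snd c ` fst c \<times> UNIV) (local_rep A F c)) \<and>
     (\<forall>c\<in>A. smooth_on (snd c ` fst c \<times> (UNIV - {0})) (local_rep A F c)) \<and>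
     (\<forall>p\<in>topspace M. \<forall>v\<in>tangent_space A p. \<forall>u\<in>tangent_space A p.
        v \<noteq> tzero \<and> u \<noteq> tzero \<longrightarrow> fundamental_tensor F p v u u > 0)"

text \<open>
  Nonconstant solutions of the Euler-Lagrange equation
  \<open>d/dt (\<partial>L/\<partial>\<xi>)(\<gamma>, \<gamma>') = (\<partial>L/\<partial>x)(\<gamma>, \<gamma>')\<close> of \<open>L = F\<^sup>2\<close>, on open intervals.
  Constancy of \<open>F(\<gamma>')\<close> follows (conservation of energy), and any constant speed is allowed.
\<close>

definition finsler_geodesic ::
  "'a topology \<Rightarrow> ('a, 'e::euclidean_space) chart set \<Rightarrow> ('a \<Rightarrow> ('a, 'e) tvec \<Rightarrow> real) \<Rightarrow>
   real set \<Rightarrow> (real \<Rightarrow> 'a) \<Rightarrow> bool" where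
  "finsler_geodesic M A F I \<gamma> \<longleftrightarrow>
     smooth_curve M A I \<gamma> \<and> \<not> \<gamma> constant_on I \<and>
     (\<forall>c\<in>A. \<forall>t\<in>I. \<gamma> t \<in> fst c \<longrightarrow> (\<forall>e.
        let L = (\<lambda>z. (local_rep A F c z)\<^sup>2); z = (\<lambda>s. (snd c (\<gamma> s), velocity A \<gamma> s c))
        in ((\<lambda>s. frechet_derivative L (at (z s)) (0, e)) has_real_derivative
              frechet_derivative L (at (z t)) (e, 0)) (at t)))"

text \<open>\<open>\<gamma>\<close> is embedded on \<open>J\<close>, and \<open>V\<close> extends its velocity to a non-vanishing field on \<open>U\<close>.\<close>

definition osculating_field ::
  "'a topology \<Rightarrow> ('a, 'e::euclidean_space) chart set \<Rightarrow> real set \<Rightarrow> (real \<Rightarrow> 'a) \<Rightarrow>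
   'a set \<Rightarrow> ('a \<Rightarrow> ('a, 'e) tvec) \<Rightarrow> bool" where
  "osculating_field M A J \<gamma> U V \<longleftrightarrow>
     embedding_map (top_of_set J) M \<gamma> \<and> openin M U \<and> \<gamma> ` J \<subseteq> U \<and>
     smooth_vector_field_on A U V \<and> (\<forall>p\<in>U. V p \<noteq> tzero) \<and>
     (\<forall>t\<in>J. V (\<gamma> t) = velocity A \<gamma> t)"

definition osculating_metric ::
  "('a \<Rightarrow> ('a, 'e::euclidean_space) tvec \<Rightarrow> real) \<Rightarrow> ('a \<Rightarrow> ('a, 'e) tvec) \<Rightarrow>
   'a \<Rightarrow> ('a, 'e) tvec \<Rightarrow> ('a, 'e) tvec \<Rightarrow> real" where
  "osculating_metric F V = (\<lambda>q. fundamental_tensor F q (V q))"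

text \<open>
  A geodesic is embedded on short intervals, so the covariant derivative is formed locally: near
  every parameter an osculating metric is chosen; the result does not depend on the choice.
\<close>

definition linearly_parallel ::
  "'a topology \<Rightarrow> ('a, 'e::euclidean_space) chart set \<Rightarrow> ('a \<Rightarrow> ('a, 'e) tvec \<Rightarrow> real) \<Rightarrow>
   real set \<Rightarrow> (real \<Rightarrow> 'a) \<Rightarrow> (real \<Rightarrow> ('a, 'e) tvec) \<Rightarrow> bool" where
  "linearly_parallel M A F I \<gamma> W \<longleftrightarrow>
     smooth_field_along A I \<gamma> W \<and>
     (\<forall>t\<in>I. \<exists>J U V \<Gamma>. open J \<and> is_interval J \<and> t \<in> J \<and> J \<subseteq> I \<and>
        osculating_field M A J \<gamma> U V \<and> levi_civita_on A U (osculating_metric F V) \<Gamma> \<and>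
        (\<forall>s\<in>J. cov_deriv_along A \<Gamma> \<gamma> W s = tzero))"

text \<open>
  As geodesics of every speed are admitted, equality of the two sets of parametrized geodesics
  already accounts for affine reparametrization.
\<close>

definition affinely_equivalent ::
  "'a topology \<Rightarrow> ('a, 'e::euclidean_space) chart set \<Rightarrow> ('a \<Rightarrow> ('a, 'e) tvec \<Rightarrow> real) \<Rightarrow>
   ('a \<Rightarrow> ('a, 'e) tvec \<Rightarrow> real) \<Rightarrow> bool" where
  "affinely_equivalent M A F G \<longleftrightarrow>
     (\<forall>I \<gamma>. finsler_geodesic M A F I \<gamma> \<longleftrightarrow> finsler_geodesic M A G I \<gamma>)"

definition riemannian_norm ::
  "('a \<Rightarrow> ('a, 'e) tvec \<Rightarrow> ('a, 'e) tvec \<Rightarrow> real) \<Rightarrow> 'a \<Rightarrow> ('a, 'e) tvec \<Rightarrow> real" where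
  "riemannian_norm g p v = sqrt (g p v v)"

definition berwald ::
  "'a topology \<Rightarrow> ('a, 'e::euclidean_space) chart set \<Rightarrow> ('a \<Rightarrow> ('a, 'e) tvec \<Rightarrow> real) \<Rightarrow> bool" where
  "berwald M A F \<longleftrightarrow>
     (\<exists>\<Gamma>. affine_connection A (topspace M) \<Gamma> \<and> torsion_free A (topspace M) \<Gamma> \<and>
        (\<forall>I \<gamma>. finsler_geodesic M A F I \<gamma> \<longrightarrow> connection_geodesic M A \<Gamma> I \<gamma>))"

end

theory Submission
  imports Defs
begin

text \<open>
  In a chart, let \<open>G\<close> be the spray of \<open>F\<close> and \<open>N(x,v) = \<partial>G/\<partial>v\<close>. Linear parallel transport along a
  geodesic \<open>x\<close> is \<open>w' = - N(x,x') w\<close>, so its invariance means \<open>dF(x,w)(v, - N(x,v) w) = 0\<close> for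
  all nonzero \<open>v\<close> and \<open>w\<close>. This no longer refers to geodesics: along every coordinate line with
  direction \<open>v\<close>, the equation \<open>w' = - N(x,v) w\<close> transports the norms \<open>F(x,\<cdot>)\<close> into each other.
  A \<open>GL\<close>-equivariant assignment of an inner product to each norm therefore yields a Riemannian
  metric \<open>g\<close> with \<open>\<partial>\<^sub>v g = g(N(x,v)\<cdot>,\<cdot>) + g(\<cdot>,N(x,v)\<cdot>)\<close>; this equation makes \<open>g\<close> smooth although
  nothing is known about the regularity of the assignment. If \<open>\<Gamma>\<close> is the Levi-Civita connection of
  \<open>g\<close>, then \<open>N(x,v) - \<Gamma>(v,\<cdot>)\<close> is \<open>g\<close>-skew. It is the derivative of \<open>v \<mapsto> G(x,v) - \<Gamma>(v,v)/2\<close>, which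
  is thus a Killing field of a Euclidean space and homogeneous of degree two, hence zero. So \<open>F\<close> and
  \<open>g\<close> have the same spray.
\<close>

section \<open>Calculus of smooth maps\<close>

text \<open>Along one geodesic, parallel transport sees \<open>N(x,v)\<close> only at the velocity
  of that geodesic and does not compare fibres along a fixed direction. The hypothesis is therefore
  used infinitesimally: short geodesics start with every position and velocity, and the derivative
  at time zero is an identity in the independent vectors \<open>v\<close> and \<open>w\<close>.
  There \<open>v\<close> can be frozen along a line.

  The inner product is found by minimization, where uniqueness alone gives equivariance. Regularity
  then costs a bootstrap: the derivative formula expresses the derivative of \<open>g\<close>
  through \<open>g\<close> itself with smooth coefficients, Gronwall's inequality makes
  \<open>g\<close> continuous, and each order of differentiability yields the next.

  Only directions \<open>v \<noteq> 0\<close> are available, since \<open>F\<close> is not assumed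
  smooth on the zero section and \<open>N(x,v)\<close> is not known to be linear in
  \<open>v\<close>. Hence the Killing field lives on a punctured space, and homogeneity, instead of
  a value at the origin, excludes the remaining affine fields. The factor 1/2 in \<Gamma>(v,v)/2
  reflects the normalization x'' = - 2 G of the spray.\<close>

abbreviation fd :: "('x::real_normed_vector \<Rightarrow> 'y::real_normed_vector) \<Rightarrow> 'x \<Rightarrow> 'x \<Rightarrow> 'y" where
  "fd f x \<equiv> frechet_derivative f (at x)"

declare Ck_on.simps(2) [simp del]

lemma fd_eq: "(f has_derivative f') (at x) \<Longrightarrow> fd f x = f'"
  by (metis frechet_derivative_at)

text \<open>\<open>frechet_derivative\<close> chooses among the candidates for the derivative, and
  two functions that agree near \<open>x\<close> have the same candidates. Hence the choices agree
  even where no derivative exists.\<close>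

lemma fd_cong:
  assumes "open S" "x \<in> S" "\<And>y. y \<in> S \<Longrightarrow> f y = g y"
  shows "fd f x = fd g x"
proof -
  have "(f has_derivative f') (at x) \<longleftrightarrow> (g has_derivative f') (at x)" for f'
    using assms by (metis has_derivative_transform_within_open)
  then show ?thesis
    unfolding frechet_derivative_def by simp
qed

section \<open>Closure properties of the classes of finite differentiability\<close>

lemma Ck_on_cong:
  assumes "open S" "\<And>x. x \<in> S \<Longrightarrow> f x = g x" "Ck_on k f S"
  shows "Ck_on k g S"
  using assms(2,3)
proof (induction k arbitrary: f g)
  case 0
  then show ?case by (auto cong: continuous_on_cong)
next
  case (Suc k)
  have "g differentiable (at x)" if "x \<in> S" for x
    using Suc.prems that assms(1) by (metis Ck_on.simps(2) differentiable_def has_derivative_transform_within_open)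
  moreover have "Ck_on k (\<lambda>x. fd g x v) S" for v
  proof (rule Suc.IH[of "\<lambda>x. fd f x v"])
    show "fd f x v = fd g x v" if "x \<in> S" for x
      using fd_cong[OF assms(1) that, of f g] Suc.prems(1) by simp
  qed (use Suc.prems in \<open>simp add: Ck_on.simps(2)\<close>)
  ultimately show ?case by (simp add: Ck_on.simps(2))
qed

lemma Ck_on_lower: "Ck_on (Suc k) f S \<Longrightarrow> Ck_on k f S"
proof (induction k arbitrary: f)
  case 0
  then show ?case
    by (simp add: Ck_on.simps(2) continuous_at_imp_continuous_on differentiable_imp_continuous_within)
qed (auto simp: Ck_on.simps(2))

lemma Ck_on_le: "Ck_on n f S \<Longrightarrow> m \<le> n \<Longrightarrow> Ck_on m f S"
proof (induction n)
  case (Suc n)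
  then show ?case by (metis Ck_on_lower le_Suc_eq)
qed auto

lemma Ck_on_subset: "Ck_on k f S \<Longrightarrow> T \<subseteq> S \<Longrightarrow> Ck_on k f T"
  by (induction k arbitrary: f) (auto simp: Ck_on.simps(2) intro: continuous_on_subset)

lemma Ck_on_SucI:
  assumes "open S" "\<And>x. x \<in> S \<Longrightarrow> (f has_derivative f' x) (at x)" "\<And>v. Ck_on k (\<lambda>x. f' x v) S"
  shows "Ck_on (Suc k) f S"
proof -
  have "fd f x v = f' x v" if "x \<in> S" for x v
    using fd_eq[OF assms(2)[OF that]] by simp
  then have "Ck_on k (\<lambda>x. fd f x v) S" for v
    using Ck_on_cong[OF assms(1), of "\<lambda>x. f' x v" "\<lambda>x. fd f x v"] assms(3) by simp
  then show ?thesis using assms(2) by (auto simp: Ck_on.simps(2) differentiable_def)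
qed

lemma Ck_on_SucD: "Ck_on (Suc k) f S \<Longrightarrow> x \<in> S \<Longrightarrow> (f has_derivative fd f x) (at x)"
  using frechet_derivative_works by (auto simp: Ck_on.simps(2))

lemma Ck_on_fd: "Ck_on (Suc k) f S \<Longrightarrow> Ck_on k (\<lambda>x. fd f x v) S"
  by (simp add: Ck_on.simps(2))

lemma Ck_on_const: "Ck_on k (\<lambda>x. c) S"
  by (induction k arbitrary: c) (auto simp: Ck_on.simps(2))

lemma Ck_on_linear:
  assumes "open S" "bounded_linear h"
  shows "Ck_on k f S \<Longrightarrow> Ck_on k (\<lambda>x. h (f x)) S"
proof (induction k arbitrary: f)
  case 0
  then show ?case using assms by (auto intro: bounded_linear.continuous_on)
next
  case (Suc k)
  show ?case
    using bounded_linear.has_derivative[OF assms(2) Ck_on_SucD[OF Suc.prems]] Suc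
    by (intro Ck_on_SucI[OF assms(1)]) (auto intro: Ck_on_fd)
qed

lemma Ck_on_add:
  assumes "open S"
  shows "Ck_on k f S \<Longrightarrow> Ck_on k g S \<Longrightarrow> Ck_on k (\<lambda>x. f x + g x) S"
proof (induction k arbitrary: f g)
  case 0
  then show ?case by (auto intro: continuous_on_add)
next
  case (Suc k)
  show ?case
    by (rule Ck_on_SucI[OF assms has_derivative_add[OF Ck_on_SucD[OF Suc.prems(1)] Ck_on_SucD[OF Suc.prems(2)]]])
      (use Suc in \<open>auto intro: Ck_on_fd\<close>)
qed

lemma Ck_on_sum:
  assumes "open S" "\<And>i. i \<in> J \<Longrightarrow> Ck_on k (f i) S"
  shows "Ck_on k (\<lambda>x. \<Sum>i\<in>J. f i x) S"
  using assms(2)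
  by (induction J rule: infinite_finite_induct) (auto intro: Ck_on_const Ck_on_add assms(1))

lemma Ck_on_bilinear:
  assumes "open S" "bounded_bilinear bl"
  shows "Ck_on k f S \<Longrightarrow> Ck_on k g S \<Longrightarrow> Ck_on k (\<lambda>x. bl (f x) (g x)) S"
proof (induction k arbitrary: f g)
  case 0
  then show ?case using assms by (auto intro: bounded_bilinear.continuous_on)
next
  case (Suc k)
  show ?case
    by (rule Ck_on_SucI[OF assms(1) bounded_bilinear.FDERIV[OF assms(2) Ck_on_SucD[OF Suc.prems(1)] Ck_on_SucD[OF Suc.prems(2)]]])
      (use Suc in \<open>auto intro!: Ck_on_add[OF assms(1)] dest: Ck_on_fd Ck_on_lower\<close>)
qed

lemma linear_eq_sum_Basis:
  fixes h :: "'e::euclidean_space \<Rightarrow> 'y::real_vector"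
  assumes "linear h"
  shows "h v = (\<Sum>i\<in>Basis. (v \<bullet> i) *\<^sub>R h i)"
  by (metis (no_types, lifting) assms euclidean_representation linear_scale linear_sum sum.cong)

text \<open>In the chain rule the direction \<open>fd g x v\<close> moves with \<open>x\<close>,
  whereas the induction hypothesis speaks of derivatives of \<open>f\<close> in a fixed direction.
  Expansion in \<open>Basis\<close> turns the derivative of the composite into a finite sum of
  components of \<open>fd g x v\<close> times \<open>fd f (g x) i\<close>.\<close>

lemma Ck_on_compose:
  fixes g :: "'x::real_normed_vector \<Rightarrow> 'e::euclidean_space"
  assumes "open S" "open T" "g ` S \<subseteq> T"
  shows "Ck_on k f T \<Longrightarrow> Ck_on k g S \<Longrightarrow> Ck_on k (\<lambda>x. f (g x)) S"
proof (induction k arbitrary: f)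
  case 0
  then show ?case using assms(3) by (auto intro: continuous_on_compose2)
next
  case (Suc k)
  have der: "((\<lambda>x. f (g x)) has_derivative (\<lambda>v. fd f (g x) (fd g x v))) (at x)" if "x \<in> S" for x
    by (rule has_derivative_compose[OF Ck_on_SucD[OF Suc.prems(2) that] Ck_on_SucD[OF Suc.prems(1)]])
      (use assms(3) that in auto)
  have "fd f (g x) (fd g x v) = (\<Sum>i\<in>Basis. (fd g x v \<bullet> i) *\<^sub>R fd f (g x) i)" if "x \<in> S" for x v
  proof (rule linear_eq_sum_Basis)
    show "linear (fd f (g x))"
      using Ck_on_SucD[OF Suc.prems(1)] assms(3) that has_derivative_linear by blast
  qed
  moreover have "Ck_on k (\<lambda>x. \<Sum>i\<in>Basis. (fd g x v \<bullet> i) *\<^sub>R fd f (g x) i) S" for v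
  proof (rule Ck_on_sum[OF assms(1)])
    fix i :: 'e
    have "Ck_on k (\<lambda>x. fd f (g x) i) S"
      using Suc.IH[of "\<lambda>y. fd f y i"] Ck_on_fd[OF Suc.prems(1)] Ck_on_lower[OF Suc.prems(2)] by blast
    then show "Ck_on k (\<lambda>x. (fd g x v \<bullet> i) *\<^sub>R fd f (g x) i) S"
      by (intro Ck_on_bilinear[OF assms(1) bounded_bilinear_scaleR]
          Ck_on_linear[OF assms(1) bounded_linear_inner_left] Ck_on_fd[OF Suc.prems(2)])
  qed
  ultimately have "Ck_on k (\<lambda>x. fd f (g x) (fd g x v)) S" for v
    using Ck_on_cong[OF assms(1), of "\<lambda>x. \<Sum>i\<in>Basis. (fd g x v \<bullet> i) *\<^sub>R fd f (g x) i"
        "\<lambda>x. fd f (g x) (fd g x v)"] by simp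
  then show ?case using Ck_on_SucI[OF assms(1) der] by blast
qed

text \<open>The derivative of the reciprocal contains the reciprocal once more, so one order is
  gained at each induction step.\<close>

lemma Ck_on_inverse:
  fixes f :: "'x::real_normed_vector \<Rightarrow> real"
  assumes "open S" "\<And>x. x \<in> S \<Longrightarrow> f x \<noteq> 0"
  shows "Ck_on k f S \<Longrightarrow> Ck_on k (\<lambda>x. inverse (f x)) S"
proof (induction k)
  case 0
  then show ?case using assms(2) by (auto intro: continuous_on_inverse)
next
  case (Suc k)
  have "Ck_on k (\<lambda>x. - (inverse (f x) * fd f x v * inverse (f x))) S" for v
    using Suc.IH Ck_on_lower[OF Suc.prems] Ck_on_fd[OF Suc.prems]
    by (intro Ck_on_linear[OF assms(1) bounded_linear_minus[OF bounded_linear_ident]]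
          Ck_on_bilinear[OF assms(1) bounded_bilinear_mult]) auto
  then show ?case
    by (intro Ck_on_SucI[OF assms(1) Deriv.has_derivative_inverse[OF assms(2) Ck_on_SucD[OF Suc.prems]]]) auto
qed

section \<open>Closure properties of smooth maps\<close>

lemma smooth_on_open: "smooth_on S f \<Longrightarrow> open S"
  by (simp add: smooth_on_def)

lemma smooth_on_subset: "smooth_on S f \<Longrightarrow> open T \<Longrightarrow> T \<subseteq> S \<Longrightarrow> smooth_on T f"
  unfolding smooth_on_def by (metis Ck_on_subset)

lemma smooth_on_cong: "smooth_on S f \<Longrightarrow> (\<And>x. x \<in> S \<Longrightarrow> f x = g x) \<Longrightarrow> smooth_on S g"
  using Ck_on_cong[of S f g] by (auto simp: smooth_on_def)

lemma smooth_on_has_derivative: "smooth_on S f \<Longrightarrow> x \<in> S \<Longrightarrow> (f has_derivative fd f x) (at x)"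
  unfolding smooth_on_def by (meson Ck_on_SucD)

lemma smooth_on_linear_fd: "smooth_on S f \<Longrightarrow> x \<in> S \<Longrightarrow> linear (fd f x)"
  using smooth_on_has_derivative has_derivative_linear by blast

lemma smooth_on_continuous: "smooth_on S f \<Longrightarrow> continuous_on S f"
  unfolding smooth_on_def using Ck_on.simps(1) by blast

lemma smooth_on_isCont: "smooth_on S f \<Longrightarrow> x \<in> S \<Longrightarrow> isCont f x"
  using smooth_on_continuous smooth_on_open continuous_on_eq_continuous_at by blast

lemma smooth_on_fd: "smooth_on S f \<Longrightarrow> smooth_on S (\<lambda>x. fd f x v)"
  by (simp add: smooth_on_def Ck_on_fd)

lemma smooth_onI_derivative:
  assumes "open S" "\<And>x. x \<in> S \<Longrightarrow> (f has_derivative f' x) (at x)" "\<And>v. smooth_on S (\<lambda>x. f' x v)"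
  shows "smooth_on S f"
proof -
  have "Ck_on k f S" for k
    by (rule Ck_on_lower, rule Ck_on_SucI[OF assms(1,2)]) (use assms(3) in \<open>auto simp: smooth_on_def\<close>)
  then show ?thesis using assms(1) by (simp add: smooth_on_def)
qed

lemma smooth_on_const: "open S \<Longrightarrow> smooth_on S (\<lambda>x. c)"
  by (simp add: smooth_on_def Ck_on_const)

lemma smooth_on_ident: "open S \<Longrightarrow> smooth_on S (\<lambda>x. x)"
  by (rule smooth_onI_derivative[where f' = "\<lambda>x v. v"]) (auto intro: smooth_on_const)

lemma smooth_on_linear: "bounded_linear h \<Longrightarrow> smooth_on S f \<Longrightarrow> smooth_on S (\<lambda>x. h (f x))"
  by (simp add: smooth_on_def Ck_on_linear)

lemma smooth_on_bilinear:
  "bounded_bilinear bl \<Longrightarrow> smooth_on S f \<Longrightarrow> smooth_on S g \<Longrightarrow> smooth_on S (\<lambda>x. bl (f x) (g x))"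
  by (simp add: smooth_on_def Ck_on_bilinear)

lemma smooth_on_add: "smooth_on S f \<Longrightarrow> smooth_on S g \<Longrightarrow> smooth_on S (\<lambda>x. f x + g x)"
  by (simp add: smooth_on_def Ck_on_add)

lemma smooth_on_minus: "smooth_on S f \<Longrightarrow> smooth_on S (\<lambda>x. - f x)"
  by (rule smooth_on_linear[OF bounded_linear_minus[OF bounded_linear_ident]])

lemma smooth_on_diff: "smooth_on S f \<Longrightarrow> smooth_on S g \<Longrightarrow> smooth_on S (\<lambda>x. f x - g x)"
  using smooth_on_add[OF _ smooth_on_minus, of S f g] by simp

lemma smooth_on_sum: "open S \<Longrightarrow> (\<And>i. i \<in> J \<Longrightarrow> smooth_on S (f i)) \<Longrightarrow> smooth_on S (\<lambda>x. \<Sum>i\<in>J. f i x)"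
  by (simp add: smooth_on_def Ck_on_sum)

lemmas smooth_on_scaleR = smooth_on_bilinear[OF bounded_bilinear_scaleR]
lemmas smooth_on_mult = smooth_on_bilinear[OF bounded_bilinear_mult]
lemmas smooth_on_fst = smooth_on_linear[OF bounded_linear_fst]
lemmas smooth_on_snd = smooth_on_linear[OF bounded_linear_snd]

lemma smooth_on_Pair:
  assumes "smooth_on S f" "smooth_on S g"
  shows "smooth_on S (\<lambda>x. (f x, g x))"
proof -
  have "bounded_linear (\<lambda>y. (y, 0))" "bounded_linear (Pair 0)"
    by (auto intro!: bounded_linear_Pair bounded_linear_ident bounded_linear_zero)
  then have "smooth_on S (\<lambda>x. (f x, 0) + (0, g x))"
    using smooth_on_add[OF smooth_on_linear[OF _ assms(1)] smooth_on_linear[OF _ assms(2)]] by blast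
  then show ?thesis by simp
qed

lemma smooth_on_compose:
  fixes g :: "'x::real_normed_vector \<Rightarrow> 'e::euclidean_space"
  shows "smooth_on T f \<Longrightarrow> smooth_on S g \<Longrightarrow> g ` S \<subseteq> T \<Longrightarrow> smooth_on S (\<lambda>x. f (g x))"
  unfolding smooth_on_def by (intro conjI allI Ck_on_compose[of S T g _ f]) auto

text \<open>For operators known to be smooth only on constant arguments: expanding the moving
  argument in \<open>Basis\<close> leaves finitely many products of smooth functions. Fibrewise
  linear objects such as metrics, differentials and \<open>ncon\<close> are handled in this
  way.\<close>

lemma smooth_on_apply_linear:
  fixes h :: "'x::real_normed_vector \<Rightarrow> 'e::euclidean_space"
  assumes "\<And>v. smooth_on S (\<lambda>x. l x v)" "\<And>x. x \<in> S \<Longrightarrow> linear (l x)" "smooth_on S h"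
  shows "smooth_on S (\<lambda>x. l x (h x))"
proof (rule smooth_on_cong)
  show "smooth_on S (\<lambda>x. \<Sum>i\<in>Basis. (h x \<bullet> i) *\<^sub>R l x i)"
    using assms smooth_on_open
    by (intro smooth_on_sum smooth_on_scaleR smooth_on_linear[OF bounded_linear_inner_left]) auto
qed (simp add: linear_eq_sum_Basis[OF assms(2), symmetric])

lemma smooth_on_fd_dir:
  fixes g h :: "'x::real_normed_vector \<Rightarrow> 'e::euclidean_space"
  assumes "smooth_on T f" "smooth_on S g" "smooth_on S h" "g ` S \<subseteq> T"
  shows "smooth_on S (\<lambda>x. fd f (g x) (h x))"
  by (rule smooth_on_apply_linear[OF smooth_on_compose[OF smooth_on_fd[OF assms(1)] assms(2)] _ assms(3)])
    (use assms smooth_on_linear_fd in blast)+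

text \<open>Expansion in \<open>Basis\<close> reduces the evaluation of a moving linear map at a
  moving vector to finitely many ordinary products.\<close>

lemma has_derivative_apply_linear:
  fixes h :: "'x::real_normed_vector \<Rightarrow> 'e::euclidean_space"
    and l :: "'x \<Rightarrow> 'e \<Rightarrow> 'y::real_normed_vector"
  assumes l: "\<And>v. ((\<lambda>x. l x v) has_derivative l' v) (at x)"
    and lin: "open S" "x \<in> S" "\<And>y. y \<in> S \<Longrightarrow> linear (l y)"
    and h: "(h has_derivative h') (at x)"
  shows "((\<lambda>y. l y (h y)) has_derivative (\<lambda>v. l' (h x) v + l x (h' v))) (at x)"
proof -
  have "((\<lambda>y. \<Sum>i\<in>Basis. (h y \<bullet> i) *\<^sub>R l y i) has_derivative
      (\<lambda>v. \<Sum>i\<in>Basis. (h x \<bullet> i) *\<^sub>R l' i v + (h' v \<bullet> i) *\<^sub>R l x i)) (at x)"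
    by (intro has_derivative_sum has_derivative_scaleR has_derivative_inner_left h l)
  then have 1: "((\<lambda>y. l y (h y)) has_derivative
      (\<lambda>v. \<Sum>i\<in>Basis. (h x \<bullet> i) *\<^sub>R l' i v + (h' v \<bullet> i) *\<^sub>R l x i)) (at x)"
    by (rule has_derivative_transform_within_open[OF _ lin(1,2)]) (simp add: linear_eq_sum_Basis[OF lin(3), symmetric])
  \<comment> \<open>How \<open>l' v\<close> depends on \<open>v\<close> is not given. With the
    argument frozen at \<open>h x\<close>, uniqueness of the derivative shows that
    \<open>l' (h x)\<close> has the expansion in \<open>Basis\<close> that the product rule
    produced.\<close>
  have "((\<lambda>y. \<Sum>i\<in>Basis. (h x \<bullet> i) *\<^sub>R l y i) has_derivative (\<lambda>v. \<Sum>i\<in>Basis. (h x \<bullet> i) *\<^sub>R l' i v)) (at x)"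
    by (intro has_derivative_sum has_derivative_scaleR_right l)
  then have "((\<lambda>y. l y (h x)) has_derivative (\<lambda>v. \<Sum>i\<in>Basis. (h x \<bullet> i) *\<^sub>R l' i v)) (at x)"
    by (rule has_derivative_transform_within_open[OF _ lin(1,2)]) (simp add: linear_eq_sum_Basis[OF lin(3), symmetric])
  then have 2: "l' (h x) = (\<lambda>v. \<Sum>i\<in>Basis. (h x \<bullet> i) *\<^sub>R l' i v)"
    using has_derivative_unique l by blast
  have 3: "(\<Sum>i\<in>Basis. (h' v \<bullet> i) *\<^sub>R l x i) = l x (h' v)" for v
    using linear_eq_sum_Basis[OF lin(3)[OF lin(2)], of "h' v"] by simp
  show ?thesis using 1 by (simp add: 2 3 sum.distrib)
qed

section \<open>Symmetry of second derivatives\<close>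

text \<open>Two mean value steps, one in each direction. The second difference on the left is
  symmetric in \<open>u\<close> and \<open>v\<close> while the derivative on the right is taken in a
  definite order; the comparison of both readings yields Schwarz's theorem.\<close>

lemma second_difference_mvt:
  fixes f :: "'x::real_normed_vector \<Rightarrow> real"
  assumes f: "\<And>z. z \<in> S \<Longrightarrow> (f has_derivative fd f z) (at z)"
    and fu: "\<And>z. z \<in> S \<Longrightarrow> ((\<lambda>z. fd f z u) has_derivative fd (\<lambda>z. fd f z u) z) (at z)"
    and t: "0 < t" and S: "\<And>s r. 0 \<le> s \<Longrightarrow> s \<le> t \<Longrightarrow> 0 \<le> r \<Longrightarrow> r \<le> t \<Longrightarrow> x + s *\<^sub>R u + r *\<^sub>R v \<in> S"
  shows "\<exists>z\<in>S. f (x + t *\<^sub>R u + t *\<^sub>R v) - f (x + t *\<^sub>R u) - f (x + t *\<^sub>R v) + f x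
           = t * t * fd (\<lambda>z. fd f z u) z v"
proof -
  define \<phi> where "\<phi> s = f (x + s *\<^sub>R u + t *\<^sub>R v) - f (x + s *\<^sub>R u + 0 *\<^sub>R v)" for s
  have dr: "((\<lambda>s. f (x + s *\<^sub>R u + r *\<^sub>R v)) has_real_derivative fd f (x + s *\<^sub>R u + r *\<^sub>R v) u) (at s)"
    if "0 \<le> s" "s \<le> t" "0 \<le> r" "r \<le> t" for s r
  proof -
    have "((\<lambda>s. f (x + s *\<^sub>R u + r *\<^sub>R v)) has_derivative (\<lambda>h. fd f (x + s *\<^sub>R u + r *\<^sub>R v) (h *\<^sub>R u))) (at s)"
      by (rule has_derivative_compose[where f = "\<lambda>s. x + s *\<^sub>R u + r *\<^sub>R v", OF _ f[OF S[OF that]]])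
        (auto intro!: derivative_eq_intros)
    then show ?thesis
      using has_derivative_linear[OF f[OF S[OF that]]]
      by (simp add: has_field_derivative_def linear_scale mult.commute mult_commute_abs)
  qed
  have "\<exists>s. 0 < s \<and> s < t \<and> \<phi> t - \<phi> 0 = (t - 0) * (fd f (x + s *\<^sub>R u + t *\<^sub>R v) u - fd f (x + s *\<^sub>R u + 0 *\<^sub>R v) u)"
    unfolding \<phi>_def by (rule MVT2[OF t]) (intro DERIV_diff dr; use t in simp)
  then obtain s where s: "0 < s" "s < t"
    "\<phi> t - \<phi> 0 = (t - 0) * (fd f (x + s *\<^sub>R u + t *\<^sub>R v) u - fd f (x + s *\<^sub>R u + 0 *\<^sub>R v) u)" by blast
  have dr2: "((\<lambda>r. fd f (x + s *\<^sub>R u + r *\<^sub>R v) u) has_real_derivative fd (\<lambda>z. fd f z u) (x + s *\<^sub>R u + r *\<^sub>R v) v) (at r)"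
    if "0 \<le> r" "r \<le> t" for r
  proof -
    have S': "x + s *\<^sub>R u + r *\<^sub>R v \<in> S" using S s that by simp
    have "((\<lambda>r. fd f (x + s *\<^sub>R u + r *\<^sub>R v) u) has_derivative (\<lambda>h. fd (\<lambda>z. fd f z u) (x + s *\<^sub>R u + r *\<^sub>R v) (h *\<^sub>R v))) (at r)"
      by (rule has_derivative_compose[where f = "\<lambda>r. x + s *\<^sub>R u + r *\<^sub>R v", OF _ fu[OF S']])
        (auto intro!: derivative_eq_intros)
    then show ?thesis
      using has_derivative_linear[OF fu[OF S']]
      by (simp add: has_field_derivative_def linear_scale mult.commute mult_commute_abs)
  qed
  have "\<exists>r. 0 < r \<and> r < t \<and> fd f (x + s *\<^sub>R u + t *\<^sub>R v) u - fd f (x + s *\<^sub>R u + 0 *\<^sub>R v) u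
      = (t - 0) * fd (\<lambda>z. fd f z u) (x + s *\<^sub>R u + r *\<^sub>R v) v"
    by (rule MVT2[OF t]) (use dr2 in auto)
  then obtain r where r: "0 < r" "r < t" "fd f (x + s *\<^sub>R u + t *\<^sub>R v) u - fd f (x + s *\<^sub>R u + 0 *\<^sub>R v) u
      = (t - 0) * fd (\<lambda>z. fd f z u) (x + s *\<^sub>R u + r *\<^sub>R v) v" by blast
  show ?thesis
    using s r S[of s r] by (intro bexI[of _ "x + s *\<^sub>R u + r *\<^sub>R v"]) (auto simp: \<phi>_def)
qed

lemma smooth_on_schwarz_real:
  fixes f :: "'x::real_normed_vector \<Rightarrow> real"
  assumes f: "smooth_on S f" "x \<in> S"
  shows "fd (\<lambda>z. fd f z u) x v = fd (\<lambda>z. fd f z v) x u"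
proof (rule ccontr)
  let ?A = "\<lambda>x. fd (\<lambda>z. fd f z u) x v" and ?B = "\<lambda>x. fd (\<lambda>z. fd f z v) x u"
  assume ne: "?A x \<noteq> ?B x"
  \<comment> \<open>Half the supposed gap: two errors below \<open>e\<close> cannot bridge
    it.\<close>
  define e where "e = \<bar>?A x - ?B x\<bar> / 2"
  have e: "e > 0" using ne by (simp add: e_def)
  have cont: "isCont ?A x" "isCont ?B x"
    by (rule smooth_on_isCont[OF smooth_on_fd[OF smooth_on_fd[OF f(1)]] f(2)])+
  obtain d1 where d1: "d1 > 0" "\<And>y. dist y x < d1 \<Longrightarrow> dist (?A y) (?A x) < e"
    using cont(1) e unfolding continuous_at_eps_delta by blast
  obtain d2 where d2: "d2 > 0" "\<And>y. dist y x < d2 \<Longrightarrow> dist (?B y) (?B x) < e"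
    using cont(2) e unfolding continuous_at_eps_delta by blast
  note d = d1 d2
  obtain d3 where d3: "d3 > 0" "ball x d3 \<subseteq> S"
    using f smooth_on_open open_contains_ball by metis
  define d0 where "d0 = min d1 (min d2 d3)"
  \<comment> \<open>The mesh is so small that the whole parallelogram lies in the ball; the summand
    1 covers \<open>u = v = 0\<close>.\<close>
  define t where "t = d0 / (2 * (norm u + norm v + 1))"
  have d0: "d0 > 0" using d d3 by (simp add: d0_def)
  have t: "t > 0" unfolding t_def using d0 by (simp add: add_nonneg_pos)
  have tuv: "t * norm u + t * norm v < d0"
  proof -
    have "t * norm u + t * norm v \<le> t * (norm u + norm v + 1)" using t by (simp add: algebra_simps)
    also have "\<dots> = d0 / 2"
    proof -
      have "norm u + norm v + 1 \<noteq> 0" by (smt (verit) norm_ge_zero)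
      then show ?thesis by (simp add: t_def field_simps)
    qed
    finally show ?thesis using d0 by simp
  qed
  have inb: "x + s *\<^sub>R u + r *\<^sub>R v \<in> ball x d0" if "0 \<le> s" "s \<le> t" "0 \<le> r" "r \<le> t" for s r
  proof -
    have "norm (s *\<^sub>R u + r *\<^sub>R v) \<le> s * norm u + r * norm v"
      by (rule norm_triangle_le) (use that in simp)
    also have "\<dots> \<le> t * norm u + t * norm v" using that by (intro add_mono mult_right_mono) auto
    finally have "norm (s *\<^sub>R u + r *\<^sub>R v) < d0" using tuv by simp
    moreover have "dist x (x + s *\<^sub>R u + r *\<^sub>R v) = norm (s *\<^sub>R u + r *\<^sub>R v)"
    proof -
      have "dist x (x + w) = norm w" for w by (simp add: dist_norm)
      from this[of "s *\<^sub>R u + r *\<^sub>R v"] show ?thesis by (simp only: add.assoc)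
    qed
    ultimately show ?thesis by simp
  qed
  have sub: "ball x d0 \<subseteq> S" using d3 by (auto simp: d0_def)
  have "\<exists>z\<in>ball x d0. f (x + t *\<^sub>R u + t *\<^sub>R v) - f (x + t *\<^sub>R u) - f (x + t *\<^sub>R v) + f x = t * t * ?A z"
    by (rule second_difference_mvt[OF _ _ t])
      (use sub inb smooth_on_has_derivative[OF f(1)] smooth_on_has_derivative[OF smooth_on_fd[OF f(1)]] in auto)
  moreover have "\<exists>z\<in>ball x d0. f (x + t *\<^sub>R v + t *\<^sub>R u) - f (x + t *\<^sub>R v) - f (x + t *\<^sub>R u) + f x = t * t * ?B z"
    by (rule second_difference_mvt[OF _ _ t])
      (use sub inb smooth_on_has_derivative[OF f(1)] smooth_on_has_derivative[OF smooth_on_fd[OF f(1)]]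
        in \<open>auto simp: add.assoc add.commute[of "_ *\<^sub>R v"]\<close>)
  ultimately obtain z w where zw: "z \<in> ball x d0" "w \<in> ball x d0" "t * t * ?A z = t * t * ?B w"
    by (smt (verit) add.commute add.left_commute)
  then have "?A z = ?B w" using t by simp
  moreover have "dist (?A z) (?A x) < e" "dist (?B w) (?B x) < e"
    using d zw(1,2) by (auto simp: d0_def intro!: d1(2) d2(2) simp: dist_commute[of x])
  ultimately show False unfolding e_def dist_real_def by argo
qed

lemma fd_inner:
  assumes "(f has_derivative f') (at x)"
  shows "fd (\<lambda>z. f z \<bullet> e) x v = f' v \<bullet> e"
  using fd_eq[OF has_derivative_inner_left[OF assms, of e]] by simp

lemma smooth_on_schwarz:
  fixes f :: "'x::real_normed_vector \<Rightarrow> 'y::euclidean_space"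
  assumes f: "smooth_on S f" "x \<in> S"
  shows "fd (\<lambda>z. fd f z u) x v = fd (\<lambda>z. fd f z v) x u"
proof -
  have *: "fd (\<lambda>z. fd f z u) x v \<bullet> e = fd (\<lambda>z. fd (\<lambda>z. f z \<bullet> e) z u) x v" for u v e
  proof -
    have "fd (\<lambda>z. fd f z u) x v \<bullet> e = fd (\<lambda>z. fd f z u \<bullet> e) x v"
      using fd_inner[OF smooth_on_has_derivative[OF smooth_on_fd[OF f(1)] f(2)]] by simp
    also have "\<dots> = fd (\<lambda>z. fd (\<lambda>z. f z \<bullet> e) z u) x v"
      by (rule fun_cong[OF fd_cong[OF smooth_on_open[OF f(1)] f(2)]])
        (simp add: fd_inner[OF smooth_on_has_derivative[OF f(1)]])
    finally show ?thesis .
  qed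
  show ?thesis
  proof (rule euclidean_eqI)
    fix e :: 'y assume "e \<in> Basis"
    show "fd (\<lambda>z. fd f z u) x v \<bullet> e = fd (\<lambda>z. fd f z v) x u \<bullet> e"
      unfolding * by (rule smooth_on_schwarz_real[OF smooth_on_linear[OF bounded_linear_inner_left f(1)] f(2)])
  qed
qed

section \<open>Smooth solutions of linear systems\<close>

text \<open>Continuity of \<open>c\<close> suffices because \<open>\<phi> y\<close> is of the order
  of \<open>y - x\<close>, so that \<open>(c y - c x) *\<^sub>R \<phi> y\<close> is of smaller
  order. In \<open>Ck_on_solve\<close> this product rule at a zero is applied to a solution known
  only to be continuous.\<close>

lemma has_derivative_scaleR_vanishing:
  fixes c :: "'x::real_normed_vector \<Rightarrow> real" and \<phi> :: "'x \<Rightarrow> 'y::real_normed_vector"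
  assumes c: "isCont c x" and \<phi>: "(\<phi> has_derivative \<phi>') (at x)" "\<phi> x = 0"
  shows "((\<lambda>y. c y *\<^sub>R \<phi> y) has_derivative (\<lambda>h. c x *\<^sub>R \<phi>' h)) (at x)"
proof -
  have "((\<lambda>y. (c y - c x) *\<^sub>R \<phi> y) has_derivative (\<lambda>h. 0)) (at x)"
    unfolding has_derivative_within_alt
  proof (intro conjI allI impI bounded_linear_zero)
    fix e :: real assume e: "e > 0"
    obtain K where K: "K > 0" "\<And>h. norm (\<phi>' h) \<le> norm h * K"
      using bounded_linear.pos_bounded[OF has_derivative_bounded_linear[OF \<phi>(1)]] by blast
    obtain d where d: "d > 0" "\<And>y. norm (y - x) < d \<Longrightarrow> norm (\<phi> y - \<phi> x - \<phi>' (y - x)) \<le> 1 * norm (y - x)"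
      using \<phi>(1) unfolding has_derivative_within_alt by (metis UNIV_I zero_less_one)
    have e': "e / (K + 1) > 0" using e K by simp
    then obtain d' where d': "d' > 0" "\<And>y. dist y x < d' \<Longrightarrow> dist (c y) (c x) < e / (K + 1)"
      using c unfolding continuous_at_eps_delta by blast
    have "norm ((c y - c x) *\<^sub>R \<phi> y - (c x - c x) *\<^sub>R \<phi> x - 0) \<le> e * norm (y - x)"
      if y: "norm (y - x) < min d d'" for y
    proof -
      have "norm (\<phi> y) \<le> norm (\<phi> y - \<phi>' (y - x)) + norm (\<phi>' (y - x))"
        by (metis diff_add_cancel norm_triangle_ineq)
      also have "\<dots> \<le> norm (y - x) + norm (y - x) * K"
        using d(2)[of y] y K(2)[of "y - x"] \<phi>(2) by (intro add_mono) auto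
      finally have 1: "norm (\<phi> y) \<le> (K + 1) * norm (y - x)" by (simp add: algebra_simps)
      have "\<bar>c y - c x\<bar> \<le> e / (K + 1)"
        using d'(2)[of y] y by (simp add: dist_norm)
      then have "\<bar>c y - c x\<bar> * norm (\<phi> y) \<le> e / (K + 1) * ((K + 1) * norm (y - x))"
        using 1 e' by (intro mult_mono) auto
      also have "\<dots> = e * norm (y - x)" using K by simp
      finally show ?thesis by simp
    qed
    then show "\<exists>d>0. \<forall>y\<in>UNIV. norm (y - x) < d \<longrightarrow>
        norm ((c y - c x) *\<^sub>R \<phi> y - (c x - c x) *\<^sub>R \<phi> x - 0) \<le> e * norm (y - x)"
      using d(1) d'(1) by (intro exI[of _ "min d d'"]) auto
  qed
  from has_derivative_add[OF this has_derivative_scaleR_right[OF \<phi>(1), of "c x"]]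
  show ?thesis by (simp add: scaleR_left_diff_distrib)
qed

text \<open>An injective linear map has a lower bound \<open>B\<close>; perturbing each of the
  \<open>DIM('e)\<close> images of basis vectors by less than \<open>B / (2 * DIM('e))\<close>
  consumes at most half of it. Uniformity in \<open>v\<close> is what makes solutions of perturbed
  systems converge.\<close>

lemma linear_family_bounded_below:
  fixes A :: "'x::real_normed_vector \<Rightarrow> 'e::euclidean_space \<Rightarrow> 'e"
  assumes S: "open S" "x0 \<in> S" and lin: "\<And>x. x \<in> S \<Longrightarrow> linear (A x)"
    and inj: "\<And>v. A x0 v = 0 \<Longrightarrow> v = 0" and cont: "\<And>e. isCont (\<lambda>x. A x e) x0"
  obtains l where "l > 0" "\<forall>\<^sub>F x in at x0. \<forall>v. l * norm v \<le> norm (A x v)"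
proof -
  have "inj (A x0)"
    using inj lin S(2) linear_injective_0 by blast
  then obtain B where B: "B > 0" "\<And>v. B * norm v \<le> norm (A x0 v)"
    using linear_inj_bounded_below_pos[OF lin[OF S(2)]] by blast
  define c where "c = B / (2 * real DIM('e))"
  have c: "c > 0" using B by (simp add: c_def)
  have "\<forall>\<^sub>F x in at x0. dist (A x i) (A x0 i) < c" for i
    using cont[of i] c by (simp add: isCont_def tendstoD)
  then have "\<forall>\<^sub>F x in at x0. \<forall>i\<in>Basis. dist (A x i) (A x0 i) < c"
    by (intro eventually_ball_finite) auto
  moreover have "\<forall>\<^sub>F x in at x0. x \<in> S" using S by (simp add: eventually_at_in_open')
  ultimately have "\<forall>\<^sub>F x in at x0. \<forall>v. B/2 * norm v \<le> norm (A x v)"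
  proof eventually_elim
    case (elim x)
    show ?case
    proof
      fix v :: 'e
      have "A x v - A x0 v = (\<Sum>i\<in>Basis. (v \<bullet> i) *\<^sub>R (A x i - A x0 i))"
        using linear_eq_sum_Basis[OF lin[OF elim(2)], of v] linear_eq_sum_Basis[OF lin[OF S(2)], of v]
        by (simp add: sum_subtractf scaleR_right_diff_distrib)
      also have "norm \<dots> \<le> (\<Sum>i\<in>(Basis::'e set). norm v * c)"
        using elim(1) by (intro sum_norm_le) (auto simp: dist_norm Basis_le_norm less_imp_le intro!: mult_mono)
      also have "\<dots> = B/2 * norm v" by (simp add: c_def)
      finally have "norm (A x v - A x0 v) \<le> B/2 * norm v" .
      then show "B/2 * norm v \<le> norm (A x v)"
        using B(2)[of v] norm_triangle_ineq3[of "A x v" "A x0 v"] by argo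
    qed
  qed
  with B(1) that[of "B/2"] show thesis by simp
qed

text \<open>Differentiating the equation shows that \<open>fd u x v\<close> solves a system with the
  same operators and a right side of one order less. Hence the induction runs over all right sides
  and all solutions, and no inverse matrix or determinant has to be differentiated.\<close>

lemma Ck_on_solve:
  fixes A :: "'x::real_normed_vector \<Rightarrow> 'e::euclidean_space \<Rightarrow> 'e"
  assumes S: "open S" and lin: "\<And>x. x \<in> S \<Longrightarrow> linear (A x)"
    and inj: "\<And>x v. x \<in> S \<Longrightarrow> A x v = 0 \<Longrightarrow> v = 0"
  shows "(\<And>e. Ck_on k (\<lambda>x. A x e) S) \<Longrightarrow> Ck_on k r S \<Longrightarrow> (\<And>x. x \<in> S \<Longrightarrow> A x (u x) = r x) \<Longrightarrow> Ck_on k u S"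
proof (induction k arbitrary: r u)
  case (0 r u)
  have "isCont u x0" if x0: "x0 \<in> S" for x0
  proof -
    have cA: "isCont (\<lambda>x. A x e) x0" for e
      using 0(1)[of e] S x0 by (simp add: continuous_on_eq_continuous_at)
    have cr: "isCont r x0"
      using 0(2) S x0 by (simp add: continuous_on_eq_continuous_at)
    obtain l where l: "l > 0" "\<forall>\<^sub>F x in at x0. \<forall>v. l * norm v \<le> norm (A x v)"
      using linear_family_bounded_below[OF S x0 lin inj[OF x0] cA] by blast
    \<comment> \<open>The difference \<open>u x - u x0\<close> solves the system with right side
      \<open>r x - A x (u x0)\<close>, which tends to zero; the uniform lower bound transfers this
      to the solution.\<close>
    have "\<forall>\<^sub>F x in at x0. norm (u x - u x0) \<le> norm (r x - A x (u x0)) / l"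
      using l(2) eventually_at_in_open'[OF S x0]
    proof eventually_elim
      case (elim x)
      have "A x (u x - u x0) = r x - A x (u x0)"
        using 0(3)[OF elim(2)] linear_diff[OF lin[OF elim(2)]] by simp
      then have "l * norm (u x - u x0) \<le> norm (r x - A x (u x0))"
        using elim(1) by metis
      then show ?case using l(1) by (simp add: field_simps)
    qed
    moreover have "((\<lambda>x. norm (r x - A x (u x0)) / l) \<longlongrightarrow> norm (r x0 - A x0 (u x0)) / l) (at x0)"
      using cA cr l(1) by (intro tendsto_intros) (auto simp: isCont_def)
    then have "((\<lambda>x. norm (r x - A x (u x0)) / l) \<longlongrightarrow> 0) (at x0)"
      using 0(3)[OF x0] by simp
    ultimately have "((\<lambda>x. u x - u x0) \<longlongrightarrow> 0) (at x0)"
      by (rule Lim_null_comparison)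
    then show ?thesis by (simp add: isCont_def LIM_zero_iff)
  qed
  then show ?case by (simp add: continuous_at_imp_continuous_on)
next
  case (Suc k r u)
  have uk: "Ck_on k u S"
    using Suc.IH[of r u] Suc.prems Ck_on_lower by blast
  have u0: "isCont u x" if "x \<in> S" for x
    using Ck_on_le[OF uk, of 0] S that by (simp add: continuous_on_eq_continuous_at)
  \<comment> \<open>The right side of the differentiated system: the derivative of \<open>r\<close>
    minus the derivative of the operators applied to \<open>u x\<close>.\<close>
  define \<rho> where "\<rho> x v = fd r x v - (\<Sum>i\<in>Basis. (u x \<bullet> i) *\<^sub>R fd (\<lambda>x. A x i) x v)" for x v
  have der: "\<exists>u'. (u has_derivative u') (at x0) \<and> (\<forall>v. A x0 (u' v) = \<rho> x0 v)" if x0: "x0 \<in> S" for x0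
  proof -
    have "inj (A x0)" using inj lin x0 linear_injective_0 by blast
    then obtain C where C: "linear C" "C \<circ> A x0 = id"
      using linear_injective_left_inverse lin x0 by blast
    then have C': "A x0 \<circ> C = id" using linear_inverse_left lin x0 by blast
    have bC: "bounded_linear C" using C(1) linear_conv_bounded_linear by blast
    have "((\<lambda>x. \<Sum>i\<in>Basis. (u x \<bullet> i) *\<^sub>R (A x i - A x0 i)) has_derivative
        (\<lambda>v. \<Sum>i\<in>Basis. (u x0 \<bullet> i) *\<^sub>R fd (\<lambda>x. A x i) x0 v)) (at x0)"
    proof (rule has_derivative_sum, rule has_derivative_scaleR_vanishing)
      fix i :: 'e
      show "isCont (\<lambda>x. u x \<bullet> i) x0" using u0[OF x0] by (intro continuous_intros)
      show "((\<lambda>x. A x i - A x0 i) has_derivative fd (\<lambda>x. A x i) x0) (at x0)"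
        using has_derivative_diff[OF Ck_on_SucD[OF Suc.prems(1)[of i] x0] has_derivative_const[of "A x0 i"]]
        by simp
    qed simp
    then have "((\<lambda>x. C (r x - (\<Sum>i\<in>Basis. (u x \<bullet> i) *\<^sub>R (A x i - A x0 i)))) has_derivative (\<lambda>v. C (\<rho> x0 v))) (at x0)"
      unfolding \<rho>_def
      by (intro bounded_linear.has_derivative[OF bC] has_derivative_diff Ck_on_SucD[OF Suc.prems(2) x0])
    moreover have "C (r x - (\<Sum>i\<in>Basis. (u x \<bullet> i) *\<^sub>R (A x i - A x0 i))) = u x" if x: "x \<in> S" for x
    proof -
      have "A x (u x) - A x0 (u x) = (\<Sum>i\<in>Basis. (u x \<bullet> i) *\<^sub>R (A x i - A x0 i))"
        using linear_eq_sum_Basis[OF lin[OF x], of "u x"] linear_eq_sum_Basis[OF lin[OF x0], of "u x"]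
        by (simp add: sum_subtractf scaleR_right_diff_distrib)
      then have "r x - (\<Sum>i\<in>Basis. (u x \<bullet> i) *\<^sub>R (A x i - A x0 i)) = A x0 (u x)"
        using Suc.prems(3)[OF x] by (metis diff_diff_eq2 add_diff_cancel_left')
      then show ?thesis using C(2) by (metis comp_apply id_apply)
    qed
    ultimately have "(u has_derivative (\<lambda>v. C (\<rho> x0 v))) (at x0)"
      using has_derivative_transform_within_open[OF _ S x0] by blast
    moreover have "A x0 (C (\<rho> x0 v)) = \<rho> x0 v" for v using C' by (metis comp_apply id_apply)
    ultimately show ?thesis by blast
  qed
  have d1: "(u has_derivative fd u x) (at x)" if "x \<in> S" for x
    using der[OF that] fd_eq by blast
  have d2: "A x (fd u x v) = \<rho> x v" if "x \<in> S" for x v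
    using der[OF that] fd_eq by blast
  have "Ck_on k (\<lambda>x. fd u x v) S" for v
  proof (rule Suc.IH[where r = "\<lambda>x. \<rho> x v"])
    have "Ck_on k (\<lambda>x. (-1) *\<^sub>R (\<Sum>i\<in>Basis. (u x \<bullet> i) *\<^sub>R fd (\<lambda>x. A x i) x v)) S"
      using Ck_on_fd[OF Suc.prems(1)] uk
      by (intro Ck_on_linear[OF S bounded_linear_scaleR_right] Ck_on_sum[OF S]
          Ck_on_bilinear[OF S bounded_bilinear_scaleR] Ck_on_linear[OF S bounded_linear_inner_left]) auto
    from Ck_on_add[OF S Ck_on_fd[OF Suc.prems(2)] this]
    show "Ck_on k (\<lambda>x. \<rho> x v) S" unfolding \<rho>_def by simp
  qed (use Suc.prems(1) Ck_on_lower d2 in auto)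
  then show ?case using Ck_on_SucI[OF S d1] by blast
qed

section \<open>Inner products and index raising\<close>

definition inner_form :: "('e::real_vector \<Rightarrow> 'e \<Rightarrow> real) \<Rightarrow> bool" where
  "inner_form a \<longleftrightarrow> bilinear a \<and> (\<forall>u v. a u v = a v u) \<and> (\<forall>v. v \<noteq> 0 \<longrightarrow> a v v > 0)"

lemma inner_form_linear: "inner_form a \<Longrightarrow> linear (a u)" "inner_form a \<Longrightarrow> linear (\<lambda>u. a u v)"
  by (auto simp: inner_form_def bilinear_def)

lemma inner_form_simps:
  assumes "inner_form a"
  shows "a (u + v) w = a u w + a v w" "a w (u + v) = a w u + a w v"
    "a (r *\<^sub>R u) w = r * a u w" "a w (r *\<^sub>R u) = r * a w u"
    "a (u - v) w = a u w - a v w" "a w (u - v) = a w u - a w v"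
    "a (- u) w = - a u w" "a w (- u) = - a w u" "a 0 w = 0" "a w 0 = 0"
proof -
  note l = inner_form_linear(1)[OF assms, of w] inner_form_linear(2)[OF assms, of w]
  show "a (u + v) w = a u w + a v w" "a w (u + v) = a w u + a w v"
    "a (r *\<^sub>R u) w = r * a u w" "a w (r *\<^sub>R u) = r * a w u"
    "a (u - v) w = a u w - a v w" "a w (u - v) = a w u - a w v"
    "a (- u) w = - a u w" "a w (- u) = - a w u" "a 0 w = 0" "a w 0 = 0"
    using linear_add[OF l(1), of u v] linear_scale[OF l(1), of r u] linear_diff[OF l(1), of u v]
      linear_neg[OF l(1), of u] linear_0[OF l(1)]
      linear_add[OF l(2), of u v] linear_scale[OF l(2), of r u] linear_diff[OF l(2), of u v]
      linear_neg[OF l(2), of u] linear_0[OF l(2)]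
    by auto
qed

lemma inner_form_eqI:
  assumes "inner_form a" "\<And>e. a u e = a v e"
  shows "u = v"
proof (rule ccontr)
  assume "u \<noteq> v"
  then have "a (u - v) (u - v) > 0" using assms(1) by (simp add: inner_form_def)
  moreover have "a (u - v) (u - v) = a u (u - v) - a v (u - v)"
    using linear_diff[OF inner_form_linear(2)[OF assms(1)]] by blast
  ultimately show False using assms(2) by simp
qed

lemma inner_form_riesz:
  fixes a :: "'e::euclidean_space \<Rightarrow> 'e \<Rightarrow> real"
  assumes a: "inner_form a" and r: "linear r"
  shows "\<exists>u. \<forall>e. a u e = r e"
proof -
  define A where "A u = (\<Sum>i\<in>Basis. a u i *\<^sub>R i)" for u
  have *: "A u \<bullet> v = a u v" for u v
    using linear_eq_sum_Basis[OF inner_form_linear(1)[OF a], of u v]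
    by (simp add: A_def inner_sum_left inner_commute[of v] mult.commute)
  have "linear A"
    unfolding A_def
    by (intro linear_compose_sum ballI linearI) (auto simp: inner_form_simps[OF a] scaleR_add_left)
  moreover have "inj A"
    by (rule injI) (use inner_form_eqI[OF a] * in metis)
  ultimately have "surj A" by (rule linear_injective_imp_surjective) simp
  then obtain u where u: "A u = (\<Sum>i\<in>Basis. r i *\<^sub>R i)" by (metis surj_def)
  have "a u e = r e" for e
    using linear_eq_sum_Basis[OF r, of e]
    by (simp add: *[symmetric] u inner_sum_left inner_commute[of e] mult.commute)
  then show ?thesis by blast
qed

text \<open>Index raising: the vector that represents the covector \<open>r\<close> with respect to
  \<open>a\<close>. The choice is determined when \<open>a\<close> is an inner product and
  \<open>r\<close> is linear.\<close>

definition raise_form :: "('e \<Rightarrow> 'e \<Rightarrow> real) \<Rightarrow> ('e \<Rightarrow> real) \<Rightarrow> 'e::euclidean_space" where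
  "raise_form a r = (SOME u. \<forall>e. a u e = r e)"

lemma raise_form:
  assumes "inner_form a" "linear r"
  shows "a (raise_form a r) e = r e"
  using someI_ex[OF inner_form_riesz[OF assms]] by (simp add: raise_form_def)

text \<open>The Gram operator of the form turns the Riesz equation into a linear system with smooth
  coefficients, to which \<open>Ck_on_solve\<close> applies.\<close>

lemma smooth_on_raise_form:
  fixes a :: "'x::real_normed_vector \<Rightarrow> 'e::euclidean_space \<Rightarrow> 'e \<Rightarrow> real"
  assumes S: "open S" and a: "\<And>x. x \<in> S \<Longrightarrow> inner_form (a x)"
    and r: "\<And>x. x \<in> S \<Longrightarrow> linear (r x)"
    and sa: "\<And>u v. smooth_on S (\<lambda>x. a x u v)" and sr: "\<And>v. smooth_on S (\<lambda>x. r x v)"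
  shows "smooth_on S (\<lambda>x. raise_form (a x) (r x))"
proof -
  define A where "A x u = (\<Sum>i\<in>Basis. a x u i *\<^sub>R i)" for x u
  have *: "A x u \<bullet> v = a x u v" if "x \<in> S" for x u v
    using linear_eq_sum_Basis[OF inner_form_linear(1)[OF a[OF that]], of u v]
    by (simp add: A_def inner_sum_left inner_commute[of v] mult.commute)
  have "linear (A x)" if "x \<in> S" for x
    unfolding A_def
    by (intro linear_compose_sum ballI linearI) (auto simp: inner_form_simps[OF a[OF that]] scaleR_add_left)
  moreover have "v = 0" if "x \<in> S" "A x v = 0" for x v
    using *[OF that(1), of v v] that(2) a[OF that(1)] by (force simp: inner_form_def)
  moreover have "smooth_on S (\<lambda>x. A x e)" for e
    unfolding A_def by (intro smooth_on_sum S smooth_on_scaleR sa smooth_on_const)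
  then have "Ck_on k (\<lambda>x. A x e) S" for k e by (simp add: smooth_on_def)
  moreover have "smooth_on S (\<lambda>x. \<Sum>i\<in>Basis. r x i *\<^sub>R i)"
    by (intro smooth_on_sum S smooth_on_scaleR sr smooth_on_const)
  then have "Ck_on k (\<lambda>x. \<Sum>i\<in>Basis. r x i *\<^sub>R i) S" for k by (simp add: smooth_on_def)
  moreover have "A x (raise_form (a x) (r x)) = (\<Sum>i\<in>Basis. r x i *\<^sub>R i)" if "x \<in> S" for x
    unfolding A_def using raise_form[OF a[OF that] r[OF that]] by simp
  ultimately have "Ck_on k (\<lambda>x. raise_form (a x) (r x)) S" for k
    by (rule Ck_on_solve[OF S])
  then show ?thesis using S by (simp add: smooth_on_def)
qed

text \<open>The point is moved one coordinate at a time, and on each leg the mean value inequality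
  compares the partial derivative with its value at \<open>x\<close>. Only derivatives along
  coordinate lines enter, which is the form in which the derivative of \<open>chart_form\<close> is
  found.\<close>

lemma has_derivative_continuous_partials:
  fixes f :: "'e::euclidean_space \<Rightarrow> real"
  assumes S: "open S" "x \<in> S"
    and d: "\<And>x i. x \<in> S \<Longrightarrow> i \<in> Basis \<Longrightarrow> ((\<lambda>t. f (x + t *\<^sub>R i)) has_real_derivative f' x i) (at 0)"
    and c: "\<And>i. i \<in> Basis \<Longrightarrow> continuous_on S (\<lambda>x. f' x i)"
  shows "(f has_derivative (\<lambda>h. \<Sum>i\<in>Basis. (h \<bullet> i) * f' x i)) (at x)"
  unfolding has_derivative_within_alt
proof (intro conjI allI impI)
  show "bounded_linear (\<lambda>h. \<Sum>i\<in>Basis. (h \<bullet> i) * f' x i)"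
    by (intro bounded_linear_sum bounded_linear_mult_const bounded_linear_inner_left)
  fix e :: real assume e: "e > 0"
  define n where "n = real DIM('e)"
  have n: "n > 0" by (simp add: n_def)
  \<comment> \<open>One share of the error for each of the \<open>n\<close> legs; the radius
    \<open>d0 / n\<close> below keeps every leg of the path within \<open>d0\<close> of
    \<open>x\<close>.\<close>
  define \<eta> where "\<eta> = e / n"
  have \<eta>: "\<eta> > 0" using e n by (simp add: \<eta>_def)
  have "\<forall>\<^sub>F y in nhds x. \<bar>f' y i - f' x i\<bar> < \<eta>" if "i \<in> Basis" for i
  proof -
    have "isCont (\<lambda>x. f' x i) x"
      using c[OF that] S continuous_on_eq_continuous_at by blast
    then have "filterlim (\<lambda>x. f' x i) (nhds (f' x i)) (nhds x)"
      using tendsto_at_iff_tendsto_nhds[of "\<lambda>x. f' x i" x] by (simp add: continuous_at)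
    then show ?thesis using tendstoD[OF _ \<eta>] by (force simp: dist_real_def)
  qed
  then have "\<forall>\<^sub>F y in nhds x. \<forall>i\<in>Basis. \<bar>f' y i - f' x i\<bar> < \<eta>"
    by (intro eventually_ball_finite) auto
  moreover have "\<forall>\<^sub>F y in nhds x. y \<in> S" using S eventually_nhds by blast
  ultimately have "\<forall>\<^sub>F y in nhds x. y \<in> S \<and> (\<forall>i\<in>Basis. \<bar>f' y i - f' x i\<bar> < \<eta>)"
    by (simp add: eventually_conj_iff)
  then obtain d0 where d0: "d0 > 0"
    "\<And>y. dist y x < d0 \<Longrightarrow> y \<in> S \<and> (\<forall>i\<in>Basis. \<bar>f' y i - f' x i\<bar> < \<eta>)"
    unfolding eventually_nhds_metric by blast
  have main: "\<bar>f (x + (\<Sum>i\<in>T. (h \<bullet> i) *\<^sub>R i)) - f x - (\<Sum>i\<in>T. (h \<bullet> i) * f' x i)\<bar> \<le> real (card T) * (\<eta> * norm h)"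
    if h: "norm h < d0 / n" and T: "T \<subseteq> Basis" for h T
  proof -
    have "finite T" using T finite_Basis finite_subset by blast
    then show ?thesis using T
    proof (induction T)
      case (insert j T)
      let ?p = "x + (\<Sum>i\<in>T. (h \<bullet> i) *\<^sub>R i)"
      have inb: "dist (?p + s *\<^sub>R j) x < d0" if s: "\<bar>s\<bar> \<le> \<bar>h \<bullet> j\<bar>" for s
      proof -
        have j: "j \<in> Basis" using insert by simp
        have "norm ((\<Sum>i\<in>T. (h \<bullet> i) *\<^sub>R i) + s *\<^sub>R j) \<le> (\<Sum>i\<in>T. norm h) + norm h"
          using insert order_trans[OF s Basis_le_norm[OF j, of h]] j
          by (intro norm_triangle_mono sum_norm_le) (auto simp: Basis_le_norm subset_iff)
        also have "\<dots> = real (card (insert j T)) * norm h" using insert by (simp add: algebra_simps)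
        also have "\<dots> \<le> n * norm h"
          using insert card_mono[of Basis "insert j T"] unfolding n_def by (intro mult_right_mono) auto
        also have "\<dots> < d0" using h n by (simp add: field_simps)
        finally show ?thesis by (simp add: dist_norm add.assoc)
      qed
      have der: "((\<lambda>s. f (?p + s *\<^sub>R j) - s * f' x j) has_real_derivative (f' (?p + s *\<^sub>R j) j - f' x j))
          (at s within {-\<bar>h \<bullet> j\<bar>..\<bar>h \<bullet> j\<bar>})"
        if "s \<in> {-\<bar>h \<bullet> j\<bar>..\<bar>h \<bullet> j\<bar>}" for s
      proof -
        have "?p + s *\<^sub>R j \<in> S" using inb[of s] d0(2) that by auto
        then have "((\<lambda>t. f (?p + s *\<^sub>R j + t *\<^sub>R j)) has_real_derivative f' (?p + s *\<^sub>R j) j) (at 0)"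
          using d insert by simp
        then have "((\<lambda>t. f (?p + t *\<^sub>R j)) has_real_derivative f' (?p + s *\<^sub>R j) j) (at (0 + s))"
          by (subst DERIV_shift) (simp add: algebra_simps)
        then have "((\<lambda>t. f (?p + t *\<^sub>R j)) has_real_derivative f' (?p + s *\<^sub>R j) j) (at s)" by simp
        then have "((\<lambda>t. f (?p + t *\<^sub>R j) - t * f' x j) has_real_derivative f' (?p + s *\<^sub>R j) j - 1 * f' x j) (at s)"
          by (intro DERIV_diff DERIV_cmult_right) auto
        then show ?thesis by (simp add: has_field_derivative_at_within)
      qed
      have "norm ((f (?p + (h \<bullet> j) *\<^sub>R j) - (h \<bullet> j) * f' x j) - (f (?p + 0 *\<^sub>R j) - 0 * f' x j)) \<le> \<eta> * norm (h \<bullet> j - 0)"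
      proof (rule field_differentiable_bound[OF _ der])
        fix s assume s: "s \<in> {-\<bar>h \<bullet> j\<bar>..\<bar>h \<bullet> j\<bar>}"
        then have "\<bar>f' (?p + s *\<^sub>R j) j - f' x j\<bar> < \<eta>"
          using d0(2)[OF inb[of s]] insert.prems by (simp add: abs_le_iff)
        then show "norm (f' (?p + s *\<^sub>R j) j - f' x j) \<le> \<eta>" by simp
      qed auto
      moreover have "\<eta> * \<bar>h \<bullet> j\<bar> \<le> \<eta> * norm h"
        using \<eta> insert by (intro mult_left_mono Basis_le_norm) auto
      ultimately have "\<bar>f (?p + (h \<bullet> j) *\<^sub>R j) - f ?p - (h \<bullet> j) * f' x j\<bar> \<le> \<eta> * norm h" by simp
      then have "\<bar>f (x + (\<Sum>i\<in>insert j T. (h \<bullet> i) *\<^sub>R i)) - f x - (\<Sum>i\<in>insert j T. (h \<bullet> i) * f' x i)\<bar>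
          \<le> real (card T) * (\<eta> * norm h) + \<eta> * norm h"
        using insert by (simp add: add.assoc add.commute[of "(h \<bullet> j) *\<^sub>R j"])
      then show ?case using insert by (simp add: algebra_simps)
    qed simp
  qed
  have "norm (f y - f x - (\<Sum>i\<in>Basis. ((y - x) \<bullet> i) * f' x i)) \<le> e * norm (y - x)" if "norm (y - x) < d0 / n" for y
    using main[OF that order_refl] n by (simp add: euclidean_representation \<eta>_def n_def)
  then show "\<exists>d>0. \<forall>y\<in>UNIV. norm (y - x) < d \<longrightarrow> norm (f y - f x - (\<Sum>i\<in>Basis. ((y - x) \<bullet> i) * f' x i)) \<le> e * norm (y - x)"
    using d0(1) n by (intro exI[of _ "d0 / n"]) auto
qed

section \<open>Ordinary differential equations\<close>

text \<open>Integrals from a common left end are compared, so that both orders of \<open>s\<close>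
  and \<open>t\<close> are covered.\<close>

lemma integral_Lipschitz:
  fixes g :: "real \<Rightarrow> 'b::banach"
  assumes "continuous_on {a..b} g" "\<And>s. s \<in> {a..b} \<Longrightarrow> norm (g s) \<le> K" "s \<in> {a..b}" "t \<in> {a..b}"
  shows "norm (integral {a..t} g - integral {a..s} g) \<le> K * \<bar>t - s\<bar>"
proof -
  have "norm (integral {a..t} g - integral {a..s} g) \<le> K * norm (t - s)"
  proof (rule differentiable_bound[OF _ _ _ assms(4,3)])
    show "((\<lambda>u. integral {a..u} g) has_derivative (\<lambda>h. h *\<^sub>R g x)) (at x within {a..b})" if "x \<in> {a..b}" for x
      using integral_has_vector_derivative[OF assms(1) that] by (simp add: has_vector_derivative_def)
    show "onorm (\<lambda>h. h *\<^sub>R g x) \<le> K" if "x \<in> {a..b}" for x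
      using assms(2)[OF that] by (intro onorm_le) (auto simp: mult.commute[of K] intro!: mult_left_mono)
  qed simp
  then show ?thesis by simp
qed

text \<open>Contraction principle on the complete set of bounded continuous functions with values in
  the ball. These functions live on the whole line, so times outside the interval are projected to
  it, and the equation is read off on the open interval. \<open>L\<close> and \<open>B\<close> carry
  no sign condition, hence the absolute values.\<close>

theorem Picard_Lindeloef:
  fixes f :: "real \<Rightarrow> 'b::banach \<Rightarrow> 'b"
  assumes T: "T > 0" and R: "R > 0"
    and cont: "continuous_on ({-T..T} \<times> cball u0 R) (\<lambda>(t, x). f t x)"
    and L: "\<And>t x y. t \<in> {-T..T} \<Longrightarrow> x \<in> cball u0 R \<Longrightarrow> y \<in> cball u0 R \<Longrightarrow> norm (f t x - f t y) \<le> L * norm (x - y)"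
    and B: "\<And>t x. t \<in> {-T..T} \<Longrightarrow> x \<in> cball u0 R \<Longrightarrow> norm (f t x) \<le> B"
  obtains \<delta> u where "0 < \<delta>" "\<delta> \<le> T" "u 0 = u0" "\<And>t. t \<in> {-\<delta><..<\<delta>} \<Longrightarrow> u t \<in> cball u0 R"
    "\<And>t. t \<in> {-\<delta><..<\<delta>} \<Longrightarrow> (u has_vector_derivative f t (u t)) (at t)"
proof -
  \<comment> \<open>The bound by \<open>R\<close> keeps the iterates in the ball, the bound by
    \<open>L\<close> makes the integral operator a contraction with factor 1/2; adding 1 avoids
    division by zero.\<close>
  define \<delta> where "\<delta> = min T (min (R / (\<bar>B\<bar> + 1)) (1 / (2 * (\<bar>L\<bar> + 1))))"
  have \<delta>: "\<delta> > 0" "\<delta> \<le> T" "\<delta> \<le> R / (\<bar>B\<bar> + 1)" "\<delta> \<le> 1 / (2 * (\<bar>L\<bar> + 1))"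
    using T R by (auto simp: \<delta>_def)
  have \<delta>B: "\<bar>B\<bar> * \<delta> \<le> R"
  proof -
    have "(\<bar>B\<bar> + 1) * \<delta> \<le> R" using \<delta>(3) by (simp add: field_simps)
    then show ?thesis using \<delta>(1) by (simp add: algebra_simps)
  qed
  have \<delta>L: "\<bar>L\<bar> * \<delta> \<le> 1/2"
  proof -
    have "(2 * (\<bar>L\<bar> + 1)) * \<delta> \<le> 1" using \<delta>(4) by (simp add: field_simps)
    then show ?thesis using \<delta>(1) by (simp add: algebra_simps)
  qed
  let ?D = "{-\<delta>..\<delta>}"
  define c where "c t = max (-\<delta>) (min \<delta> t)" for t :: real
  have cD: "c t \<in> ?D" for t using \<delta>(1) by (auto simp: c_def)
  have cc: "continuous_on UNIV c" unfolding c_def by (intro continuous_intros)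
  define X :: "(real \<Rightarrow>\<^sub>C 'b) set" where "X = PiC UNIV (\<lambda>_. cball u0 R)"
  have X: "v \<in> X \<longleftrightarrow> (\<forall>t. apply_bcontfun v t \<in> cball u0 R)" for v
    by (simp add: X_def mem_PiC_iff Pi_iff)
  define g where "g v s = f s (apply_bcontfun v s)" for v s
  have gc: "continuous_on ?D (g v)" if "v \<in> X" for v
  proof -
    have "continuous_on ?D (\<lambda>s. (\<lambda>(t, x). f t x) (s, apply_bcontfun v s))"
      by (rule continuous_on_compose2[OF cont])
        (use that X \<delta>(2) in \<open>auto intro!: continuous_intros\<close>)
    then show ?thesis by (simp add: g_def)
  qed
  have gB: "norm (g v s) \<le> \<bar>B\<bar>" if "v \<in> X" "s \<in> ?D" for v s
    using B[of s "apply_bcontfun v s"] that X \<delta>(2) by (force simp: g_def)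
  \<comment> \<open>A difference of two integrals from \<open>-\<delta>\<close>, because an integral
    over \<open>{0..t}\<close> would vanish for negative \<open>t\<close>.\<close>
  define J where "J v t = u0 + (integral {-\<delta>..c t} (g v) - integral {-\<delta>..0} (g v))" for v t
  have J_ball: "J v t \<in> cball u0 R" if "v \<in> X" for v t
  proof -
    have "norm (integral {-\<delta>..c t} (g v) - integral {-\<delta>..0} (g v)) \<le> \<bar>B\<bar> * \<bar>c t - 0\<bar>"
      by (rule integral_Lipschitz[OF gc gB]) (use that cD \<delta> in auto)
    also have "\<dots> \<le> \<bar>B\<bar> * \<delta>" using cD[of t] by (intro mult_left_mono) auto
    finally show ?thesis using \<delta>B by (simp add: J_def dist_norm norm_minus_commute)
  qed
  have J_bc: "J v \<in> bcontfun" if "v \<in> X" for v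
  proof (rule bcontfun_normI)
    have "continuous_on ?D (\<lambda>t. integral {-\<delta>..t} (g v))"
      by (rule indefinite_integral_continuous_1[OF integrable_continuous_interval[OF gc[OF that]]])
    then have "continuous_on UNIV (\<lambda>t. integral {-\<delta>..c t} (g v))"
      by (rule continuous_on_compose2[OF _ cc]) (use cD in auto)
    then show "continuous_on UNIV (J v)" unfolding J_def by (intro continuous_intros)
    show "norm (J v t) \<le> norm u0 + R" for t
      using J_ball[OF that, of t] norm_triangle_sub[of "J v t" u0] by (simp add: dist_norm norm_minus_commute)
  qed
  define \<Phi> where "\<Phi> v = Bcontfun (J v)" for v
  have \<Phi>: "apply_bcontfun (\<Phi> v) = J v" if "v \<in> X" for v
    using J_bc[OF that] by (simp add: \<Phi>_def Bcontfun_inverse)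
  have "\<exists>!v\<in>X. \<Phi> v = v"
  proof (rule Banach_fix[where c = "1/2"])
    show "complete X" unfolding X_def by (simp add: complete_eq_closed closed_PiC)
    have "const_bcontfun u0 \<in> X" using R by (simp add: X)
    then show "X \<noteq> {}" by blast
    show "\<Phi> ` X \<subseteq> X" using J_ball by (auto simp: X \<Phi>)
    show "dist (\<Phi> v) (\<Phi> w) \<le> 1/2 * dist v w" if v: "v \<in> X" and w: "w \<in> X" for v w
    proof (rule dist_bound)
      fix t
      have "norm (integral {-\<delta>..c t} (\<lambda>s. g v s - g w s) - integral {-\<delta>..0} (\<lambda>s. g v s - g w s))
          \<le> (\<bar>L\<bar> * dist v w) * \<bar>c t - 0\<bar>"
      proof (rule integral_Lipschitz)
        show "continuous_on ?D (\<lambda>s. g v s - g w s)" using gc v w by (intro continuous_intros)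
        fix s assume s: "s \<in> ?D"
        have "norm (g v s - g w s) \<le> L * norm (apply_bcontfun v s - apply_bcontfun w s)"
          unfolding g_def using X v w s \<delta>(2) by (intro L) auto
        also have "\<dots> \<le> \<bar>L\<bar> * dist v w"
          using dist_bounded[of v s w] by (intro mult_mono) (auto simp: dist_norm)
        finally show "norm (g v s - g w s) \<le> \<bar>L\<bar> * dist v w" .
      qed (use cD \<delta> in auto)
      also have "\<dots> \<le> (\<bar>L\<bar> * dist v w) * \<delta>" using cD[of t] by (intro mult_left_mono) auto
      also have "\<dots> \<le> 1/2 * dist v w"
        using mult_right_mono[OF \<delta>L, of "dist v w"] by (simp add: algebra_simps)
      finally have *: "norm (integral {-\<delta>..c t} (\<lambda>s. g v s - g w s) - integral {-\<delta>..0} (\<lambda>s. g v s - g w s)) \<le> 1/2 * dist v w" .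
      have i: "g v integrable_on {-\<delta>..r}" "g w integrable_on {-\<delta>..r}" if "r \<in> ?D" for r
        using gc[OF v] gc[OF w] that
        by (auto intro!: integrable_continuous_interval intro: continuous_on_subset)
      have "J v t - J w t = integral {-\<delta>..c t} (\<lambda>s. g v s - g w s) - integral {-\<delta>..0} (\<lambda>s. g v s - g w s)"
        using i[OF cD[of t]] i[of 0] \<delta>(1) by (simp add: J_def integral_diff)
      then show "dist (apply_bcontfun (\<Phi> v) t) (apply_bcontfun (\<Phi> w) t) \<le> 1/2 * dist v w"
        using * by (simp add: \<Phi> v w dist_norm)
    qed
  qed auto
  then obtain v where v: "v \<in> X" "\<Phi> v = v" by blast
  define u where "u = apply_bcontfun v"
  have uJ: "u = J v" using \<Phi>[OF v(1)] v(2) by (simp add: u_def)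
  show thesis
  proof
    show "u 0 = u0" using \<delta>(1) by (simp add: uJ J_def c_def)
    show "u t \<in> cball u0 R" for t using v(1) by (simp add: X u_def)
    fix t assume t: "t \<in> {-\<delta><..<\<delta>}"
    have "((\<lambda>t. integral {-\<delta>..t} (g v)) has_vector_derivative g v t) (at t within ?D)"
      by (rule integral_has_vector_derivative[OF gc[OF v(1)]]) (use t in auto)
    then have "((\<lambda>t. integral {-\<delta>..t} (g v)) has_vector_derivative g v t) (at t)"
      using t by (metis at_within_Icc_at greaterThanLessThan_iff)
    then have "((\<lambda>t. u0 + (integral {-\<delta>..t} (g v) - integral {-\<delta>..0} (g v))) has_vector_derivative g v t) (at t)"
      by (auto intro!: derivative_eq_intros)
    then have "(u has_vector_derivative g v t) (at t)"
      by (rule has_vector_derivative_transform_within_open[where S = "{-\<delta><..<\<delta>}"])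
        (use t in \<open>auto simp: uJ J_def c_def\<close>)
    then show "(u has_vector_derivative f t (u t)) (at t)" by (simp add: g_def u_def)
  qed (use \<delta> in auto)
qed

text \<open>Compactness bounds the derivatives along \<open>Basis\<close>, and convexity of the ball
  turns a bound on the derivative into one on differences.\<close>

lemma smooth_on_cball_Lipschitz:
  fixes f :: "'b::euclidean_space \<Rightarrow> 'c::real_normed_vector"
  assumes f: "smooth_on S f" and sub: "cball u0 R \<subseteq> S"
  obtains K where "\<And>x y. x \<in> cball u0 R \<Longrightarrow> y \<in> cball u0 R \<Longrightarrow> norm (f x - f y) \<le> K * norm (x - y)"
proof -
  have "\<exists>K. \<forall>x\<in>cball u0 R. norm (fd f x i) \<le> K" for i
  proof -
    have "continuous_on (cball u0 R) (\<lambda>x. fd f x i)"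
      using smooth_on_continuous[OF smooth_on_fd[OF f]] sub continuous_on_subset by blast
    then have "compact ((\<lambda>x. fd f x i) ` cball u0 R)"
      by (rule compact_continuous_image) simp
    from compact_imp_bounded[OF this] show ?thesis by (auto simp: bounded_iff)
  qed
  then obtain K where K: "\<And>i x. x \<in> cball u0 R \<Longrightarrow> norm (fd f x i) \<le> K i" by metis
  have bd: "norm (fd f x v) \<le> (\<Sum>i\<in>Basis. K i) * norm v" if x: "x \<in> cball u0 R" for x v
  proof -
    have "fd f x v = (\<Sum>i\<in>Basis. (v \<bullet> i) *\<^sub>R fd f x i)"
      by (rule linear_eq_sum_Basis[OF smooth_on_linear_fd[OF f]]) (use x sub in auto)
    also have "norm \<dots> \<le> (\<Sum>i\<in>Basis. norm v * K i)"
    proof (rule sum_norm_le)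
      fix i :: 'b assume "i \<in> Basis"
      then show "norm ((v \<bullet> i) *\<^sub>R fd f x i) \<le> norm v * K i"
        using K[OF x, of i] Basis_le_norm[of i v] by (simp add: mult_mono)
    qed
    finally show ?thesis by (simp add: sum_distrib_left mult.commute)
  qed
  show thesis
  proof (rule that)
    fix x y assume "x \<in> cball u0 R" "y \<in> cball u0 R"
    then show "norm (f x - f y) \<le> (\<Sum>i\<in>Basis. K i) * norm (x - y)"
    proof (intro differentiable_bound[where f' = "fd f" and S = "cball u0 R"])
      show "(f has_derivative fd f z) (at z within cball u0 R)" if "z \<in> cball u0 R" for z
        using smooth_on_has_derivative[OF f] sub that has_derivative_at_withinI by blast
      show "onorm (fd f z) \<le> (\<Sum>i\<in>Basis. K i)" if "z \<in> cball u0 R" for z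
        by (rule onorm_le) (rule bd[OF that])
    qed auto
  qed
qed

text \<open>Smoothness of the solution is read off from the equation: if \<open>u\<close> is of
  class C^k, so is \<open>f (u t)\<close>, which is the derivative of \<open>u\<close>.\<close>

theorem smooth_ode_solution:
  fixes f :: "'b::euclidean_space \<Rightarrow> 'b"
  assumes f: "smooth_on S f" and u0: "u0 \<in> S"
  obtains \<delta> u where "0 < \<delta>" "u 0 = u0" "smooth_on {-\<delta><..<\<delta>} u" "\<And>t. t \<in> {-\<delta><..<\<delta>} \<Longrightarrow> u t \<in> S"
    "\<And>t. t \<in> {-\<delta><..<\<delta>} \<Longrightarrow> (u has_vector_derivative f (u t)) (at t)"
proof -
  obtain R where R: "R > 0" "cball u0 R \<subseteq> S"
    using u0 smooth_on_open[OF f] open_contains_cball by blast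
  obtain K where K: "\<And>x y. x \<in> cball u0 R \<Longrightarrow> y \<in> cball u0 R \<Longrightarrow> norm (f x - f y) \<le> K * norm (x - y)"
    using smooth_on_cball_Lipschitz[OF f R(2)] by blast
  have cf: "continuous_on (cball u0 R) f"
    using smooth_on_continuous[OF f] R(2) continuous_on_subset by blast
  then have "bounded (f ` cball u0 R)"
    using compact_continuous_image compact_imp_bounded compact_cball by blast
  then obtain B where "\<forall>y\<in>f ` cball u0 R. norm y \<le> B"
    unfolding bounded_iff by blast
  then have B: "\<And>x. x \<in> cball u0 R \<Longrightarrow> norm (f x) \<le> B" by blast
  have "continuous_on ({-1..1::real} \<times> cball u0 R) (\<lambda>p. f (snd p))"
    by (rule continuous_on_compose2[OF cf]) (auto intro!: continuous_intros)
  then have cont: "continuous_on ({-1..1::real} \<times> cball u0 R) (\<lambda>(t, x). f x)" by (simp add: case_prod_unfold)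
  obtain \<delta> u where u: "0 < \<delta>" "u 0 = u0" "\<And>t. t \<in> {-\<delta><..<\<delta>} \<Longrightarrow> u t \<in> cball u0 R"
    "\<And>t. t \<in> {-\<delta><..<\<delta>} \<Longrightarrow> (u has_vector_derivative f (u t)) (at t)"
    by (rule Picard_Lindeloef[of 1 R u0 "\<lambda>t. f" K B]) (use R K B cont in auto)
  let ?I = "{-\<delta><..<\<delta>}"
  have uS: "u t \<in> S" if "t \<in> ?I" for t using u(3)[OF that] R(2) by blast
  have "Ck_on k u ?I" for k
  proof (induction k)
    case 0
    have "isCont u t" if "t \<in> ?I" for t
      using has_vector_derivative_continuous[OF u(4)[OF that]] .
    then show ?case by (simp add: continuous_at_imp_continuous_on)
  next
    case (Suc k)
    have "Ck_on k (\<lambda>t. f (u t)) ?I"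
      by (rule Ck_on_compose[OF _ smooth_on_open[OF f]]) (use uS Suc f in \<open>auto simp: smooth_on_def\<close>)
    then have "Ck_on k (\<lambda>t. v *\<^sub>R f (u t)) ?I" for v
      by (intro Ck_on_linear[OF _ bounded_linear_scaleR_right]) auto
    then show ?case
      using u(4) unfolding has_vector_derivative_def by (intro Ck_on_SucI) auto
  qed
  then have "smooth_on ?I u" by (simp add: smooth_on_def)
  with that u uS show thesis by blast
qed

section \<open>An equivariant choice of inner product\<close>

text \<open>Models the square of a Finsler function on one fibre. Scaling is by nonnegative factors
  only, since \<open>F\<close> need not be reversible.\<close>

definition quadratic_gauge :: "('e::euclidean_space \<Rightarrow> real) \<Rightarrow> bool" where
  "quadratic_gauge f \<longleftrightarrow> continuous_on UNIV f \<and> (\<forall>r\<ge>0. \<forall>v. f (r *\<^sub>R v) = r\<^sup>2 * f v) \<and> (\<forall>v. v \<noteq> 0 \<longrightarrow> f v > 0)"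

text \<open>A linear coordinate system in which \<open>f\<close> lies between the squared Euclidean
  norm and \<open>C\<close> times it. An isomorphism \<open>S\<close> acts by
  \<open>S \<circ> T\<close>, compatibly with pulling \<open>f\<close> back along
  \<open>S\<close>.\<close>

definition frame :: "('e::euclidean_space \<Rightarrow> real) \<Rightarrow> real \<Rightarrow> ('e \<Rightarrow> 'e) \<Rightarrow> bool" where
  "frame f C T \<longleftrightarrow> linear T \<and> (\<forall>v. (norm v)\<^sup>2 \<le> f (T v) \<and> f (T v) \<le> C * (norm v)\<^sup>2)"

text \<open>A natural number is used because a least one is attained for free; an infimum of real
  ratios would first have to be shown to be attained. The value depends only on which
  \<open>C\<close> admit a frame and is therefore invariant under linear isomorphisms.\<close>

definition distortion :: "('e::euclidean_space \<Rightarrow> real) \<Rightarrow> real" where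
  "distortion f = real (LEAST n. \<exists>T. frame f (real n) T)"

text \<open>The squared Hilbert-Schmidt norm of the matrix of \<open>b\<close> in the frame
  \<open>T\<close>. Pulling \<open>b\<close> back along \<open>S\<close> amounts to replacing
  \<open>T\<close> by \<open>S \<circ> T\<close>.\<close>

definition frame_energy :: "('e::euclidean_space \<Rightarrow> 'e \<Rightarrow> real) \<Rightarrow> ('e \<Rightarrow> 'e) \<Rightarrow> real" where
  "frame_energy b T = (\<Sum>i\<in>Basis. \<Sum>j\<in>Basis. (b (T i) (T j))\<^sup>2)"

text \<open>Sublevel sets of the largest energy over all admissible frames. Taking all frames
  instead of a chosen one makes the construction independent of choices; dominating \<open>f\<close>
  forces positive definiteness.\<close>

definition majorants :: "('e::euclidean_space \<Rightarrow> real) \<Rightarrow> real \<Rightarrow> ('e \<Rightarrow> 'e \<Rightarrow> real) set" where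
  "majorants f c = {b. bilinear b \<and> (\<forall>u v. b u v = b v u) \<and> (\<forall>v. f v \<le> b v v) \<and>
     (\<forall>T. frame f (distortion f) T \<longrightarrow> frame_energy b T \<le> c)}"

definition least_energy :: "('e::euclidean_space \<Rightarrow> real) \<Rightarrow> real" where
  "least_energy f = Inf {c. majorants f c \<noteq> {}}"

text \<open>
  The admissible frames form a compact set on which the general linear group acts compatibly with
  its action on \<open>f\<close>. The largest energy over them is a strictly convex function of the form \<open>b\<close>,
  so its minimizer among the forms that dominate \<open>f\<close> is unique, and hence equivariant.
\<close>

definition canonical_form :: "('e::euclidean_space \<Rightarrow> real) \<Rightarrow> 'e \<Rightarrow> 'e \<Rightarrow> real" where
  "canonical_form f = (THE b. b \<in> majorants f (least_energy f))"

lemma quadratic_gauge_bounds: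
  fixes f :: "'e::euclidean_space \<Rightarrow> real"
  assumes f: "quadratic_gauge f"
  obtains m M where "m > 0" "M > 0" "\<And>v. m * (norm v)\<^sup>2 \<le> f v" "\<And>v. f v \<le> M * (norm v)\<^sup>2"
proof -
  let ?S = "sphere (0::'e) 1"
  have ne: "?S \<noteq> {}" by simp
  have c: "continuous_on ?S f" using f continuous_on_subset by (auto simp: quadratic_gauge_def)
  obtain a where a: "a \<in> ?S" "\<And>v. v \<in> ?S \<Longrightarrow> f a \<le> f v"
    using continuous_attains_inf[OF compact_sphere ne c] by blast
  obtain b where b: "b \<in> ?S" "\<And>v. v \<in> ?S \<Longrightarrow> f v \<le> f b"
    using continuous_attains_sup[OF compact_sphere ne c] by blast
  have "a \<noteq> 0" "b \<noteq> 0" using a(1) b(1) by auto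
  then have pos: "f a > 0" "f b > 0" using f by (auto simp: quadratic_gauge_def)
  have *: "f a * (norm v)\<^sup>2 \<le> f v \<and> f v \<le> f b * (norm v)\<^sup>2" for v
  proof (cases "v = 0")
    case True
    have "f (0 *\<^sub>R v) = 0\<^sup>2 * f v" using f by (simp only: quadratic_gauge_def order_refl)
    then show ?thesis using True by simp
  next
    case False
    define w where "w = (1 / norm v) *\<^sub>R v"
    have "w \<in> ?S" using False by (simp add: w_def)
    moreover have "f v = (norm v)\<^sup>2 * f w"
    proof -
      have "v = norm v *\<^sub>R w" using False by (simp add: w_def)
      then show ?thesis using f unfolding quadratic_gauge_def by (metis norm_ge_zero)
    qed
    ultimately show ?thesis
      using a(2)[of w] b(2)[of w] by (simp add: mult.commute[of _ "f w"] mult_right_mono)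
  qed
  with that pos show thesis by blast
qed

text \<open>With \<open>m\<close> and \<open>M\<close> bounding \<open>f\<close> on the unit sphere,
  multiplication by \<open>1 / sqrt m\<close> is a frame for every \<open>C \<ge> M / m\<close>, in
  particular for a natural number, and a least such number is attained.\<close>

lemma frame_distortion_exists:
  fixes f :: "'e::euclidean_space \<Rightarrow> real"
  assumes f: "quadratic_gauge f"
  shows "\<exists>T. frame f (distortion f) T"
proof -
  obtain m M where m: "m > 0" "M > 0" "\<And>v. m * (norm v)\<^sup>2 \<le> f v" "\<And>v. f v \<le> M * (norm v)\<^sup>2"
    using quadratic_gauge_bounds[OF f] by blast
  define T :: "'e \<Rightarrow> 'e" where "T v = (1 / sqrt m) *\<^sub>R v" for v
  have T: "f (T v) = f v / m" for v
    using f m(1) by (simp add: quadratic_gauge_def T_def power_divide)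
  obtain n where n: "M / m \<le> real n" using real_arch_simple by blast
  have "f v / m \<le> real n * (norm v)\<^sup>2" for v
  proof -
    have "f v / m \<le> (M / m) * (norm v)\<^sup>2" using m(4)[of v] m(1) by (simp add: divide_right_mono)
    also have "\<dots> \<le> real n * (norm v)\<^sup>2" using n by (intro mult_right_mono) auto
    finally show ?thesis .
  qed
  moreover have "linear T" unfolding T_def by (simp add: linear_compose_scale_right linear_id[unfolded id_def] )
  moreover have "(norm v)\<^sup>2 \<le> f v / m" for v using m(1) m(3)[of v] by (simp add: field_simps)
  ultimately have "frame f (real n) T" by (simp add: frame_def T)
  then show ?thesis
    unfolding distortion_def using LeastI_ex[of "\<lambda>n. \<exists>T. frame f (real n) T"] by blast
qed

text \<open>One frame already controls the form: expand both arguments in the frame, where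
  coordinates are at most \<open>sqrt M\<close> times the norms. The double sum contributes the
  square of the dimension, the two coordinate bounds contribute \<open>M\<close>. Thus energy
  sublevel sets are bounded, and energy zero forces the form to vanish.\<close>

lemma frame_blinfun_bound:
  fixes \<beta> :: "'e::euclidean_space \<Rightarrow>\<^sub>L 'e"
  assumes T: "frame f C T" and M: "\<And>v. f v \<le> M * (norm v)\<^sup>2" "M \<ge> 0"
  shows "norm \<beta> \<le> real DIM('e) * real DIM('e) * M * sqrt (frame_energy (\<lambda>u w. \<beta> u \<bullet> w) T)"
proof -
  let ?q = "sqrt (frame_energy (\<lambda>u w. \<beta> u \<bullet> w) T)"
  have lin: "linear T" using T by (simp add: frame_def)
  have inj: "inj T"
  proof (rule linear_injective_0[THEN iffD2, OF lin], intro allI impI)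
    fix v assume "T v = 0"
    then have "(norm v)\<^sup>2 \<le> f 0" using T by (auto simp: frame_def dest: spec[of _ v])
    from order_trans[OF this M(1)[of 0]] show "v = 0" by simp
  qed
  have e: "\<bar>\<beta> (T i) \<bullet> T j\<bar> \<le> ?q" if "i \<in> Basis" "j \<in> Basis" for i j :: 'e
  proof (rule real_le_rsqrt)
    have "(\<beta> (T i) \<bullet> T j)\<^sup>2 \<le> (\<Sum>j\<in>Basis. (\<beta> (T i) \<bullet> T j)\<^sup>2)"
      using that by (intro member_le_sum) auto
    also have "\<dots> \<le> frame_energy (\<lambda>u w. \<beta> u \<bullet> w) T"
      unfolding frame_energy_def using that by (intro member_le_sum) (auto intro: sum_nonneg)
    finally show "\<bar>\<beta> (T i) \<bullet> T j\<bar>\<^sup>2 \<le> frame_energy (\<lambda>u w. \<beta> u \<bullet> w) T" by simp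
  qed
  let ?n = "real DIM('e)"
  have q0: "?q \<ge> 0" by (simp add: frame_energy_def sum_nonneg)
  have b: "\<beta> u \<bullet> w \<le> ?n * ?n * M * ?q * (norm u * norm w)" for u w
  proof -
    obtain u' w' where uw: "u = T u'" "w = T w'"
      using linear_injective_imp_surjective[OF lin inj] by (metis surjE)
    have nn: "norm v' \<le> sqrt M * norm (T v')" for v'
    proof -
      have "(norm v')\<^sup>2 \<le> M * (norm (T v'))\<^sup>2"
        using T M(1)[of "T v'"] by (auto simp: frame_def intro: order_trans)
      then have "sqrt ((norm v')\<^sup>2) \<le> sqrt (M * (norm (T v'))\<^sup>2)" by (rule real_sqrt_le_mono)
      then show ?thesis by (simp add: real_sqrt_mult)
    qed
    have "T u' = (\<Sum>i\<in>Basis. (u' \<bullet> i) *\<^sub>R T i)" "T w' = (\<Sum>j\<in>Basis. (w' \<bullet> j) *\<^sub>R T j)"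
      using linear_eq_sum_Basis[OF lin] by blast+
    then have "\<beta> u \<bullet> w = (\<Sum>i\<in>Basis. \<Sum>j\<in>Basis. (u' \<bullet> i) * (w' \<bullet> j) * (\<beta> (T i) \<bullet> T j))"
      by (simp add: uw blinfun.sum_right blinfun.scaleR_right inner_sum_left inner_sum_right sum_distrib_left mult.assoc mult.left_commute)
        (rule sum.swap)
    also have "\<dots> \<le> (\<Sum>i\<in>(Basis::'e set). \<Sum>j\<in>(Basis::'e set). norm u' * norm w' * ?q)"
    proof (intro sum_mono)
      fix i j :: 'e assume ij: "i \<in> Basis" "j \<in> Basis"
      have "(u' \<bullet> i) * (w' \<bullet> j) * (\<beta> (T i) \<bullet> T j) \<le> \<bar>u' \<bullet> i\<bar> * \<bar>w' \<bullet> j\<bar> * \<bar>\<beta> (T i) \<bullet> T j\<bar>"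
        by (metis abs_ge_self abs_mult)
      also have "\<dots> \<le> norm u' * norm w' * ?q"
        using ij e[OF ij] by (intro mult_mono Basis_le_norm) auto
      finally show "(u' \<bullet> i) * (w' \<bullet> j) * (\<beta> (T i) \<bullet> T j) \<le> norm u' * norm w' * ?q" .
    qed
    also have "\<dots> = ?n * ?n * ?q * (norm u' * norm w')" by simp
    also have "\<dots> \<le> ?n * ?n * ?q * ((sqrt M * norm u) * (sqrt M * norm w))"
      using nn[of u'] nn[of w'] q0 M(2) uw by (intro mult_left_mono mult_mono) auto
    also have "\<dots> = ?n * ?n * M * ?q * (norm u * norm w)"
      using real_sqrt_mult_self[of M] M(2) by (simp add: algebra_simps)
    finally show ?thesis .
  qed
  show ?thesis
  proof (rule norm_blinfun_bound)
    show "0 \<le> ?n * ?n * M * ?q" using q0 M(2) by simp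
    fix u
    show "norm (\<beta> u) \<le> ?n * ?n * M * ?q * norm u"
    proof (cases "\<beta> u = 0")
      case False
      \<comment> \<open>Testing with \<open>w = \<beta> u\<close> turns the bound on the form into a
        bound on the operator.\<close>
      have "norm (\<beta> u) * norm (\<beta> u) \<le> (?n * ?n * M * ?q * norm u) * norm (\<beta> u)"
        using b[of u "\<beta> u"] by (simp add: dot_square_norm power2_eq_square mult.assoc)
      then show ?thesis using False by simp
    qed (use q0 M(2) in simp)
  qed
qed

text \<open>Endomorphisms represent forms as elements of a finite-dimensional normed space, in which
  closed bounded sets are compact.\<close>

lemma bilinear_blinfun:
  fixes b :: "'e::euclidean_space \<Rightarrow> 'e \<Rightarrow> real"
  assumes "bilinear b"
  shows "\<exists>\<beta>::'e \<Rightarrow>\<^sub>L 'e. b = (\<lambda>u w. \<beta> u \<bullet> w)"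
proof -
  let ?B = "\<lambda>u. \<Sum>i\<in>Basis. b u i *\<^sub>R i"
  have "linear ?B"
    using assms by (intro linear_compose_sum ballI linearI)
      (auto simp: bilinear_ladd bilinear_lmul scaleR_add_left)
  then have "blinfun_apply (Blinfun ?B) = ?B"
    by (simp add: bounded_linear_Blinfun_apply linear_conv_bounded_linear)
  moreover have "?B u \<bullet> w = b u w" for u w
    using linear_eq_sum_Basis[of "b u" w] assms
    by (simp add: bilinear_def inner_sum_left inner_commute[of w] mult.commute)
  ultimately show ?thesis by (intro exI[of _ "Blinfun ?B"]) auto
qed

text \<open>Existence comes from compactness, since the sublevel sets above the infimum contain a
  decreasing sequence of nonempty compact sets. Uniqueness comes from the parallelogram law: the
  midpoint of two minimizers would have strictly smaller largest energy.\<close>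

lemma majorants_least_energy:
  fixes f :: "'e::euclidean_space \<Rightarrow> real"
  assumes f: "quadratic_gauge f"
  shows "\<exists>!b. b \<in> majorants f (least_energy f)"
proof -
  obtain m M where m: "m > 0" "M > 0" "\<And>v. m * (norm v)\<^sup>2 \<le> f v" "\<And>v. f v \<le> M * (norm v)\<^sup>2"
    using quadratic_gauge_bounds[OF f] by blast
  have fc: "continuous_on UNIV f" using f by (simp add: quadratic_gauge_def)
  let ?C = "distortion f"
  have C0: "?C \<ge> 0" by (simp add: distortion_def)
  define \<FF> where "\<FF> = {T::'e \<Rightarrow>\<^sub>L 'e. frame f ?C T}"
  define bf where "bf \<beta> = (\<lambda>u w. blinfun_apply \<beta> u \<bullet> w)" for \<beta> :: "'e \<Rightarrow>\<^sub>L 'e"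
  have lin_bl: "linear (blinfun_apply T)" for T :: "'e \<Rightarrow>\<^sub>L 'e"
    using blinfun.bounded_linear_right linear_conv_bounded_linear by blast
  have frame_bl: "\<exists>T'. T = blinfun_apply T' \<and> T' \<in> \<FF>" if "frame f ?C T" for T
  proof -
    have "blinfun_apply (Blinfun T) = T"
      using that by (simp add: frame_def bounded_linear_Blinfun_apply linear_conv_bounded_linear)
    then show ?thesis using that by (intro exI[of _ "Blinfun T"]) (simp add: \<FF>_def)
  qed
  obtain T0 where T0: "frame f ?C T0" using frame_distortion_exists[OF f] by blast
  have frame_norm: "norm (T v) \<le> sqrt (?C / m) * norm v" if "frame f ?C T" for T v
  proof -
    have "m * (norm (T v))\<^sup>2 \<le> ?C * (norm v)\<^sup>2"
      using m(3)[of "T v"] that by (auto simp: frame_def intro: order_trans)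
    then have "(norm (T v))\<^sup>2 \<le> ?C / m * (norm v)\<^sup>2" using m(1) by (simp add: field_simps)
    then have "sqrt ((norm (T v))\<^sup>2) \<le> sqrt (?C / m * (norm v)\<^sup>2)" by (rule real_sqrt_le_mono)
    then show ?thesis by (simp only: real_sqrt_mult real_sqrt_abs abs_norm_cancel)
  qed
  have cf\<FF>: "compact \<FF>"
  proof -
    have "bounded \<FF>"
      by (rule boundedI[where B = "sqrt (?C / m)"])
        (use frame_norm C0 m(1) in \<open>auto simp: \<FF>_def intro!: norm_blinfun_bound\<close>)
    moreover have "closed \<FF>"
      unfolding \<FF>_def frame_def
      by (intro closed_Collect_conj closed_Collect_all closed_Collect_le closed_Collect_const continuous_intros
          continuous_on_compose2[OF fc])
        (auto simp: lin_bl intro!: continuous_intros)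
    ultimately show ?thesis by (simp add: compact_eq_bounded_closed)
  qed
  have T0': "\<FF> \<noteq> {}" using frame_bl[OF T0] by blast
  define K where "K c = {\<beta>. (\<forall>u w. bf \<beta> u w = bf \<beta> w u) \<and> (\<forall>v. f v \<le> bf \<beta> v v) \<and>
     (\<forall>T\<in>\<FF>. frame_energy (bf \<beta>) (blinfun_apply T) \<le> c)}" for c
  have bil: "bilinear (bf \<beta>)" for \<beta>
    unfolding bf_def bilinear_def
    by (auto intro!: linearI simp: inner_add_right inner_add_left blinfun.add_right blinfun.scaleR_right)
  have KM: "bf \<beta> \<in> majorants f c \<longleftrightarrow> \<beta> \<in> K c" for \<beta> c
  proof -
    have "(\<forall>T. frame f ?C T \<longrightarrow> frame_energy (bf \<beta>) T \<le> c) \<longleftrightarrow> (\<forall>T\<in>\<FF>. frame_energy (bf \<beta>) (blinfun_apply T) \<le> c)"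
      using frame_bl by (auto simp: \<FF>_def)
    then show ?thesis using bil[of \<beta>] unfolding majorants_def K_def by simp
  qed
  have Mbf: "\<exists>\<beta>\<in>K c. b = bf \<beta>" if "b \<in> majorants f c" for b c
    using bilinear_blinfun[of b] that KM[of _ c] by (auto simp: majorants_def bf_def)
  have compK: "compact (K c)" for c
  proof -
    have "norm \<beta> \<le> real DIM('e) * real DIM('e) * M * sqrt \<bar>c\<bar>" if "\<beta> \<in> K c" for \<beta>
    proof -
      obtain T' where T': "T0 = blinfun_apply T'" "T' \<in> \<FF>" using frame_bl[OF T0] by blast
      have "norm \<beta> \<le> real DIM('e) * real DIM('e) * M * sqrt (frame_energy (bf \<beta>) T0)"
        unfolding bf_def by (rule frame_blinfun_bound[OF T0 m(4)]) (use m in simp)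
      also have "\<dots> \<le> real DIM('e) * real DIM('e) * M * sqrt \<bar>c\<bar>"
        using that T' m(2) by (intro mult_left_mono real_sqrt_le_mono) (auto simp: K_def)
      finally show ?thesis .
    qed
    then have "bounded (K c)" by (rule boundedI)
    moreover have "closed (K c)"
      unfolding K_def frame_energy_def bf_def Ball_def
      by (intro closed_Collect_conj closed_Collect_all closed_Collect_le closed_Collect_eq closed_Collect_imp
          open_Collect_const continuous_intros)
    ultimately show ?thesis by (simp add: compact_eq_bounded_closed)
  qed
  define I where "I = {c. majorants f c \<noteq> {}}"
  have I: "c \<in> I \<longleftrightarrow> K c \<noteq> {}" for c unfolding I_def using Mbf[of _ c] KM[of _ c] by blast
  have I0: "0 \<le> c" if "c \<in> I" for c
  proof -
    obtain \<beta> where "\<beta> \<in> K c" using \<open>c \<in> I\<close> I by blast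
    moreover obtain T where "T \<in> \<FF>" using T0' by blast
    ultimately have "frame_energy (bf \<beta>) (blinfun_apply T) \<le> c" by (simp add: K_def)
    moreover have "frame_energy (bf \<beta>) (blinfun_apply T) \<ge> 0" by (simp add: frame_energy_def sum_nonneg)
    ultimately show ?thesis by simp
  qed
  have bdd: "bdd_below I" by (rule bdd_belowI[of _ 0]) (rule I0)
  \<comment> \<open>A large multiple of the Euclidean inner product dominates \<open>f\<close>, and
    its energy is bounded because all admissible frames have bounded norm.\<close>
  have Ine: "I \<noteq> {}"
  proof -
    let ?b = "\<lambda>u w. M * (u \<bullet> w)"
    let ?c = "\<Sum>i\<in>(Basis::'e set). \<Sum>j\<in>(Basis::'e set). (M * (sqrt (?C / m) * sqrt (?C / m)))\<^sup>2"
    have "frame_energy ?b T \<le> ?c" if "frame f ?C T" for T :: "'e \<Rightarrow> 'e"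
      unfolding frame_energy_def
    proof (intro sum_mono)
      fix i j :: 'e assume ij: "i \<in> Basis" "j \<in> Basis"
      have "\<bar>T i \<bullet> T j\<bar> \<le> norm (T i) * norm (T j)" by (rule Cauchy_Schwarz_ineq2)
      also have "\<dots> \<le> sqrt (?C / m) * sqrt (?C / m)"
        using frame_norm[OF that, of i] frame_norm[OF that, of j] ij C0 m(1) by (intro mult_mono) auto
      finally have "M * \<bar>T i \<bullet> T j\<bar> \<le> M * (sqrt (?C / m) * sqrt (?C / m))"
        by (rule mult_left_mono) (use m(2) in simp)
      moreover have "\<bar>M * (T i \<bullet> T j)\<bar> = M * \<bar>T i \<bullet> T j\<bar>" using m(2) by (simp add: abs_mult)
      ultimately have "\<bar>M * (T i \<bullet> T j)\<bar> \<le> M * (sqrt (?C / m) * sqrt (?C / m))" by (simp only:)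
      then have "\<bar>M * (T i \<bullet> T j)\<bar>\<^sup>2 \<le> (M * (sqrt (?C / m) * sqrt (?C / m)))\<^sup>2"
        by (intro power_mono) auto
      then show "(M * (T i \<bullet> T j))\<^sup>2 \<le> (M * (sqrt (?C / m) * sqrt (?C / m)))\<^sup>2" by simp
    qed
    moreover have "bilinear ?b"
      unfolding bilinear_def by (auto intro!: linearI simp: inner_add_right inner_add_left algebra_simps)
    ultimately have "?b \<in> majorants f ?c"
      using m(4) by (auto simp: majorants_def inner_commute dot_square_norm)
    then show ?thesis by (auto simp: I_def)
  qed
  define c0 where "c0 = least_energy f"
  have c0: "c0 = Inf I" by (simp add: c0_def least_energy_def I_def)
  have Kmono: "K c \<subseteq> K c'" if "c \<le> c'" for c c' using that by (force simp: K_def)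
  have "\<Inter>(range (\<lambda>n::nat. K (c0 + 1 / real (Suc n)))) \<noteq> {}"
  proof (rule compact_nest)
    fix n :: nat
    have "\<exists>c\<in>I. c < c0 + 1 / real (Suc n)" using cInf_lessD[OF Ine, of "c0 + 1 / real (Suc n)"] c0 by auto
    then obtain c where "K c \<noteq> {}" "c < c0 + 1 / real (Suc n)" using I by blast
    then show "K (c0 + 1 / real (Suc n)) \<noteq> {}" using Kmono[of c "c0 + 1 / real (Suc n)"] by fastforce
  next
    fix k n :: nat assume "k \<le> n"
    then show "K (c0 + 1 / real (Suc n)) \<subseteq> K (c0 + 1 / real (Suc k))"
      by (intro Kmono) (simp add: frac_le)
  qed (rule compK)
  then obtain \<beta> where \<beta>: "\<And>n::nat. \<beta> \<in> K (c0 + 1 / real (Suc n))" by blast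
  have \<beta>0: "\<beta> \<in> K c0"
  proof -
    have "frame_energy (bf \<beta>) (blinfun_apply T) \<le> c0" if "T \<in> \<FF>" for T
    proof (rule field_le_epsilon)
      fix e :: real assume "e > 0"
      then obtain n where "1 / real (Suc n) < e" using nat_approx_posE by blast
      then show "frame_energy (bf \<beta>) (blinfun_apply T) \<le> c0 + e"
        using \<beta>[of n] that by (force simp: K_def)
    qed
    then show ?thesis using \<beta>[of 0] by (simp add: K_def)
  qed
  have uniq: "\<beta>1 = \<beta>2" if b1: "\<beta>1 \<in> K c0" and b2: "\<beta>2 \<in> K c0" for \<beta>1 \<beta>2
  proof (rule ccontr)
    assume ne: "\<beta>1 \<noteq> \<beta>2"
    have "continuous_on \<FF> (\<lambda>T. frame_energy (bf (\<beta>1 - \<beta>2)) (blinfun_apply T))"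
      unfolding frame_energy_def bf_def by (intro continuous_intros)
    then obtain T1 where T1: "T1 \<in> \<FF>" "\<And>T. T \<in> \<FF> \<Longrightarrow>
        frame_energy (bf (\<beta>1 - \<beta>2)) (blinfun_apply T1) \<le> frame_energy (bf (\<beta>1 - \<beta>2)) (blinfun_apply T)"
      using continuous_attains_inf[OF cf\<FF> T0'] by blast
    \<comment> \<open>The least energy of the difference over all frames. It is positive by
      compactness and \<open>frame_blinfun_bound\<close>, so the gain at the midpoint is uniform
      over the frames.\<close>
    define e where "e = frame_energy (bf (\<beta>1 - \<beta>2)) (blinfun_apply T1)"
    have e: "e > 0"
    proof -
      have "0 < norm (\<beta>1 - \<beta>2)" using ne by simp
      also have "\<dots> \<le> real DIM('e) * real DIM('e) * M * sqrt e"
        unfolding e_def bf_def by (rule frame_blinfun_bound) (use T1 m in \<open>auto simp: \<FF>_def\<close>)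
      finally have "sqrt e \<noteq> 0" by auto
      moreover have "e \<ge> 0" by (simp add: e_def frame_energy_def sum_nonneg)
      ultimately show ?thesis by auto
    qed
    define \<gamma> where "\<gamma> = (1/2) *\<^sub>R (\<beta>1 + \<beta>2)"
    \<comment> \<open>The parallelogram law for each matrix entry: the midpoint gains a quarter of
      the energy of the difference.\<close>
    have par: "frame_energy (bf \<gamma>) T = frame_energy (bf \<beta>1) T / 2 + frame_energy (bf \<beta>2) T / 2
        - frame_energy (bf (\<beta>1 - \<beta>2)) T / 4" for T
      unfolding frame_energy_def sum_divide_distrib sum.distrib[symmetric] sum_subtractf[symmetric]
      by (intro sum.cong refl)
        (simp add: bf_def \<gamma>_def blinfun.bilinear_simps inner_add_left inner_diff_left power2_eq_square field_simps)
    have "\<gamma> \<in> K (c0 - e / 4)"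
    proof -
      have "frame_energy (bf \<gamma>) (blinfun_apply T) \<le> c0 - e / 4" if "T \<in> \<FF>" for T
      proof -
        have "frame_energy (bf \<beta>1) (blinfun_apply T) \<le> c0" "frame_energy (bf \<beta>2) (blinfun_apply T) \<le> c0"
          using b1 b2 that by (auto simp: K_def)
        then show ?thesis using T1(2)[OF that] unfolding par e_def by argo
      qed
      moreover have "bf \<gamma> u w = bf \<gamma> w u" for u w
      proof -
        have "bf \<beta>1 u w = bf \<beta>1 w u" "bf \<beta>2 u w = bf \<beta>2 w u" using b1 b2 by (auto simp: K_def)
        then show ?thesis by (simp add: bf_def \<gamma>_def blinfun.bilinear_simps inner_add_left)
      qed
      moreover have "f v \<le> bf \<gamma> v v" for v
      proof -
        have "f v \<le> bf \<beta>1 v v" "f v \<le> bf \<beta>2 v v" using b1 b2 by (auto simp: K_def)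
        then show ?thesis by (simp add: bf_def \<gamma>_def blinfun.bilinear_simps inner_add_left)
      qed
      ultimately show ?thesis by (simp add: K_def)
    qed
    then have "c0 - e / 4 \<in> I" using I by blast
    then have "c0 \<le> c0 - e / 4" using cInf_lower[OF _ bdd] c0 by blast
    then show False using e by simp
  qed
  show ?thesis
  proof (rule ex1I[of _ "bf \<beta>"])
    show "bf \<beta> \<in> majorants f (least_energy f)" using \<beta>0 KM by (simp add: c0_def)
    show "b = bf \<beta>" if bm: "b \<in> majorants f (least_energy f)" for b
    proof -
      obtain \<beta>' where "\<beta>' \<in> K c0" "b = bf \<beta>'" using Mbf[OF bm] unfolding c0_def by blast
      then show ?thesis using uniq[OF _ \<beta>0, of \<beta>'] by simp
    qed
  qed
qed

lemma inner_form_canonical_form: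
  assumes f: "quadratic_gauge f"
  shows "inner_form (canonical_form f)"
proof -
  have "canonical_form f \<in> majorants f (least_energy f)"
    unfolding canonical_form_def by (rule theI'[OF majorants_least_energy[OF f]])
  then have b: "bilinear (canonical_form f)" "\<forall>u v. canonical_form f u v = canonical_form f v u"
    and ge: "f v \<le> canonical_form f v v" for v
    unfolding majorants_def by blast+
  have "canonical_form f v v > 0" if "v \<noteq> 0" for v
    using f that ge[of v] unfolding quadratic_gauge_def by (metis less_le_trans)
  with b show ?thesis by (simp add: inner_form_def)
qed

text \<open>An isomorphism \<open>S\<close> carries the admissible frames of the pulled back gauge
  to those of \<open>f\<close> and preserves distortion and energies. The pullback of the minimizer
  is thus a minimizer, and uniqueness identifies it.\<close>

lemma canonical_form_compose:
  fixes S :: "'e::euclidean_space \<Rightarrow> 'e"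
  assumes f: "quadratic_gauge f" and S: "linear S" "inj S"
  shows "canonical_form (\<lambda>v. f (S v)) = (\<lambda>u w. canonical_form f (S u) (S w))"
proof -
  let ?f = "\<lambda>v. f (S v)"
  obtain S' where S': "linear S'" "S' \<circ> S = id" using linear_injective_left_inverse[OF S] by blast
  then have S'': "S \<circ> S' = id" using linear_inverse_left S(1) by blast
  have inv: "S' (S v) = v" "S (S' v) = v" for v using S'(2) S'' by (metis comp_apply id_apply)+
  have g: "quadratic_gauge ?f"
    unfolding quadratic_gauge_def
  proof (intro conjI allI impI)
    show "continuous_on UNIV ?f"
      using f linear_continuous_on[OF S(1)[unfolded linear_conv_bounded_linear]]
      by (auto simp: quadratic_gauge_def intro: continuous_on_compose2)
    show "f (S v) > 0" if "v \<noteq> 0" for v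
      using f that inv(1)[of v] linear_0[OF S'(1)] by (metis quadratic_gauge_def)
  qed (use f linear_scale[OF S(1)] in \<open>simp add: quadratic_gauge_def\<close>)
  have fr1: "frame f C (S \<circ> T)" if "frame ?f C T" for C T
    using that linear_compose[OF _ S(1), of T] by (auto simp: frame_def)
  have fr2: "frame ?f C (S' \<circ> T)" if "frame f C T" for C T
    using that linear_compose[OF _ S'(1), of T] by (auto simp: frame_def inv)
  have "(\<exists>T. frame ?f C T) \<longleftrightarrow> (\<exists>T. frame f C T)" for C
    using fr1 fr2 by blast
  then have d: "distortion ?f = distortion f" by (simp add: distortion_def)
  have pull: "bilinear (\<lambda>u w. b (R u) (R w))" if "bilinear b" "linear R" for b :: "'e \<Rightarrow> 'e \<Rightarrow> real" and R
    unfolding bilinear_def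
    by (auto intro!: linearI simp: linear_add[OF that(2)] linear_scale[OF that(2)] bilinear_ladd[OF that(1)]
        bilinear_radd[OF that(1)] bilinear_lmul[OF that(1)] bilinear_rmul[OF that(1)])
  have m1: "(\<lambda>u w. b (S u) (S w)) \<in> majorants ?f c" if "b \<in> majorants f c" for b c
  proof -
    have "frame_energy (\<lambda>u w. b (S u) (S w)) T = frame_energy b (S \<circ> T)" for T
      by (simp add: frame_energy_def)
    then show ?thesis using that fr1 pull[OF _ S(1)] by (auto simp: majorants_def d)
  qed
  have m2: "(\<lambda>u w. b (S' u) (S' w)) \<in> majorants f c" if "b \<in> majorants ?f c" for b c
  proof -
    have "frame_energy (\<lambda>u w. b (S' u) (S' w)) T = frame_energy b (S' \<circ> T)" for T
      by (simp add: frame_energy_def)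
    moreover have "f v \<le> b (S' v) (S' v)" for v
    proof -
      have "\<forall>v. f (S v) \<le> b v v" using that unfolding majorants_def by blast
      from this[rule_format, of "S' v"] show ?thesis by (simp only: inv(2))
    qed
    moreover have "frame_energy b (S' \<circ> T) \<le> c" if "frame f (distortion f) T" for T
      using fr2[OF that] \<open>b \<in> majorants ?f c\<close> by (simp add: majorants_def d)
    moreover have "bilinear b" "\<forall>u v. b u v = b v u"
      using that unfolding majorants_def by blast+
    ultimately show ?thesis using pull[OF _ S'(1), of b] by (simp add: majorants_def)
  qed
  have "majorants ?f c \<noteq> {} \<longleftrightarrow> majorants f c \<noteq> {}" for c using m1 m2 by blast
  then have e: "least_energy ?f = least_energy f" by (simp add: least_energy_def)
  have "canonical_form f \<in> majorants f (least_energy f)"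
    unfolding canonical_form_def by (rule theI'[OF majorants_least_energy[OF f]])
  then have "(\<lambda>u w. canonical_form f (S u) (S w)) \<in> majorants ?f (least_energy ?f)"
    using m1 e by simp
  then show ?thesis
    unfolding canonical_form_def[of ?f] by (intro the1_equality majorants_least_energy[OF g])
qed

section \<open>Sprays in a chart\<close>

text \<open>
  Throughout, \<open>L\<close> is the square of a Finsler function in a chart \<open>U\<close>. The geodesics are the
  solutions of \<open>x'' = - 2 spray (x, x')\<close>, and linear parallel transport along them is
  \<open>w' = - ncon (x, x') w\<close>.
\<close>

definition vhess :: "('e::euclidean_space \<times> 'e \<Rightarrow> real) \<Rightarrow> 'e \<times> 'e \<Rightarrow> 'e \<Rightarrow> 'e \<Rightarrow> real" where
  "vhess L z u w = fd (\<lambda>z. fd L z (0, w)) z (0, u) / 2"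

text \<open>The spray with its index lowered. Of the factor 1/4, one half comes from
  \<open>vhess\<close> being half of the second derivative, the other from the convention
  \<open>x'' = - 2 spray\<close>.\<close>

definition spray_form :: "('e::euclidean_space \<times> 'e \<Rightarrow> real) \<Rightarrow> 'e \<times> 'e \<Rightarrow> 'e \<Rightarrow> real" where
  "spray_form L z e = (fd (\<lambda>z. fd L z (0, e)) z (snd z, 0) - fd L z (e, 0)) / 4"

definition spray :: "('e::euclidean_space \<times> 'e \<Rightarrow> real) \<Rightarrow> 'e \<times> 'e \<Rightarrow> 'e" where
  "spray L z = raise_form (vhess L z) (spray_form L z)"

definition ncon :: "('e::euclidean_space \<times> 'e \<Rightarrow> real) \<Rightarrow> 'e \<times> 'e \<Rightarrow> 'e \<Rightarrow> 'e" where
  "ncon L z w = fd (spray L) z (0, w)"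

section \<open>Positively homogeneous functions\<close>

definition homogeneous :: "'e::euclidean_space set \<Rightarrow> nat \<Rightarrow> ('e \<times> 'e \<Rightarrow> 'y::real_normed_vector) \<Rightarrow> bool" where
  "homogeneous U k h \<longleftrightarrow> (\<forall>x\<in>U. \<forall>v. v \<noteq> 0 \<longrightarrow> (\<forall>r>0. h (x, r *\<^sub>R v) = r ^ k *\<^sub>R h (x, v)))"

lemma fd_divide:
  fixes f :: "'x::real_normed_vector \<Rightarrow> real"
  assumes "(f has_derivative f') (at x)"
  shows "fd (\<lambda>x. f x / c) x v = f' v / c"
proof -
  have "((\<lambda>x. f x / c) has_derivative (\<lambda>v. f' v / c)) (at x)"
    by (rule bounded_linear.has_derivative[OF bounded_linear_divide assms])
  then show ?thesis by (simp add: fd_eq)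
qed

lemma smooth_on_divide:
  fixes f :: "'x::real_normed_vector \<Rightarrow> real"
  shows "smooth_on S f \<Longrightarrow> smooth_on S (\<lambda>x. f x / c)"
  by (rule smooth_on_linear[OF bounded_linear_divide])

lemma homogeneousD: "homogeneous U k h \<Longrightarrow> x \<in> U \<Longrightarrow> v \<noteq> 0 \<Longrightarrow> r > 0 \<Longrightarrow> h (x, r *\<^sub>R v) = r ^ k *\<^sub>R h (x, v)"
  unfolding homogeneous_def by blast

text \<open>The homogeneity relation is differentiated in \<open>(x, v)\<close>; scaling acts
  linearly on the second component and leaves the first alone.\<close>

lemma homogeneous_fd:
  fixes h :: "'e::euclidean_space \<times> 'e \<Rightarrow> 'y::real_normed_vector"
  assumes sm: "smooth_on (U \<times> (UNIV - {0})) h" and hom: "homogeneous U k h"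
    and z: "x \<in> U" "v \<noteq> 0" "r > 0"
  shows "fd h (x, r *\<^sub>R v) (e1, r *\<^sub>R e2) = r ^ k *\<^sub>R fd h (x, v) (e1, e2)"
proof -
  let ?W = "U \<times> (UNIV - {0 :: 'e})"
  let ?\<sigma> = "\<lambda>z. (fst z, r *\<^sub>R snd z)"
  have W: "open ?W" using smooth_on_open[OF sm] .
  have zW: "(x, v) \<in> ?W" "?\<sigma> (x, v) \<in> ?W" using z by auto
  have "(?\<sigma> has_derivative ?\<sigma>) (at (x, v))"
    by (intro has_derivative_Pair has_derivative_scaleR_right has_derivative_fst has_derivative_snd has_derivative_ident)
  then have "((\<lambda>z. h (?\<sigma> z)) has_derivative (\<lambda>\<zeta>. fd h (?\<sigma> (x, v)) (?\<sigma> \<zeta>))) (at (x, v))"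
    by (rule has_derivative_compose) (rule smooth_on_has_derivative[OF sm zW(2)])
  then have "((\<lambda>z. r ^ k *\<^sub>R h z) has_derivative (\<lambda>\<zeta>. fd h (?\<sigma> (x, v)) (?\<sigma> \<zeta>))) (at (x, v))"
  proof (rule has_derivative_transform_within_open[OF _ W zW(1)])
    fix y assume "y \<in> ?W"
    then obtain a b where "y = (a, b)" "a \<in> U" "b \<noteq> 0" by blast
    then show "h (?\<sigma> y) = r ^ k *\<^sub>R h y"
      by (simp add: homogeneousD[OF hom _ _ z(3)])
  qed
  moreover have "((\<lambda>z. r ^ k *\<^sub>R h z) has_derivative (\<lambda>\<zeta>. r ^ k *\<^sub>R fd h (x, v) \<zeta>)) (at (x, v))"
    by (intro has_derivative_scaleR_right smooth_on_has_derivative[OF sm zW(1)])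
  ultimately have "(\<lambda>\<zeta>. fd h (?\<sigma> (x, v)) (?\<sigma> \<zeta>)) = (\<lambda>\<zeta>. r ^ k *\<^sub>R fd h (x, v) \<zeta>)"
    by (rule has_derivative_unique)
  from fun_cong[OF this, of "(e1, e2)"] show ?thesis by simp
qed

text \<open>In vertical directions the chain rule supplies a factor \<open>r\<close>, whose
  cancellation lowers the degree by one.\<close>

lemma homogeneous_fd_vertical:
  fixes h :: "'e::euclidean_space \<times> 'e \<Rightarrow> 'y::real_normed_vector"
  assumes sm: "smooth_on (U \<times> (UNIV - {0})) h" and hom: "homogeneous U (Suc k) h"
  shows "homogeneous U k (\<lambda>z. fd h z (0, e))"
  unfolding homogeneous_def
proof (intro ballI allI impI)
  fix x v :: 'e and r :: real assume z: "x \<in> U" "v \<noteq> 0" "r > 0"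
  have "r *\<^sub>R fd h (x, r *\<^sub>R v) (0, e) = fd h (x, r *\<^sub>R v) (r *\<^sub>R (0, e))"
    by (rule linear_scale[symmetric]) (rule smooth_on_linear_fd[OF sm], use z in simp)
  also have "\<dots> = r *\<^sub>R (r ^ k *\<^sub>R fd h (x, v) (0, e))"
    using homogeneous_fd[OF sm hom z, of 0 e] by simp
  finally show "fd h (x, r *\<^sub>R v) (0, e) = r ^ k *\<^sub>R fd h (x, v) (0, e)"
    using z(3) by (simp only: real_vector.scale_left_imp_eq less_irrefl scaleR_cancel_left) auto
qed

lemma homogeneous_fd_horizontal:
  fixes h :: "'e::euclidean_space \<times> 'e \<Rightarrow> 'y::real_normed_vector"
  assumes sm: "smooth_on (U \<times> (UNIV - {0})) h" and hom: "homogeneous U k h"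
  shows "homogeneous U k (\<lambda>z. fd h z (e, 0))"
  unfolding homogeneous_def using homogeneous_fd[OF sm hom, of _ _ _ e 0] by simp

text \<open>Derivative of the homogeneity relation in \<open>r\<close> at
  \<open>r = 1\<close>.\<close>

lemma euler_homogeneous:
  fixes h :: "'e::euclidean_space \<times> 'e \<Rightarrow> 'y::real_normed_vector"
  assumes sm: "smooth_on (U \<times> (UNIV - {0})) h" and hom: "homogeneous U k h"
    and z: "x \<in> U" "v \<noteq> 0"
  shows "fd h (x, v) (0, v) = real k *\<^sub>R h (x, v)"
proof -
  have d: "(h has_derivative fd h (x, 1 *\<^sub>R v)) (at (x, 1 *\<^sub>R v))"
    by (rule smooth_on_has_derivative[OF sm]) (use z in simp)
  have "((\<lambda>r. (x, r *\<^sub>R v)) has_derivative (\<lambda>s. (0, s *\<^sub>R v))) (at 1)"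
    by (intro has_derivative_Pair has_derivative_const has_derivative_scaleR_left has_derivative_ident)
  then have "((\<lambda>r. h (x, r *\<^sub>R v)) has_derivative (\<lambda>s. fd h (x, 1 *\<^sub>R v) (0, s *\<^sub>R v))) (at (1::real))"
    by (rule has_derivative_compose) (rule d)
  then have "((\<lambda>r. r ^ k *\<^sub>R h (x, v)) has_derivative (\<lambda>s. fd h (x, 1 *\<^sub>R v) (0, s *\<^sub>R v))) (at (1::real))"
    by (rule has_derivative_transform_within_open[where s = "{0<..}"])
      (use hom z in \<open>auto simp: homogeneous_def\<close>)
  moreover have "((\<lambda>r. r ^ k *\<^sub>R h (x, v)) has_derivative (\<lambda>s. (s * real k) *\<^sub>R h (x, v))) (at (1::real))"
    by (auto intro!: derivative_eq_intros)
  ultimately have "(\<lambda>s. fd h (x, 1 *\<^sub>R v) (0, s *\<^sub>R v)) = (\<lambda>s. (s * real k) *\<^sub>R h (x, v))"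
    by (rule has_derivative_unique)
  from fun_cong[OF this, of 1] show ?thesis by simp
qed

locale finsler_chart =
  fixes U :: "'e::euclidean_space set" and L :: "'e \<times> 'e \<Rightarrow> real"
  assumes open_U: "open U"
    and smooth_L: "smooth_on (U \<times> (UNIV - {0})) L"
    and cont_L: "continuous_on (U \<times> UNIV) L"
    and hom_L: "x \<in> U \<Longrightarrow> r \<ge> 0 \<Longrightarrow> L (x, r *\<^sub>R v) = r\<^sup>2 * L (x, v)"
    and pos_L: "x \<in> U \<Longrightarrow> v \<noteq> 0 \<Longrightarrow> L (x, v) > 0"
    and convex_L: "x \<in> U \<Longrightarrow> v \<noteq> 0 \<Longrightarrow> u \<noteq> 0 \<Longrightarrow> vhess L (x, v) u u > 0"
begin

abbreviation "W \<equiv> U \<times> (UNIV - {0::'e})"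

lemma open_W: "open W"
  using smooth_on_open[OF smooth_L] .

lemma L_zero: "x \<in> U \<Longrightarrow> L (x, 0) = 0"
  using hom_L[of x 0 0] by simp

lemma L_homogeneous: "homogeneous U 2 L"
  unfolding homogeneous_def using hom_L by simp

lemma quadratic_gauge_L: "x \<in> U \<Longrightarrow> quadratic_gauge (\<lambda>v. L (x, v))"
  unfolding quadratic_gauge_def
  by (intro conjI allI impI continuous_on_compose2[OF cont_L] continuous_intros hom_L pos_L) auto

section \<open>Fundamental tensor, spray and nonlinear connection\<close>

lemma smooth_Ly: "smooth_on W (\<lambda>z. fd L z (0, e))"
  by (rule smooth_on_fd[OF smooth_L])

lemma smooth_vhess: "smooth_on W (\<lambda>z. vhess L z u w)"
  unfolding vhess_def using smooth_on_fd[OF smooth_Ly]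
  by (rule smooth_on_divide)

lemma vhess_sym: "z \<in> W \<Longrightarrow> vhess L z u w = vhess L z w u"
  unfolding vhess_def using smooth_on_schwarz_real[OF smooth_L] by metis

lemma inner_form_vhess:
  assumes z: "z \<in> W"
  shows "inner_form (vhess L z)"
proof -
  have 1: "linear (\<lambda>u. vhess L z u w)" for w
  proof -
    have "linear (fd (\<lambda>z. fd L z (0, w)) z)" by (rule smooth_on_linear_fd[OF smooth_Ly z])
    from linear_add[OF this, of "(0, _)" "(0, _)"] linear_scale[OF this, of _ "(0, _)"]
    show ?thesis by (intro linearI) (simp_all add: vhess_def add_divide_distrib)
  qed
  have eq: "vhess L z w = (\<lambda>u. vhess L z u w)" for w
    using vhess_sym[OF z] by blast
  have "linear (vhess L z w)" for w
    by (subst eq) (rule 1)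
  with 1 show ?thesis
    using z convex_L[of "fst z" "snd z"] vhess_sym[OF z] by (auto simp: inner_form_def bilinear_def)
qed

text \<open>With the derivatives exchanged, \<open>e\<close> occurs only as a direction, which makes
  linearity in \<open>e\<close> visible.\<close>

lemma spray_form_alt:
  assumes z: "z \<in> W"
  shows "spray_form L z e = (fd (\<lambda>z'. fd L z' (snd z, 0)) z (0, e) - fd L z (e, 0)) / 4"
  unfolding spray_form_def using smooth_on_schwarz_real[OF smooth_L z, of "(0, e)" "(snd z, 0)"] by simp

lemma linear_spray_form: "z \<in> W \<Longrightarrow> linear (spray_form L z)"
proof -
  assume z: "z \<in> W"
  have 1: "linear (fd (\<lambda>z'. fd L z' (snd z, 0)) z)"
    by (rule smooth_on_linear_fd[OF smooth_on_fd[OF smooth_L] z])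
  have 2: "linear (fd L z)" by (rule smooth_on_linear_fd[OF smooth_L z])
  have eq: "spray_form L z e = (fd (\<lambda>z'. fd L z' (snd z, 0)) z (0, e) - fd L z (e, 0)) / 4" for e
    using spray_form_alt[OF z] .
  show ?thesis
    using linear_add[OF 1, of "(0, _)" "(0, _)"] linear_add[OF 2, of "(_, 0)" "(_, 0)"]
      linear_scale[OF 1, of _ "(0, _)"] linear_scale[OF 2, of _ "(_, 0)"]
    by (intro linearI) (simp_all add: eq algebra_simps add_divide_distrib diff_divide_distrib)
qed

lemma smooth_spray_form: "smooth_on W (\<lambda>z. spray_form L z e)"
proof -
  have id: "smooth_on W (\<lambda>z. z)" by (rule smooth_on_ident[OF open_W])
  show ?thesis
    unfolding spray_form_def
    by (intro smooth_on_divide smooth_on_diff smooth_on_fd[OF smooth_L]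
        smooth_on_fd_dir[OF smooth_Ly id] smooth_on_Pair smooth_on_snd[OF id] smooth_on_const[OF open_W]) auto
qed

lemma smooth_spray: "smooth_on W (spray L)"
  unfolding spray_def[abs_def]
  by (rule smooth_on_raise_form[OF open_W inner_form_vhess linear_spray_form smooth_vhess smooth_spray_form])

lemma vhess_spray: "z \<in> W \<Longrightarrow> vhess L z (spray L z) e = spray_form L z e"
  unfolding spray_def by (rule raise_form[OF inner_form_vhess linear_spray_form])

lemma smooth_ncon: "smooth_on W (\<lambda>z. ncon L z w)"
  unfolding ncon_def by (rule smooth_on_fd[OF smooth_spray])

lemma linear_ncon: "z \<in> W \<Longrightarrow> linear (ncon L z)"
proof -
  assume z: "z \<in> W"
  have 1: "linear (fd (spray L) z)" by (rule smooth_on_linear_fd[OF smooth_spray z])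
  show ?thesis
    using linear_add[OF 1, of "(0, _)" "(0, _)"] linear_scale[OF 1, of _ "(0, _)"]
    by (intro linearI) (simp_all add: ncon_def)
qed

section \<open>Homogeneity identities for the fundamental tensor\<close>

lemma Ly_homogeneous: "homogeneous U 1 (\<lambda>z. fd L z (0, e))"
  using homogeneous_fd_vertical[OF smooth_L, of 1] L_homogeneous by (simp add: numeral_2_eq_2)

lemma vhess_homogeneous: "homogeneous U 0 (\<lambda>z. vhess L z u w)"
  using homogeneous_fd_vertical[OF smooth_Ly, of 0 w u] Ly_homogeneous[of w]
  by (simp add: vhess_def homogeneous_def)

lemma vhess_velocity: "(x, v) \<in> W \<Longrightarrow> vhess L (x, v) v w = fd L (x, v) (0, w) / 2"
  unfolding vhess_def using euler_homogeneous[OF smooth_Ly Ly_homogeneous] by simp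

text \<open>Up to a factor this is the Cartan tensor, a third vertical derivative of
  \<open>L\<close>; symmetry of second derivatives lets the differentiating direction change places
  with an argument.\<close>

lemma vhess_vertical_sym:
  "z \<in> W \<Longrightarrow> fd (\<lambda>z. vhess L z u w) z (0, t) = fd (\<lambda>z. vhess L z t w) z (0, u)"
proof -
  assume z: "z \<in> W"
  have eq: "fd (\<lambda>z. vhess L z u w) z (0, t) = fd (\<lambda>z. fd (\<lambda>z. fd L z (0, w)) z (0, u)) z (0, t) / 2" for u t
    unfolding vhess_def
    by (rule fd_divide[OF smooth_on_has_derivative[OF smooth_on_fd[OF smooth_Ly] z]])
  show ?thesis unfolding eq using smooth_on_schwarz_real[OF smooth_Ly z, of w "(0, u)" "(0, t)"] by simp
qed

text \<open>Degree zero makes the derivative of the fundamental tensor along the velocity vanish,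
  and the symmetry of the Cartan tensor moves the velocity into an argument.\<close>

lemma vhess_vertical_velocity:
  assumes z: "(x, v) \<in> W"
  shows "fd (\<lambda>z. vhess L z v w) (x, v) (0, t) = 0"
  using vhess_vertical_sym[OF z, of v w t] euler_homogeneous[OF smooth_vhess vhess_homogeneous, of x v t w] z
  by simp

text \<open>Vertical first derivatives of \<open>L\<close> are homogeneous of degree one, so Euler's
  relation rewrites them through \<open>vhess\<close>. This brings the derivative of the spray into
  Koszul form.\<close>

lemma Ly_horizontal:
  assumes z: "(x, v) \<in> W"
  shows "fd (\<lambda>z. fd L z (0, e)) (x, v) (w, 0) = 2 * fd (\<lambda>z. vhess L z v e) (x, v) (w, 0)"
proof -
  have "fd (\<lambda>z. vhess L z v e) (x, v) (w, 0) = fd (\<lambda>z. fd (\<lambda>z. fd L z (0, e)) z (0, v)) (x, v) (w, 0) / 2"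
    unfolding vhess_def
    by (rule fd_divide[OF smooth_on_has_derivative[OF smooth_on_fd[OF smooth_Ly] z]])
  also have "\<dots> = fd (\<lambda>z. fd (\<lambda>z. fd L z (0, e)) z (w, 0)) (x, v) (0, v) / 2"
    using smooth_on_schwarz_real[OF smooth_Ly z] by simp
  also have "\<dots> = fd (\<lambda>z. fd L z (0, e)) (x, v) (w, 0) / 2"
    using euler_homogeneous[OF smooth_on_fd[OF smooth_Ly] homogeneous_fd_horizontal[OF smooth_Ly Ly_homogeneous]] z
    by simp
  finally show ?thesis by simp
qed

lemma Ly_horizontal_velocity:
  assumes z: "(x, v) \<in> W"
  shows "fd (\<lambda>z. fd L z (0, v)) (x, v) (e, 0) = 2 * fd L (x, v) (e, 0)"
  using smooth_on_schwarz_real[OF smooth_L z, of "(0, v)" "(e, 0)"] z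
    euler_homogeneous[OF smooth_on_fd[OF smooth_L] homogeneous_fd_horizontal[OF smooth_L L_homogeneous], of x v]
  by simp

text \<open>Lowering the index with \<open>vhess\<close>, which has degree zero, reduces the claim
  to \<open>spray_form\<close>. Its terms have degree two: one as a derivative of degree one taken
  along the velocity, the other as a horizontal derivative of \<open>L\<close>.\<close>

lemma spray_homogeneous: "homogeneous U 2 (spray L)"
  unfolding homogeneous_def
proof (intro ballI allI impI)
  fix x v :: 'e and r :: real assume z: "x \<in> U" "v \<noteq> 0" "r > 0"
  have W: "(x, v) \<in> W" "(x, r *\<^sub>R v) \<in> W" using z by auto
  have "fd (\<lambda>z. fd L z (0, e)) (x, r *\<^sub>R v) (r *\<^sub>R v, 0) = r\<^sup>2 * fd (\<lambda>z. fd L z (0, e)) (x, v) (v, 0)" for e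
  proof -
    have "fd (\<lambda>z. fd L z (0, e)) (x, r *\<^sub>R v) (r *\<^sub>R (v, 0)) = r * fd (\<lambda>z. fd L z (0, e)) (x, r *\<^sub>R v) (v, 0)"
      using linear_scale[OF smooth_on_linear_fd[OF smooth_Ly[of e] W(2)], of r "(v, 0)"] by simp
    then show ?thesis
      using homogeneous_fd[OF smooth_Ly Ly_homogeneous z, of e v 0] by (simp add: power2_eq_square)
  qed
  moreover have "fd L (x, r *\<^sub>R v) (e, 0) = r\<^sup>2 * fd L (x, v) (e, 0)" for e
    using homogeneous_fd[OF smooth_L L_homogeneous z, of e 0] by simp
  ultimately have sf: "spray_form L (x, r *\<^sub>R v) e = r\<^sup>2 * spray_form L (x, v) e" for e
    by (simp add: spray_form_def algebra_simps)
  have "vhess L (x, r *\<^sub>R v) (spray L (x, r *\<^sub>R v)) e = vhess L (x, r *\<^sub>R v) (r\<^sup>2 *\<^sub>R spray L (x, v)) e" for e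
  proof -
    have "vhess L (x, r *\<^sub>R v) (spray L (x, r *\<^sub>R v)) e = r\<^sup>2 * vhess L (x, v) (spray L (x, v)) e"
      by (simp only: vhess_spray[OF W(1)] vhess_spray[OF W(2)] sf)
    also have "\<dots> = r\<^sup>2 * vhess L (x, r *\<^sub>R v) (spray L (x, v)) e"
      using homogeneousD[OF vhess_homogeneous z] by simp
    finally show ?thesis by (simp only: inner_form_simps(3)[OF inner_form_vhess[OF W(2)]])
  qed
  then show "spray L (x, r *\<^sub>R v) = r\<^sup>2 *\<^sub>R spray L (x, v)"
    by (rule inner_form_eqI[OF inner_form_vhess[OF W(2)]])
qed

text \<open>The vertical derivative of the equation that defines the spray. The first three terms
  are the Koszul formula with the velocity in one slot; the last is a Cartan tensor correction,
  because the fundamental tensor itself depends on the velocity.\<close>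

lemma vhess_ncon:
  assumes z: "(x, v) \<in> W"
  shows "2 * vhess L (x, v) (ncon L (x, v) w) e =
    fd (\<lambda>z. vhess L z w e) (x, v) (v, 0) + fd (\<lambda>z. vhess L z v e) (x, v) (w, 0)
    - fd (\<lambda>z. vhess L z v w) (x, v) (e, 0) - 2 * fd (\<lambda>z. vhess L z (spray L (x, v)) e) (x, v) (0, w)"
proof -
  let ?z = "(x, v)"
  have lin1: "linear (\<lambda>u. vhess L z u e)" if "z \<in> W" for z
    by (rule inner_form_linear(2)[OF inner_form_vhess[OF that]])
  have lin2: "linear (\<lambda>u. fd (\<lambda>z. fd L z (0, e)) z (u, 0))" if "z \<in> W" for z
    using linear_add[OF smooth_on_linear_fd[OF smooth_Ly[of e] that], of "(_, 0)" "(_, 0)"]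
      linear_scale[OF smooth_on_linear_fd[OF smooth_Ly[of e] that], of _ "(_, 0)"]
    by (intro linearI) simp_all
  have d1: "((\<lambda>z. vhess L z (spray L z) e) has_derivative
      (\<lambda>\<zeta>. fd (\<lambda>z. vhess L z (spray L ?z) e) ?z \<zeta> + vhess L ?z (fd (spray L) ?z \<zeta>) e)) (at ?z)"
    by (rule has_derivative_apply_linear[where l = "\<lambda>z u. vhess L z u e", OF smooth_on_has_derivative[OF smooth_vhess z]
        open_W z lin1 smooth_on_has_derivative[OF smooth_spray z]])
  have d2: "((\<lambda>z. fd (\<lambda>z. fd L z (0, e)) z (snd z, 0)) has_derivative
      (\<lambda>\<zeta>. fd (\<lambda>z. fd (\<lambda>z. fd L z (0, e)) z (snd ?z, 0)) ?z \<zeta> + fd (\<lambda>z. fd L z (0, e)) ?z (snd \<zeta>, 0))) (at ?z)"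
    by (rule has_derivative_apply_linear[where l = "\<lambda>z u. fd (\<lambda>z. fd L z (0, e)) z (u, 0)",
        OF smooth_on_has_derivative[OF smooth_on_fd[OF smooth_Ly] z] open_W z lin2 has_derivative_snd[OF has_derivative_ident]])
  have d3: "((\<lambda>z. (fd (\<lambda>z. fd L z (0, e)) z (snd z, 0) - fd L z (e, 0)) / 4) has_derivative
      (\<lambda>\<zeta>. (fd (\<lambda>z. fd (\<lambda>z. fd L z (0, e)) z (v, 0)) ?z \<zeta> + fd (\<lambda>z. fd L z (0, e)) ?z (snd \<zeta>, 0)
        - fd (\<lambda>z. fd L z (e, 0)) ?z \<zeta>) / 4)) (at ?z)"
    using bounded_linear.has_derivative[OF bounded_linear_divide
        has_derivative_diff[OF d2 smooth_on_has_derivative[OF smooth_on_fd[OF smooth_L] z]]]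
    by simp
  have "((\<lambda>z. vhess L z (spray L z) e) has_derivative
      (\<lambda>\<zeta>. (fd (\<lambda>z. fd (\<lambda>z. fd L z (0, e)) z (v, 0)) ?z \<zeta> + fd (\<lambda>z. fd L z (0, e)) ?z (snd \<zeta>, 0)
        - fd (\<lambda>z. fd L z (e, 0)) ?z \<zeta>) / 4)) (at ?z)"
    by (rule has_derivative_transform_within_open[OF d3 open_W z]) (simp add: vhess_spray spray_form_def)
  from fun_cong[OF has_derivative_unique[OF d1 this], of "(0, w)"]
  have eq: "fd (\<lambda>z. vhess L z (spray L ?z) e) ?z (0, w) + vhess L ?z (ncon L ?z w) e =
      (fd (\<lambda>z. fd (\<lambda>z. fd L z (0, e)) z (v, 0)) ?z (0, w) + fd (\<lambda>z. fd L z (0, e)) ?z (w, 0)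
        - fd (\<lambda>z. fd L z (e, 0)) ?z (0, w)) / 4"
    by (simp add: ncon_def)
  have "fd (\<lambda>z. vhess L z w e) ?z (v, 0) = fd (\<lambda>z. fd (\<lambda>z. fd L z (0, e)) z (0, w)) ?z (v, 0) / 2"
    unfolding vhess_def
    by (rule fd_divide[OF smooth_on_has_derivative[OF smooth_on_fd[OF smooth_Ly] z]])
  then have 1: "fd (\<lambda>z. fd (\<lambda>z. fd L z (0, e)) z (v, 0)) ?z (0, w) = 2 * fd (\<lambda>z. vhess L z w e) ?z (v, 0)"
    using smooth_on_schwarz_real[OF smooth_Ly z, of e "(v, 0)" "(0, w)"] by simp
  have 2: "fd (\<lambda>z. fd L z (e, 0)) ?z (0, w) = 2 * fd (\<lambda>z. vhess L z v w) ?z (e, 0)"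
    using smooth_on_schwarz_real[OF smooth_L z, of "(e, 0)" "(0, w)"] Ly_horizontal[OF z, of w e] by simp
  show ?thesis using eq unfolding 1 2 Ly_horizontal[OF z] by (simp add: algebra_simps)
qed

text \<open>
  Of the derivative \<open>V'\<close> of the extension \<open>V\<close> of the velocity, only \<open>V' v\<close> survives in the Koszul
  formula, because the vertical derivative of \<open>vhess L (x, v)\<close> is totally symmetric and
  annihilates \<open>v\<close>.
\<close>

lemma osculating_christoffel_eq_ncon:
  assumes z: "(x, v) \<in> W" and V: "(V has_derivative V') (at x)" "V x = v" "V' v = - 2 *\<^sub>R spray L (x, v)"
    and sym: "\<And>u w. \<Gamma> u w = \<Gamma> w u"
    and compat: "\<And>u p q. fd (\<lambda>y. vhess L (y, V y) p q) x u =
      vhess L (x, v) (\<Gamma> u p) q + vhess L (x, v) p (\<Gamma> u q)"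
  shows "\<Gamma> v w = ncon L (x, v) w"
proof (rule inner_form_eqI[OF inner_form_vhess[OF z]])
  fix e
  let ?z = "(x, v)"
  note a = inner_form_simps[OF inner_form_vhess[OF z]]
  have d: "fd (\<lambda>y. vhess L (y, V y) p q) x u = fd (\<lambda>z. vhess L z p q) ?z (u, 0) + fd (\<lambda>z. vhess L z p q) ?z (0, V' u)" for p q u
  proof -
    have dP: "((\<lambda>y. (y, V y)) has_derivative (\<lambda>u. (u, V' u))) (at x)"
      by (intro has_derivative_Pair has_derivative_ident V(1))
    have "((\<lambda>z. vhess L z p q) has_derivative fd (\<lambda>z. vhess L z p q) ?z) (at (x, V x))"
      using smooth_on_has_derivative[OF smooth_vhess z] V(2) by simp
    from has_derivative_compose[OF dP this]
    have "fd (\<lambda>y. vhess L (y, V y) p q) x u = fd (\<lambda>z. vhess L z p q) ?z (u, V' u)"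
      by (rule fd_eq[THEN fun_cong])
    also have "\<dots> = fd (\<lambda>z. vhess L z p q) ?z ((u, 0) + (0, V' u))" by simp
    also have "\<dots> = fd (\<lambda>z. vhess L z p q) ?z (u, 0) + fd (\<lambda>z. vhess L z p q) ?z (0, V' u)"
      by (rule linear_add[OF smooth_on_linear_fd[OF smooth_vhess z]])
    finally show ?thesis .
  qed
  have "2 * vhess L ?z (\<Gamma> v w) e =
      fd (\<lambda>y. vhess L (y, V y) w e) x v + fd (\<lambda>y. vhess L (y, V y) v e) x w - fd (\<lambda>y. vhess L (y, V y) v w) x e"
    unfolding compat using sym[of w v] sym[of e v] sym[of e w] vhess_sym[OF z] by simp
  also have "\<dots> = fd (\<lambda>z. vhess L z w e) ?z (v, 0) + fd (\<lambda>z. vhess L z v e) ?z (w, 0) - fd (\<lambda>z. vhess L z v w) ?z (e, 0)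
      + fd (\<lambda>z. vhess L z w e) ?z (0, - 2 *\<^sub>R spray L ?z)"
    unfolding d V(3) using vhess_vertical_velocity[OF z] by simp
  also have "fd (\<lambda>z. vhess L z w e) ?z (0, - 2 *\<^sub>R spray L ?z) = - 2 * fd (\<lambda>z. vhess L z w e) ?z (0, spray L ?z)"
    using linear_scale[OF smooth_on_linear_fd[OF smooth_vhess z], of w e "-2" "(0, spray L ?z)"] by simp
  also have "fd (\<lambda>z. vhess L z w e) ?z (0, spray L ?z) = fd (\<lambda>z. vhess L z (spray L ?z) e) ?z (0, w)"
    by (rule vhess_vertical_sym[OF z])
  finally show "vhess L ?z (\<Gamma> v w) e = vhess L ?z (ncon L ?z w) e"
    using vhess_ncon[OF z, of w e] by simp
qed

section \<open>Euler-Lagrange equation and conservation of energy\<close>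

text \<open>By the chain rule the two sides differ by \<open>4 * vhess L (x, v) (spray L (x, v)) e +
  2 * vhess L (x, v) a e\<close>. Nondegeneracy of \<open>vhess\<close> turns its vanishing for all
  \<open>e\<close> into an equation of vectors.\<close>

lemma euler_lagrange_iff_spray:
  assumes z: "(z has_vector_derivative (v, a)) (at t)" "z t = (x, v)" "(x, v) \<in> W"
  shows "(\<forall>e. ((\<lambda>s. fd L (z s) (0, e)) has_real_derivative fd L (z t) (e, 0)) (at t)) \<longleftrightarrow> a = - 2 *\<^sub>R spray L (x, v)"
proof -
  have d: "((\<lambda>s. fd L (z s) (0, e)) has_real_derivative (4 * vhess L (x, v) (spray L (x, v)) e + fd L (x, v) (e, 0)
      + 2 * vhess L (x, v) a e)) (at t)" for e
  proof -
    have "((\<lambda>z. fd L z (0, e)) has_derivative fd (\<lambda>z. fd L z (0, e)) (z t)) (at (z t))"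
      using smooth_on_has_derivative[OF smooth_Ly z(3)] z(2) by simp
    from has_derivative_compose[OF z(1)[unfolded has_vector_derivative_def] this]
    have "((\<lambda>s. fd L (z s) (0, e)) has_derivative (\<lambda>h. fd (\<lambda>z. fd L z (0, e)) (x, v) (h *\<^sub>R (v, a)))) (at t)"
      using z(2) by simp
    moreover have "fd (\<lambda>z. fd L z (0, e)) (x, v) (h *\<^sub>R (v, a)) = (4 * vhess L (x, v) (spray L (x, v)) e
        + fd L (x, v) (e, 0) + 2 * vhess L (x, v) a e) * h" for h
    proof -
      have l: "linear (fd (\<lambda>z. fd L z (0, e)) (x, v))" by (rule smooth_on_linear_fd[OF smooth_Ly z(3)])
      have "fd (\<lambda>z. fd L z (0, e)) (x, v) (h *\<^sub>R (v, a)) = h *\<^sub>R fd (\<lambda>z. fd L z (0, e)) (x, v) ((v, 0) + (0, a))"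
        using linear_scale[OF l, of h "(v, a)"] by simp
      also have "\<dots> = h * (fd (\<lambda>z. fd L z (0, e)) (x, v) (v, 0) + fd (\<lambda>z. fd L z (0, e)) (x, v) (0, a))"
        by (simp only: linear_add[OF l] real_scaleR_def)
      finally show ?thesis
        unfolding vhess_spray[OF z(3)] by (simp add: spray_form_def vhess_def field_simps)
    qed
    ultimately show ?thesis by (simp add: has_field_derivative_def)
  qed
  have "((\<lambda>s. fd L (z s) (0, e)) has_real_derivative fd L (z t) (e, 0)) (at t) \<longleftrightarrow>
      vhess L (x, v) a e = vhess L (x, v) (- 2 *\<^sub>R spray L (x, v)) e" for e
  proof -
    have "((\<lambda>s. fd L (z s) (0, e)) has_real_derivative fd L (z t) (e, 0)) (at t) \<longleftrightarrow>
      fd L (x, v) (e, 0) = 4 * vhess L (x, v) (spray L (x, v)) e + fd L (x, v) (e, 0) + 2 * vhess L (x, v) a e"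
      using d[of e] DERIV_unique z(2) by metis
    then show ?thesis
      using inner_form_simps(3)[OF inner_form_vhess[OF z(3)], of "-2" "spray L (x, v)" e] by auto
  qed
  then show ?thesis using inner_form_eqI[OF inner_form_vhess[OF z(3)]] by metis
qed

text \<open>By Euler's relation the vertical contribution is
  \<open>- 4 * spray_form L (x, v) v\<close>, which equals \<open>- fd L (x, v) (v, 0)\<close> and
  cancels the horizontal one.\<close>

lemma energy_derivative_spray:
  assumes z: "(z has_vector_derivative (v, - 2 *\<^sub>R spray L (x, v))) (at t)" "z t = (x, v)" "(x, v) \<in> W"
  shows "((\<lambda>s. L (z s)) has_real_derivative 0) (at t)"
proof -
  have l: "linear (fd L (x, v))" by (rule smooth_on_linear_fd[OF smooth_L z(3)])
  have "(L has_derivative fd L (z t)) (at (z t))"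
    using smooth_on_has_derivative[OF smooth_L z(3)] z(2) by simp
  from has_derivative_compose[OF z(1)[unfolded has_vector_derivative_def] this]
  have d: "((\<lambda>s. L (z s)) has_derivative (\<lambda>h. fd L (x, v) (h *\<^sub>R (v, - 2 *\<^sub>R spray L (x, v))))) (at t)"
    using z(2) by simp
  have "fd L (x, v) (v, - 2 *\<^sub>R spray L (x, v)) = fd L (x, v) ((v, 0) + (- 2) *\<^sub>R (0, spray L (x, v)))" by simp
  also have "\<dots> = fd L (x, v) (v, 0) - 2 * fd L (x, v) (0, spray L (x, v))"
    by (simp only: linear_add[OF l] linear_scale[OF l]) simp
  also have "2 * fd L (x, v) (0, spray L (x, v)) = 4 * spray_form L (x, v) v"
    using vhess_velocity[OF z(3)] vhess_sym[OF z(3)] vhess_spray[OF z(3)]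
    by (metis (no_types, opaque_lifting) field_sum_of_halves mult.commute mult_2 numeral_Bit0 distrib_left)
  also have "\<dots> = fd L (x, v) (v, 0)"
    using Ly_horizontal_velocity[OF z(3), of v] by (simp add: spray_form_def)
  finally have "fd L (x, v) (v, - 2 *\<^sub>R spray L (x, v)) = 0" by simp
  then have "fd L (x, v) (h *\<^sub>R (v, - 2 *\<^sub>R spray L (x, v))) = 0" for h
    by (simp only: linear_scale[OF l] scaleR_zero_right)
  then have "((\<lambda>s. L (z s)) has_derivative (\<lambda>h. 0)) (at t)" using d by (simp only:)
  then show ?thesis by (simp add: has_field_derivative_def lambda_zero)
qed

text \<open>
  A vector field \<open>h\<close> with skew derivative is a Killing field of a Euclidean space, so its second
  derivative vanishes; being homogeneous of degree two, it is zero.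
\<close>

lemma spray_eq_if_skew:
  assumes b: "inner_form b" and x: "x \<in> U" and \<Gamma>: "bilinear \<Gamma>" "\<And>u w. \<Gamma> u w = \<Gamma> w u"
    and skew: "\<And>v w. v \<noteq> 0 \<Longrightarrow> b (ncon L (x, v) w - \<Gamma> v w) w = 0"
    and v: "v \<noteq> 0"
  shows "spray L (x, v) = (1/2) *\<^sub>R \<Gamma> v v"
proof -
  let ?V = "UNIV \<times> (UNIV - {0}) :: ('e \<times> 'e) set"
  have opV: "open ?V" by (intro open_Times) auto
  have blG: "bounded_bilinear \<Gamma>" using \<Gamma>(1) bilinear_conv_bounded_bilinear by blast
  \<comment> \<open>The first component is a dummy; it makes the results on homogeneous functions of
    \<open>(x, v)\<close> applicable to a function on one fibre.\<close>
  define h where "h z = spray L (x, snd z) - (1/2) *\<^sub>R \<Gamma> (snd z) (snd z)" for z :: "'e \<times> 'e"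
  have sn: "smooth_on ?V snd" using smooth_on_snd[OF smooth_on_ident[OF opV]] .
  have sh: "smooth_on ?V h"
    unfolding h_def
    by (intro smooth_on_diff smooth_on_compose[OF smooth_spray] smooth_on_Pair smooth_on_const[OF opV] sn
        smooth_on_linear[OF bounded_linear_scaleR_right] smooth_on_bilinear[OF blG]) (use x in auto)
  have hom: "homogeneous UNIV 2 h"
    using homogeneousD[OF spray_homogeneous x]
    by (auto simp: homogeneous_def h_def bilinear_lmul[OF \<Gamma>(1)] bilinear_rmul[OF \<Gamma>(1)] power2_eq_square algebra_simps)
  have dh: "fd h (y, u) (0, w) = ncon L (x, u) w - \<Gamma> u w" if u: "u \<noteq> 0" for y u w
  proof -
    have "((\<lambda>z::'e \<times> 'e. (x, snd z)) has_derivative (\<lambda>\<zeta>. (0, snd \<zeta>))) (at (y, u))"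
      by (intro has_derivative_Pair has_derivative_const has_derivative_snd has_derivative_ident)
    then have "((\<lambda>z. spray L (x, snd z)) has_derivative (\<lambda>\<zeta>. fd (spray L) (x, snd (y, u)) (0, snd \<zeta>))) (at (y, u))"
      by (rule has_derivative_compose) (rule smooth_on_has_derivative[OF smooth_spray], use x u in simp)
    moreover have "((\<lambda>z::'e \<times> 'e. \<Gamma> (snd z) (snd z)) has_derivative (\<lambda>\<zeta>. \<Gamma> (snd (y, u)) (snd \<zeta>) + \<Gamma> (snd \<zeta>) (snd (y, u)))) (at (y, u))"
      by (intro bounded_bilinear.FDERIV[OF blG] has_derivative_snd has_derivative_ident)
    ultimately have "(h has_derivative (\<lambda>\<zeta>. fd (spray L) (x, u) (0, snd \<zeta>) - (1/2) *\<^sub>R (\<Gamma> u (snd \<zeta>) + \<Gamma> (snd \<zeta>) u))) (at (y, u))"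
      unfolding h_def[abs_def] by (intro has_derivative_diff has_derivative_scaleR_right) simp_all
    then have "fd h (y, u) (0, w) = fd (spray L) (x, u) (0, w) - (1/2) *\<^sub>R (\<Gamma> u w + \<Gamma> w u)"
      by (simp add: fd_eq)
    also have "(1/2) *\<^sub>R (\<Gamma> u w + \<Gamma> w u) = \<Gamma> u w"
      using \<Gamma>(2)[of w u] by (simp flip: scaleR_2)
    finally show ?thesis by (simp add: ncon_def)
  qed
  note bs = inner_form_simps[OF b]
  have lh: "linear (fd h z)" if "z \<in> ?V" for z by (rule smooth_on_linear_fd[OF sh that])
  have sk: "b (fd h z (0, p)) q = - b (fd h z (0, q)) p" if z: "z \<in> ?V" for z p q
  proof -
    have u: "snd z \<noteq> 0" using z by auto
    have d: "fd h z (0, w) = ncon L (x, snd z) w - \<Gamma> (snd z) w" for w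
      using dh[OF u, of "fst z" w] by simp
    have s: "b (fd h z (0, w)) w = 0" for w unfolding d by (rule skew[OF u])
    have a: "fd h z (0, p + q) = fd h z (0, p) + fd h z (0, q)"
      using linear_add[OF lh[OF z], of "(0, p)" "(0, q)"] by simp
    show ?thesis using s[of "p + q"] s[of p] s[of q] unfolding a bs by simp
  qed
  define T where "T p q = fd (\<lambda>z. fd h z (0, q)) (x, v) (0, p)" for p q
  have zv: "(x, v) \<in> ?V" using v by auto
  have Tsym: "T p q = T q p" for p q
    unfolding T_def by (rule smooth_on_schwarz[OF sh zv])
  have Tskew: "b (T p q) w = - b (T p w) q" for p q w
  proof -
    have lb: "bounded_linear (\<lambda>u. b u w)" for w
      using inner_form_linear(2)[OF b] linear_conv_bounded_linear by blast
    have d: "((\<lambda>z. b (fd h z (0, q)) w) has_derivative (\<lambda>\<zeta>. b (fd (\<lambda>z. fd h z (0, q)) (x, v) \<zeta>) w)) (at (x, v))" for q w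
      by (rule bounded_linear.has_derivative[OF lb smooth_on_has_derivative[OF smooth_on_fd[OF sh] zv]])
    have "((\<lambda>z. b (fd h z (0, q)) w) has_derivative (\<lambda>\<zeta>. - b (fd (\<lambda>z. fd h z (0, w)) (x, v) \<zeta>) q)) (at (x, v))"
      by (rule has_derivative_transform_within_open[OF has_derivative_minus[OF d] opV zv]) (metis sk)
    from fun_cong[OF has_derivative_unique[OF d this], of "(0, p)"] show ?thesis by (simp add: T_def)
  qed
  \<comment> \<open>Symmetry in the first pair and skewness in the last pair of arguments exclude
    each other unless the form is zero: six alternating exchanges return the arguments with the
    opposite sign.\<close>
  have T0: "T p q = 0" for p q
  proof (rule inner_form_eqI[OF b])
    fix w
    have "b (T p q) w = - b (T p w) q" by (rule Tskew)
    also have "\<dots> = - b (T w p) q" by (simp add: Tsym)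
    also have "\<dots> = b (T w q) p" by (simp add: Tskew[of w p q])
    also have "\<dots> = b (T q w) p" by (simp add: Tsym)
    also have "\<dots> = - b (T q p) w" by (rule Tskew)
    also have "\<dots> = - b (T p q) w" by (simp add: Tsym)
    finally show "b (T p q) w = b 0 w" by (simp add: bs)
  qed
  \<comment> \<open>Euler's relation is used twice: \<open>T v v = 0\<close> gives the vanishing of
    the first derivative along \<open>v\<close>, and this the vanishing of \<open>h\<close>.\<close>
  have "homogeneous UNIV 1 (\<lambda>z. fd h z (0, v))"
    using homogeneous_fd_vertical[OF sh, of 1] hom by (simp add: numeral_2_eq_2)
  from euler_homogeneous[OF smooth_on_fd[OF sh] this, of x v] v T0[of v v]
  have "fd h (x, v) (0, v) = 0" by (simp add: T_def)
  with euler_homogeneous[OF sh hom, of x v] v have "h (x, v) = 0" by simp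
  then show ?thesis by (simp add: h_def)
qed

end

section \<open>Riemannian metrics in a chart\<close>

text \<open>Koszul's formula for coordinate fields, whose brackets vanish, with the index
  raised.\<close>

definition christoffel :: "('e::euclidean_space \<Rightarrow> 'e \<Rightarrow> 'e \<Rightarrow> real) \<Rightarrow> 'e \<Rightarrow> 'e \<Rightarrow> 'e \<Rightarrow> 'e" where
  "christoffel h x u w = raise_form (h x)
     (\<lambda>e. (fd (\<lambda>y. h y w e) x u + fd (\<lambda>y. h y u e) x w - fd (\<lambda>y. h y u w) x e) / 2)"

locale riemann_chart =
  fixes S :: "'e::euclidean_space set" and h :: "'e \<Rightarrow> 'e \<Rightarrow> 'e \<Rightarrow> real"
  assumes open_S: "open S"
    and form: "x \<in> S \<Longrightarrow> inner_form (h x)"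
    and smooth_h: "smooth_on S (\<lambda>x. h x u w)"
begin

lemma h_sym: "x \<in> S \<Longrightarrow> h x u w = h x w u"
  using form unfolding inner_form_def by blast

lemma smooth_on_metric:
  assumes "smooth_on T p" "smooth_on T q" "smooth_on T r" "p ` T \<subseteq> S"
  shows "smooth_on T (\<lambda>t. h (p t) (q t) (r t))"
proof (rule smooth_on_apply_linear[where l = "\<lambda>t \<xi>. h (p t) \<xi> (r t)" and h = q])
  show "smooth_on T (\<lambda>t. h (p t) v (r t))" for v
  proof (rule smooth_on_apply_linear[where l = "\<lambda>t \<xi>. h (p t) v \<xi>" and h = r])
    show "smooth_on T (\<lambda>t. h (p t) v w)" for w
      by (rule smooth_on_compose[OF smooth_h assms(1,4)])
    show "linear (h (p t) v)" if "t \<in> T" for t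
      using inner_form_linear(1)[OF form] assms(4) that by blast
  qed (rule assms)
  show "linear (\<lambda>\<xi>. h (p t) \<xi> (r t))" if "t \<in> T" for t
    using inner_form_linear(2)[OF form] assms(4) that by blast
qed (rule assms)

lemma has_derivative_metric:
  assumes T: "open T" "t \<in> T" "p ` T \<subseteq> S"
    and d: "(p has_derivative p') (at t)" "(q has_derivative q') (at t)" "(r has_derivative r') (at t)"
  shows "((\<lambda>t. h (p t) (q t) (r t)) has_derivative
    (\<lambda>v. fd (\<lambda>y. h y (q t) (r t)) (p t) (p' v) + h (p t) (q t) (r' v) + h (p t) (q' v) (r t))) (at t)"
proof (rule has_derivative_apply_linear[where l = "\<lambda>t \<xi>. h (p t) \<xi> (r t)" and h = q, OF _ T(1,2) _ d(2)])
  have pt: "p t \<in> S" using T by blast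
  show "((\<lambda>t. h (p t) v (r t)) has_derivative (\<lambda>u. fd (\<lambda>y. h y v (r t)) (p t) (p' u) + h (p t) v (r' u))) (at t)" for v
  proof (rule has_derivative_apply_linear[where l = "\<lambda>t \<xi>. h (p t) v \<xi>" and h = r, OF _ T(1,2) _ d(3)])
    show "((\<lambda>t. h (p t) v w) has_derivative (\<lambda>u. fd (\<lambda>y. h y v w) (p t) (p' u))) (at t)" for w
      by (rule has_derivative_compose[OF d(1) smooth_on_has_derivative[OF smooth_h pt]])
    show "linear (h (p s) v)" if "s \<in> T" for s
      using inner_form_linear(1)[OF form] T(3) that by blast
  qed
  show "linear (\<lambda>\<xi>. h (p s) \<xi> (r s))" if "s \<in> T" for s
    using inner_form_linear(2)[OF form] T(3) that by blast
qed

lemma linear_fd_metric: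
  assumes x: "x \<in> S"
  shows "linear (fd (\<lambda>y. h y u w) x)" "linear (\<lambda>u. fd (\<lambda>y. h y u w) x e)" "linear (\<lambda>w. fd (\<lambda>y. h y u w) x e)"
proof -
  show 1: "linear (fd (\<lambda>y. h y u w) x)" for u w by (rule smooth_on_linear_fd[OF smooth_h x])
  have cg: "fd (\<lambda>y. h y u w) x = fd (\<lambda>y. h y w u) x" for u w
    by (rule fd_cong[OF open_S x h_sym])
  show 2: "linear (\<lambda>u. fd (\<lambda>y. h y u w) x e)" for w
  proof (rule linearI)
    fix u v :: 'e and r :: real
    have "((\<lambda>y. h y u w + h y v w) has_derivative (\<lambda>e. fd (\<lambda>y. h y u w) x e + fd (\<lambda>y. h y v w) x e)) (at x)"
      by (intro has_derivative_add smooth_on_has_derivative[OF smooth_h x])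
    then have "((\<lambda>y. h y (u + v) w) has_derivative (\<lambda>e. fd (\<lambda>y. h y u w) x e + fd (\<lambda>y. h y v w) x e)) (at x)"
      by (rule has_derivative_transform_within_open[OF _ open_S x]) (simp add: inner_form_simps[OF form])
    then show "fd (\<lambda>y. h y (u + v) w) x e = fd (\<lambda>y. h y u w) x e + fd (\<lambda>y. h y v w) x e"
      by (simp add: fd_eq)
    have "((\<lambda>y. r * h y u w) has_derivative (\<lambda>e. r * fd (\<lambda>y. h y u w) x e)) (at x)"
      by (intro has_derivative_mult_right smooth_on_has_derivative[OF smooth_h x])
    then have "((\<lambda>y. h y (r *\<^sub>R u) w) has_derivative (\<lambda>e. r * fd (\<lambda>y. h y u w) x e)) (at x)"
      by (rule has_derivative_transform_within_open[OF _ open_S x]) (simp add: inner_form_simps[OF form])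
    then show "fd (\<lambda>y. h y (r *\<^sub>R u) w) x e = r *\<^sub>R fd (\<lambda>y. h y u w) x e"
      by (simp add: fd_eq)
  qed
  show "linear (\<lambda>w. fd (\<lambda>y. h y u w) x e)" unfolding cg[of u] by (rule 2)
qed

lemma linear_koszul:
  assumes x: "x \<in> S"
  shows "linear (\<lambda>e. (fd (\<lambda>y. h y w e) x u + fd (\<lambda>y. h y u e) x w - fd (\<lambda>y. h y u w) x e) / 2)"
  by (rule linearI)
    (simp_all add: linear_add[OF linear_fd_metric(1)[OF x]] linear_add[OF linear_fd_metric(3)[OF x]]
      linear_scale[OF linear_fd_metric(1)[OF x]] linear_scale[OF linear_fd_metric(3)[OF x]] algebra_simps add_divide_distrib diff_divide_distrib)

lemma koszul:
  assumes x: "x \<in> S"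
  shows "h x (christoffel h x u w) e = (fd (\<lambda>y. h y w e) x u + fd (\<lambda>y. h y u e) x w - fd (\<lambda>y. h y u w) x e) / 2"
  unfolding christoffel_def by (rule raise_form[OF form[OF x] linear_koszul[OF x]])

lemma fd_metric_sym: "x \<in> S \<Longrightarrow> fd (\<lambda>y. h y u w) x = fd (\<lambda>y. h y w u) x"
  by (rule fd_cong[OF open_S]) (auto intro: h_sym)

text \<open>Symmetry and compatibility determine the Koszul combination. In a change of charts,
  transformed symbols therefore need only be tested for these two properties.\<close>

lemma christoffel_unique:
  assumes x: "x \<in> S" and sym: "\<And>u w. B u w = B w u"
    and compat: "\<And>u v w. fd (\<lambda>y. h y v w) x u = h x (B u v) w + h x v (B u w)"
  shows "B u w = christoffel h x u w"
proof (rule inner_form_eqI[OF form[OF x]])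
  fix e
  show "h x (B u w) e = h x (christoffel h x u w) e"
    unfolding koszul[OF x] compat
    using sym[of w u] sym[of e u] sym[of e w] h_sym[OF x, of w "B u e"] by simp
qed

lemma christoffel_sym:
  assumes x: "x \<in> S"
  shows "christoffel h x u w = christoffel h x w u"
proof (rule inner_form_eqI[OF form[OF x]])
  show "h x (christoffel h x u w) e = h x (christoffel h x w u) e" for e
    unfolding koszul[OF x] using fd_metric_sym[OF x, of u w] by simp
qed

lemma christoffel_compat:
  assumes x: "x \<in> S"
  shows "fd (\<lambda>y. h y v w) x u = h x (christoffel h x u v) w + h x v (christoffel h x u w)"
  unfolding h_sym[OF x, of v "christoffel h x u w"] koszul[OF x]
  using fd_metric_sym[OF x, of w v] by (simp add: field_simps)

lemma bilinear_christoffel: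
  assumes x: "x \<in> S"
  shows "bilinear (christoffel h x)"
proof -
  have 1: "linear (\<lambda>w. christoffel h x u w)" for u
    by (intro linearI inner_form_eqI[OF form[OF x]])
      (simp_all add: inner_form_simps[OF form[OF x]] koszul[OF x] linear_add[OF linear_fd_metric(1)[OF x]]
        linear_add[OF linear_fd_metric(2)[OF x]] linear_add[OF linear_fd_metric(3)[OF x]]
        linear_scale[OF linear_fd_metric(1)[OF x]] linear_scale[OF linear_fd_metric(2)[OF x]]
        linear_scale[OF linear_fd_metric(3)[OF x]] algebra_simps add_divide_distrib diff_divide_distrib)
  have eq: "(\<lambda>u. christoffel h x u w) = christoffel h x w" for w
    using christoffel_sym[OF x] by blast
  show ?thesis unfolding bilinear_def eq using 1 by blast
qed

lemma smooth_christoffel: "smooth_on S (\<lambda>x. christoffel h x u w)"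
  unfolding christoffel_def
  by (rule smooth_on_raise_form[OF open_S form linear_koszul smooth_h])
    (auto intro!: smooth_on_divide smooth_on_add smooth_on_diff smooth_on_fd[OF smooth_h])

section \<open>The Riemannian energy as the square of a Finsler function\<close>

definition energy :: "'e \<times> 'e \<Rightarrow> real" where
  "energy z = h (fst z) (snd z) (snd z)"

lemma fd_energy:
  assumes x: "x \<in> S"
  shows "fd energy (x, v) (e1, e2) = fd (\<lambda>y. h y v v) x e1 + 2 * h x v e2"
proof -
  have "(energy has_derivative (\<lambda>\<zeta>. fd (\<lambda>y. h y (snd (x, v)) (snd (x, v))) (fst (x, v)) (fst \<zeta>)
      + h (fst (x, v)) (snd (x, v)) (snd \<zeta>) + h (fst (x, v)) (snd \<zeta>) (snd (x, v)))) (at (x, v))"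
    unfolding energy_def[abs_def]
    by (rule has_derivative_metric[where T = "S \<times> UNIV"])
      (use x open_S in \<open>auto intro!: has_derivative_fst has_derivative_snd has_derivative_ident open_Times\<close>)
  then show ?thesis using h_sym[OF x, of v e2] by (simp add: fd_eq)
qed

lemma smooth_energy: "smooth_on (S \<times> UNIV) energy"
proof -
  have id: "smooth_on (S \<times> UNIV) (\<lambda>z. z :: 'e \<times> 'e)"
    by (rule smooth_on_ident) (intro open_Times open_S open_UNIV)
  show ?thesis unfolding energy_def[abs_def]
    by (rule smooth_on_metric[OF smooth_on_fst[OF id] smooth_on_snd[OF id] smooth_on_snd[OF id]]) auto
qed

lemma fd_fd_energy:
  assumes x: "x \<in> S"
  shows "fd (\<lambda>z. fd energy z (0, w)) (x, v) (e1, e2) = 2 * fd (\<lambda>y. h y v w) x e1 + 2 * h x e2 w"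
proof -
  have "((\<lambda>z. h (fst z) (snd z) w) has_derivative (\<lambda>\<zeta>. fd (\<lambda>y. h y (snd (x, v)) w) (fst (x, v)) (fst \<zeta>)
      + h (fst (x, v)) (snd (x, v)) 0 + h (fst (x, v)) (snd \<zeta>) w)) (at (x, v))"
    by (rule has_derivative_metric[where T = "S \<times> UNIV"])
      (use x open_S in \<open>auto intro!: has_derivative_fst has_derivative_snd has_derivative_ident open_Times\<close>)
  from has_derivative_mult_right[OF this, of 2]
  have "((\<lambda>z. fd energy z (0, w)) has_derivative (\<lambda>\<zeta>. 2 * (fd (\<lambda>y. h y (snd (x, v)) w) (fst (x, v)) (fst \<zeta>)
      + h (fst (x, v)) (snd (x, v)) 0 + h (fst (x, v)) (snd \<zeta>) w))) (at (x, v))"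
  proof (rule has_derivative_transform_within_open)
    show "open (S \<times> (UNIV :: 'e set))" by (intro open_Times open_S open_UNIV)
    show "(x, v) \<in> S \<times> UNIV" using x by simp
    fix z :: "'e \<times> 'e" assume "z \<in> S \<times> UNIV"
    then obtain y u where "z = (y, u)" "y \<in> S" by blast
    then show "2 * h (fst z) (snd z) w = fd energy z (0, w)"
      using linear_0[OF linear_fd_metric(1)[of y u u]] by (simp add: fd_energy)
  qed
  then show ?thesis by (simp add: fd_eq inner_form_simps[OF form[OF x]])
qed

lemma vhess_energy: "x \<in> S \<Longrightarrow> vhess energy (x, v) u w = h x u w"
  using linear_0[OF linear_fd_metric(1)[of x v w]] by (simp add: vhess_def fd_fd_energy)

lemma finsler_chart_energy: "finsler_chart S energy"
proof
  show "smooth_on (S \<times> (UNIV - {0})) energy"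
    by (rule smooth_on_subset[OF smooth_energy]) (auto intro!: open_Times open_S)
  show "continuous_on (S \<times> UNIV) energy" by (rule smooth_on_continuous[OF smooth_energy])
  show "energy (x, r *\<^sub>R v) = r\<^sup>2 * energy (x, v)" if "x \<in> S" "r \<ge> 0" for x r v
    using that by (simp add: energy_def inner_form_simps[OF form] power2_eq_square)
  show "energy (x, v) > 0" if "x \<in> S" "v \<noteq> 0" for x v
    using form[OF that(1)] that(2) by (simp add: energy_def inner_form_def)
  show "vhess energy (x, v) u u > 0" if "x \<in> S" "v \<noteq> 0" "u \<noteq> 0" for x v u
    using form[OF that(1)] that(3) vhess_energy[OF that(1)] by (simp add: inner_form_def)
qed (rule open_S)

text \<open>The horizontal derivatives in \<open>spray_form\<close> reproduce Koszul's formula on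
  the diagonal; the factor 1/2 comes from the convention \<open>x'' = - 2 spray\<close>.\<close>

lemma spray_energy:
  assumes x: "x \<in> S" and v: "v \<noteq> 0"
  shows "spray energy (x, v) = (1/2) *\<^sub>R christoffel h x v v"
proof (rule inner_form_eqI[OF form[OF x]])
  fix e
  have "h x (spray energy (x, v)) e = spray_form energy (x, v) e"
    using finsler_chart.vhess_spray[OF finsler_chart_energy, of "(x, v)" e] x v vhess_energy[OF x] by simp
  also have "\<dots> = h x ((1/2) *\<^sub>R christoffel h x v v) e"
    by (simp add: spray_form_def fd_fd_energy[OF x] fd_energy[OF x] inner_form_simps[OF form[OF x]] koszul[OF x])
  finally show "h x (spray energy (x, v)) e = h x ((1/2) *\<^sub>R christoffel h x v v) e" .
qed

end

text \<open>Second derivatives of \<psi> enter twice, through the derivative of \<open>L2\<close> in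
  \<open>x\<close> and through the moving direction \<open>fd \<psi> (x s) e\<close>; their symmetry
  makes both contributions agree. The Euler-Lagrange equation then needs verification in one chart
  only.\<close>

lemma euler_lagrange_transform:
  fixes \<psi> :: "'e::euclidean_space \<Rightarrow> 'e" and L1 L2 :: "'e \<times> 'e \<Rightarrow> real"
  assumes \<psi>: "smooth_on O2 \<psi>" and L1: "smooth_on W1 L1"
    and W2: "open W2" "\<And>x v. (x, v) \<in> W2 \<Longrightarrow> x \<in> O2 \<and> (\<psi> x, fd \<psi> x v) \<in> W1 \<and> L2 (x, v) = L1 (\<psi> x, fd \<psi> x v)"
    and T: "open T" "t \<in> T" "\<And>s. s \<in> T \<Longrightarrow> (x s, v s) \<in> W2"
    and xv: "(x has_vector_derivative v t) (at t)"
    and el: "\<And>e. ((\<lambda>s. fd L1 (\<psi> (x s), fd \<psi> (x s) (v s)) (0, e)) has_real_derivative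
        fd L1 (\<psi> (x t), fd \<psi> (x t) (v t)) (e, 0)) (at t)"
  shows "((\<lambda>s. fd L2 (x s, v s) (0, e)) has_real_derivative fd L2 (x t, v t) (e, 0)) (at t)"
proof -
  have dL: "fd L2 (y, u) (e1, e2) = fd L1 (\<psi> y, fd \<psi> y u) (fd \<psi> y e1, fd (\<lambda>y. fd \<psi> y u) y e1 + fd \<psi> y e2)"
    if yu: "(y, u) \<in> W2" for y u e1 e2
  proof -
    have y: "y \<in> O2" using W2(2)[OF yu] by blast
    have d1: "((\<lambda>z. \<psi> (fst z)) has_derivative (\<lambda>\<zeta>. fd \<psi> y (fst \<zeta>))) (at (y, u))"
      using has_derivative_compose[OF has_derivative_fst[OF has_derivative_ident], of \<psi> "fd \<psi> y" "(y, u)" UNIV]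
        smooth_on_has_derivative[OF \<psi> y] by simp
    have d2: "((\<lambda>z. fd \<psi> (fst z) (snd z)) has_derivative
        (\<lambda>\<zeta>. fd (\<lambda>x. fd \<psi> x (snd (y, u))) y (fst \<zeta>) + fd \<psi> (fst (y, u)) (snd \<zeta>))) (at (y, u))"
    proof (rule has_derivative_apply_linear[where l = "\<lambda>z. fd \<psi> (fst z)" and h = "snd :: 'e \<times> 'e \<Rightarrow> 'e"
          and l' = "\<lambda>w (\<zeta> :: 'e \<times> 'e). fd (\<lambda>y. fd \<psi> y w) y (fst \<zeta>)"
          and S = "O2 \<times> (UNIV :: 'e set)"])
      show "((\<lambda>z. fd \<psi> (fst z) w) has_derivative (\<lambda>\<zeta>. fd (\<lambda>y. fd \<psi> y w) y (fst \<zeta>))) (at (y, u))" for w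
        using has_derivative_compose[OF has_derivative_fst[OF has_derivative_ident], of "\<lambda>y. fd \<psi> y w" "fd (\<lambda>y. fd \<psi> y w) y" "(y, u)" UNIV]
          smooth_on_has_derivative[OF smooth_on_fd[OF \<psi>] y] by simp
      show "open (O2 \<times> (UNIV :: 'e set))" using smooth_on_open[OF \<psi>] by (intro open_Times) auto
      show "linear (fd \<psi> (fst z))" if "z \<in> O2 \<times> (UNIV :: 'e set)" for z
        using smooth_on_linear_fd[OF \<psi>] that by auto
    qed (use y in \<open>auto intro!: has_derivative_snd has_derivative_ident\<close>)
    have "(L1 has_derivative fd L1 (\<psi> y, fd \<psi> y u)) (at (\<psi> (fst (y, u)), fd \<psi> (fst (y, u)) (snd (y, u))))"
      using smooth_on_has_derivative[OF L1] W2(2)[OF yu] by simp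
    from has_derivative_compose[OF has_derivative_Pair[OF d1 d2] this]
    have "((\<lambda>z. L1 (\<psi> (fst z), fd \<psi> (fst z) (snd z))) has_derivative (\<lambda>\<zeta>. fd L1 (\<psi> y, fd \<psi> y u)
        (fd \<psi> y (fst \<zeta>), fd (\<lambda>y. fd \<psi> y u) y (fst \<zeta>) + fd \<psi> y (snd \<zeta>)))) (at (y, u))" by simp
    then have "(L2 has_derivative (\<lambda>\<zeta>. fd L1 (\<psi> y, fd \<psi> y u)
        (fd \<psi> y (fst \<zeta>), fd (\<lambda>y. fd \<psi> y u) y (fst \<zeta>) + fd \<psi> y (snd \<zeta>)))) (at (y, u))"
      by (rule has_derivative_transform_within_open[OF _ W2(1) yu]) (use W2(2) in auto)
    then show ?thesis by (simp add: fd_eq)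
  qed
  have tW: "(x t, v t) \<in> W2" using T by blast
  have xt: "x t \<in> O2" using W2(2)[OF tW] by blast
  \<comment> \<open>A constant test vector \<open>e\<close> becomes the moving vector
    \<open>fd \<psi> (x s) e\<close> under the change of coordinates, hence the second term.\<close>
  have "((\<lambda>s. fd L1 (\<psi> (x s), fd \<psi> (x s) (v s)) (0, fd \<psi> (x s) e)) has_derivative
      (\<lambda>r. r * fd L1 (\<psi> (x t), fd \<psi> (x t) (v t)) (fd \<psi> (x t) e, 0) +
        fd L1 (\<psi> (x t), fd \<psi> (x t) (v t)) (0, fd (\<lambda>y. fd \<psi> y e) (x t) (r *\<^sub>R v t)))) (at t)"
  proof (rule has_derivative_apply_linear[where l = "\<lambda>s u. fd L1 (\<psi> (x s), fd \<psi> (x s) (v s)) (0, u)", OF _ T(1,2)])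
    show "((\<lambda>s. fd L1 (\<psi> (x s), fd \<psi> (x s) (v s)) (0, u)) has_derivative
        (\<lambda>r. r * fd L1 (\<psi> (x t), fd \<psi> (x t) (v t)) (u, 0))) (at t)" for u
      using el[of u] by (simp add: has_field_derivative_def mult.commute[of _ "fd L1 (\<psi> (x t), fd \<psi> (x t) (v t)) (u, 0)"])
    show "linear (\<lambda>u. fd L1 (\<psi> (x s), fd \<psi> (x s) (v s)) (0, u))" if "s \<in> T" for s
    proof -
      have l: "linear (fd L1 (\<psi> (x s), fd \<psi> (x s) (v s)))"
        by (rule smooth_on_linear_fd[OF L1]) (use W2(2) T(3)[OF that] in blast)
      show ?thesis
        using linear_add[OF l, of "(0, _)" "(0, _)"] linear_scale[OF l, of _ "(0, _)"] by (intro linearI) simp_all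
    qed
    show "((\<lambda>s. fd \<psi> (x s) e) has_derivative (\<lambda>r. fd (\<lambda>y. fd \<psi> y e) (x t) (r *\<^sub>R v t))) (at t)"
      by (rule has_derivative_compose[OF xv[unfolded has_vector_derivative_def] smooth_on_has_derivative[OF smooth_on_fd[OF \<psi>] xt]])
  qed
  moreover have "r * fd L1 (\<psi> (x t), fd \<psi> (x t) (v t)) (fd \<psi> (x t) e, 0) +
        fd L1 (\<psi> (x t), fd \<psi> (x t) (v t)) (0, fd (\<lambda>y. fd \<psi> y e) (x t) (r *\<^sub>R v t)) = r * fd L2 (x t, v t) (e, 0)" for r
  proof -
    let ?z = "(\<psi> (x t), fd \<psi> (x t) (v t))"
    have l: "linear (fd L1 ?z)" by (rule smooth_on_linear_fd[OF L1]) (use W2(2) tW in blast)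
    have l2: "linear (fd (\<lambda>y. fd \<psi> y e) (x t))" by (rule smooth_on_linear_fd[OF smooth_on_fd[OF \<psi>] xt])
    have l3: "linear (fd \<psi> (x t))" by (rule smooth_on_linear_fd[OF \<psi> xt])
    have "fd L1 ?z (0, fd (\<lambda>y. fd \<psi> y e) (x t) (r *\<^sub>R v t)) = r * fd L1 ?z (0, fd (\<lambda>y. fd \<psi> y e) (x t) (v t))"
      using linear_scale[OF l, of r "(0, _)"] by (simp add: linear_scale[OF l2])
    moreover have "fd L1 ?z (fd \<psi> (x t) e, 0) + fd L1 ?z (0, fd (\<lambda>y. fd \<psi> y e) (x t) (v t)) = fd L2 (x t, v t) (e, 0)"
      using linear_add[OF l, of "(fd \<psi> (x t) e, 0)" "(0, fd (\<lambda>y. fd \<psi> y e) (x t) (v t))"]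
        smooth_on_schwarz[OF \<psi> xt, of e "v t"] by (simp add: dL[OF tW] linear_0[OF l3])
    ultimately show ?thesis by (simp only: distrib_left[symmetric])
  qed
  ultimately have "((\<lambda>s. fd L1 (\<psi> (x s), fd \<psi> (x s) (v s)) (0, fd \<psi> (x s) e)) has_real_derivative fd L2 (x t, v t) (e, 0)) (at t)"
    by (simp add: has_field_derivative_def mult.commute[of _ "fd L2 (x t, v t) (e, 0)"])
  then show ?thesis
  proof (rule DERIV_cong_ev[THEN iffD1, OF refl _ refl, rotated])
    have "\<forall>\<^sub>F s in nhds t. s \<in> T" using T eventually_nhds by blast
    then show "\<forall>\<^sub>F s in nhds t. fd L1 (\<psi> (x s), fd \<psi> (x s) (v s)) (0, fd \<psi> (x s) e) = fd L2 (x s, v s) (0, e)"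
    proof eventually_elim
      case (elim s)
      have sW: "(x s, v s) \<in> W2" using T(3)[OF elim] .
      have "x s \<in> O2" using W2(2)[OF sW] by blast
      then show ?case
        using linear_0[OF smooth_on_linear_fd[OF \<psi>]] linear_0[OF smooth_on_linear_fd[OF smooth_on_fd[OF \<psi>]]]
        by (simp add: dL[OF sW])
    qed
  qed
qed

text \<open>A positive derivative gives strict monotonicity. The derivative of the inverse is
  expressed through the inverse itself, which raises its smoothness one order at a time. The result
  serves to read the parameter of a curve off one coordinate.\<close>

lemma smooth_on_inverse_function_real:
  fixes s :: "real \<Rightarrow> real"
  assumes J: "open J" "is_interval J" and s: "smooth_on J s" "\<And>t. t \<in> J \<Longrightarrow> fd s t 1 > 0"
  shows "inj_on s J" "open (s ` J)" "smooth_on (s ` J) (inv_into J s)"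
proof -
  have D: "(s has_real_derivative fd s t 1) (at t)" if "t \<in> J" for t
  proof -
    have "fd s t h = fd s t 1 * h" for h
      using linear_scale[OF smooth_on_linear_fd[OF s(1) that], of h 1] by (simp add: mult.commute)
    then have "fd s t = (*) (fd s t 1)" by blast
    then show ?thesis using smooth_on_has_derivative[OF s(1) that] by (simp add: has_field_derivative_def)
  qed
  have lt: "s a < s b" if "a \<in> J" "b \<in> J" "a < b" for a b
  proof (rule DERIV_pos_imp_increasing[OF that(3)])
    fix t assume "a \<le> t" "t \<le> b"
    then have "t \<in> J" using J(2) that unfolding is_interval_1 by blast
    then show "\<exists>y. (s has_real_derivative y) (at t) \<and> y > 0" using D s(2) by blast
  qed
  show inj: "inj_on s J"
    by (rule inj_onI) (metis lt less_irrefl linorder_neqE)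
  show op: "open (s ` J)"
    by (rule invariance_of_domain[OF smooth_on_continuous[OF s(1)] J(1) inj])
  let ?\<tau> = "inv_into J s"
  have \<tau>: "?\<tau> y \<in> J" "s (?\<tau> y) = y" if "y \<in> s ` J" for y
    using that by (auto intro: inv_into_into f_inv_into_f)
  have d\<tau>: "(?\<tau> has_derivative (\<lambda>v. v * inverse (fd s (?\<tau> y) 1))) (at y)" if y: "y \<in> s ` J" for y
  proof (rule has_derivative_inverse_strong_x[where f = s and g = "inv_into J s" and f' = "fd s (inv_into J s y)"])
    show "?\<tau> (s t) = t" if "t \<in> J" for t by (rule inv_into_f_f[OF inj that])
    have "fd s (?\<tau> y) (v * inverse (fd s (?\<tau> y) 1)) = v" for v
      using linear_scale[OF smooth_on_linear_fd[OF s(1) \<tau>(1)[OF y]], of "v * inverse (fd s (?\<tau> y) 1)" 1]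
        s(2)[OF \<tau>(1)[OF y]] by simp
    then show "fd s (?\<tau> y) \<circ> (\<lambda>v. v * inverse (fd s (?\<tau> y) 1)) = id" by auto
  qed (use J \<tau>[OF y] smooth_on_continuous[OF s(1)] smooth_on_has_derivative[OF s(1)] in auto)
  have "Ck_on k ?\<tau> (s ` J)" for k
  proof (induction k)
    case 0
    have "isCont ?\<tau> y" if "y \<in> s ` J" for y
      using has_derivative_continuous[OF d\<tau>[OF that]] .
    then show ?case by (simp add: continuous_at_imp_continuous_on)
  next
    case (Suc k)
    have "Ck_on k (\<lambda>t. fd s t 1) J" using smooth_on_fd[OF s(1)] by (simp add: smooth_on_def)
    then have "Ck_on k (\<lambda>y. fd s (?\<tau> y) 1) (s ` J)"
      by (rule Ck_on_compose[OF op J(1), where f = "\<lambda>t. fd s t 1", rotated, OF _ Suc.IH]) (use \<tau>(1) in auto)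
    then have "Ck_on k (\<lambda>y. inverse (fd s (?\<tau> y) 1)) (s ` J)"
      by (rule Ck_on_inverse[OF op, rotated]) (use s(2)[OF \<tau>(1)] in force)
    then have "Ck_on k (\<lambda>y. v * inverse (fd s (?\<tau> y) 1)) (s ` J)" for v
      by (rule Ck_on_linear[OF op bounded_linear_mult_right])
    then show ?case
      using d\<tau> by (intro Ck_on_SucI[OF op, where f' = "\<lambda>y v. v * inverse (fd s (?\<tau> y) 1)"]) blast+
  qed
  then show "smooth_on (s ` J) ?\<tau>" using op by (simp add: smooth_on_def)
qed

lemma has_vector_derivative_zero_imp_eq:
  fixes x :: "real \<Rightarrow> 'b::real_normed_vector"
  assumes T: "convex T" "\<And>s. s \<in> T \<Longrightarrow> (x has_vector_derivative 0) (at s)" and st: "s \<in> T" "t \<in> T"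
  shows "x s = x t"
proof -
  have "(x has_derivative (\<lambda>h. 0)) (at s within T)" if "s \<in> T" for s
    using has_derivative_at_withinI[OF T(2)[OF that, unfolded has_vector_derivative_def]] by simp
  then obtain c where "\<And>s. s \<in> T \<Longrightarrow> x s = c"
    using has_derivative_zero_constant[OF T(1), of x] by metis
  then show ?thesis using st by metis
qed

section \<open>Manifolds\<close>

abbreviation cod :: "('a, 'e) chart \<Rightarrow> 'e set" where
  "cod c \<equiv> snd c ` fst c"

definition metric_rep ::
  "('a, 'e::euclidean_space) chart set \<Rightarrow> ('a \<Rightarrow> ('a, 'e) tvec \<Rightarrow> ('a, 'e) tvec \<Rightarrow> real) \<Rightarrow>
   ('a, 'e) chart \<Rightarrow> 'e \<Rightarrow> 'e \<Rightarrow> 'e \<Rightarrow> real" where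
  "metric_rep A g c x u w = g (cinv c x) (tvec_of A c (cinv c x) u) (tvec_of A c (cinv c x) w)"

locale smooth_mfd =
  fixes M :: "'a topology" and A :: "('a, 'e::euclidean_space) chart set"
  assumes mfd: "smooth_manifold M A"
begin

section \<open>Charts and their inverses\<close>

lemma chart_open: "c \<in> A \<Longrightarrow> openin M (fst c)" and cod_open: "c \<in> A \<Longrightarrow> open (cod c)"
  and chart_homeo: "c \<in> A \<Longrightarrow> homeomorphic_map (subtopology M (fst c)) (top_of_set (cod c)) (snd c)"
  using mfd by (auto simp: smooth_manifold_def is_chart_def)

lemma chart_subset: "c \<in> A \<Longrightarrow> fst c \<subseteq> topspace M"
  using chart_open openin_subset by blast

lemma covered: "p \<in> topspace M \<Longrightarrow> \<exists>c\<in>A. p \<in> fst c"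
  using mfd unfolding smooth_manifold_def by blast

lemma chart_inj: "c \<in> A \<Longrightarrow> inj_on (snd c) (fst c)"
  using homeomorphic_imp_injective_map[OF chart_homeo] chart_subset
  by (simp add: inf.absorb2)

lemma cinv_chart: "c \<in> A \<Longrightarrow> p \<in> fst c \<Longrightarrow> cinv c (snd c p) = p"
  unfolding cinv_def using chart_inj inv_into_f_f by metis

lemma chart_cinv: "x \<in> cod c \<Longrightarrow> snd c (cinv c x) = x" and cinv_in: "x \<in> cod c \<Longrightarrow> cinv c x \<in> fst c"
  unfolding cinv_def by (auto intro: f_inv_into_f inv_into_into)

lemma image_chart_iff:
  assumes c: "c \<in> A"
  shows "x \<in> snd c ` (U \<inter> fst c) \<longleftrightarrow> x \<in> cod c \<and> cinv c x \<in> U"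
proof
  assume "x \<in> snd c ` (U \<inter> fst c)"
  then obtain p where "x = snd c p" "p \<in> U" "p \<in> fst c" by blast
  then show "x \<in> cod c \<and> cinv c x \<in> U" using cinv_chart[OF c] by simp
next
  assume x: "x \<in> cod c \<and> cinv c x \<in> U"
  then have "snd c (cinv c x) \<in> snd c ` (U \<inter> fst c)" using cinv_in[of x c] by (intro imageI) simp
  then show "x \<in> snd c ` (U \<inter> fst c)" using chart_cinv[of x c] x by simp
qed

lemma image_open:
  assumes c: "c \<in> A" and U: "openin M U"
  shows "open (snd c ` (U \<inter> fst c))"
proof -
  have "openin (subtopology M (fst c)) (U \<inter> fst c)"
    by (rule openin_subtopology_Int[OF U])
  then have "openin (top_of_set (cod c)) (snd c ` (U \<inter> fst c))"
    using homeomorphic_imp_open_map[OF chart_homeo[OF c]] by (simp add: open_map_def)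
  then show ?thesis using cod_open[OF c] by (simp add: openin_open_eq)
qed

lemma cinv_image_open:
  assumes c: "c \<in> A" and V: "open V" "V \<subseteq> cod c"
  shows "openin M (cinv c ` V)"
proof -
  have "continuous_map (subtopology M (fst c)) (top_of_set (cod c)) (snd c)"
    by (rule homeomorphic_imp_continuous_map[OF chart_homeo[OF c]])
  moreover have "openin (top_of_set (cod c)) V" using V by (simp add: openin_open_eq cod_open[OF c])
  ultimately have "openin (subtopology M (fst c)) {p \<in> topspace (subtopology M (fst c)). snd c p \<in> V}"
    by (rule openin_continuous_map_preimage)
  moreover have "{p \<in> topspace (subtopology M (fst c)). snd c p \<in> V} = cinv c ` V"
  proof
    show "{p \<in> topspace (subtopology M (fst c)). snd c p \<in> V} \<subseteq> cinv c ` V"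
    proof
      fix p assume "p \<in> {p \<in> topspace (subtopology M (fst c)). snd c p \<in> V}"
      then show "p \<in> cinv c ` V" using imageI[of "snd c p" V "cinv c"] cinv_chart[OF c, of p] by simp
    qed
    show "cinv c ` V \<subseteq> {p \<in> topspace (subtopology M (fst c)). snd c p \<in> V}"
    proof (rule image_subsetI)
      fix x assume x: "x \<in> V"
      then have "x \<in> cod c" using V(2) by blast
      then show "cinv c x \<in> {p \<in> topspace (subtopology M (fst c)). snd c p \<in> V}"
        using cinv_in[of x c] chart_cinv[of x c] chart_subset[OF c] x by auto
    qed
  qed
  ultimately have "openin (subtopology M (fst c)) (cinv c ` V)" by simp
  then show ?thesis by (rule openin_trans_full[OF _ chart_open[OF c]])
qed

section \<open>Transition maps and tangent vectors\<close>

lemma transition_smooth: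
  "c \<in> A \<Longrightarrow> d \<in> A \<Longrightarrow> smooth_on (snd c ` (fst c \<inter> fst d)) (transition c d)"
  using mfd by (simp add: smooth_manifold_def)

lemma transition_apply: "c \<in> A \<Longrightarrow> p \<in> fst c \<Longrightarrow> transition c d (snd c p) = snd d p"
  by (simp add: transition_def cinv_chart)

lemma transition_has_derivative:
  assumes "c \<in> A" "d \<in> A" "p \<in> fst c" "p \<in> fst d"
  shows "(transition c d has_derivative dtransition c d p) (at (snd c p))"
  unfolding dtransition_def by (rule smooth_on_has_derivative[OF transition_smooth]) (use assms in auto)

lemma dtransition_linear:
  "c \<in> A \<Longrightarrow> d \<in> A \<Longrightarrow> p \<in> fst c \<Longrightarrow> p \<in> fst d \<Longrightarrow> linear (dtransition c d p)"
  using transition_has_derivative has_derivative_linear by blast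

lemma dtransition_refl:
  assumes c: "c \<in> A" "p \<in> fst c"
  shows "dtransition c c p = (\<lambda>v. v)"
proof -
  have "((\<lambda>x. x) has_derivative (\<lambda>v. v)) (at (snd c p))" by (rule has_derivative_ident)
  then have "(transition c c has_derivative (\<lambda>v. v)) (at (snd c p))"
    by (rule has_derivative_transform_within_open[OF _ cod_open[OF c(1)]])
      (use c in \<open>auto simp: transition_apply\<close>)
  then show ?thesis by (simp add: dtransition_def fd_eq)
qed

lemma dtransition_cocycle:
  assumes A: "c \<in> A" "d \<in> A" "e \<in> A" and p: "p \<in> fst c" "p \<in> fst d" "p \<in> fst e"
  shows "dtransition d e p (dtransition c d p \<xi>) = dtransition c e p \<xi>"
proof -
  have op: "open (snd c ` ((fst d \<inter> fst e) \<inter> fst c))"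
    by (intro image_open openin_Int chart_open A)
  have "((\<lambda>x. transition d e (transition c d x)) has_derivative (\<lambda>v. dtransition d e p (dtransition c d p v))) (at (snd c p))"
    by (rule has_derivative_compose[OF transition_has_derivative])
      (use A p transition_has_derivative[of d e p] transition_apply[of c p d] in auto)
  then have "(transition c e has_derivative (\<lambda>v. dtransition d e p (dtransition c d p v))) (at (snd c p))"
    by (rule has_derivative_transform_within_open[OF _ op]) (use A p in \<open>auto simp: transition_apply\<close>)
  then show ?thesis by (simp add: dtransition_def[of c e] fd_eq)
qed

lemma dtransition_inverse:
  assumes "c \<in> A" "d \<in> A" "p \<in> fst c" "p \<in> fst d"
  shows "dtransition d c p (dtransition c d p \<xi>) = \<xi>"
  using dtransition_cocycle[of c d c p \<xi>] dtransition_refl[of c p] assms by simp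

lemma tvec_of_apply: "d \<in> A \<Longrightarrow> p \<in> fst d \<Longrightarrow> tvec_of A c p \<xi> d = dtransition c d p \<xi>"
  by (simp add: tvec_of_def)

lemma tvec_of_self: "c \<in> A \<Longrightarrow> p \<in> fst c \<Longrightarrow> tvec_of A c p \<xi> c = \<xi>"
  by (simp add: tvec_of_def dtransition_refl)

lemma tvec_of_tangent: "c \<in> A \<Longrightarrow> p \<in> fst c \<Longrightarrow> tvec_of A c p \<xi> \<in> tangent_space A p"
  unfolding tangent_space_def by (auto simp: tvec_of_def dtransition_cocycle)

lemma tangent_component:
  assumes "v \<in> tangent_space A p" "c \<in> A" "d \<in> A" "p \<in> fst c" "p \<in> fst d"
  shows "v d = dtransition c d p (v c)"
  using assms unfolding tangent_space_def by blast

lemma tvec_of_component: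
  assumes "c \<in> A" "p \<in> fst c" "v \<in> tangent_space A p"
  shows "tvec_of A c p (v c) = v"
proof
  fix d
  show "tvec_of A c p (v c) d = v d"
  proof (cases "d \<in> A \<and> p \<in> fst d")
    case True
    then have "v d = dtransition c d p (v c)" using tangent_component assms by blast
    then show ?thesis using True by (simp only: tvec_of_def simp_thms if_True)
  next
    case False
    then have "v d = 0" using assms(3) unfolding tangent_space_def by blast
    then show ?thesis using False by (auto simp: tvec_of_def)
  qed
qed

lemma tvec_of_dtransition:
  assumes "c \<in> A" "d \<in> A" "p \<in> fst c" "p \<in> fst d"
  shows "tvec_of A d p (dtransition c d p \<xi>) = tvec_of A c p \<xi>"
  using assms by (auto simp: tvec_of_def dtransition_cocycle)

lemma tvec_of_lincomb:
  assumes "c \<in> A" "p \<in> fst c"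
  shows "(\<lambda>e. a *\<^sub>R tvec_of A c p u e + b *\<^sub>R tvec_of A c p w e) = tvec_of A c p (a *\<^sub>R u + b *\<^sub>R w)"
  using assms by (auto simp: tvec_of_def linear_add[OF dtransition_linear] linear_scale[OF dtransition_linear])

lemma tvec_of_eq_tzero_iff:
  assumes "c \<in> A" "p \<in> fst c"
  shows "tvec_of A c p \<xi> = tzero \<longleftrightarrow> \<xi> = 0"
proof
  show "\<xi> = 0" if "tvec_of A c p \<xi> = tzero"
    using tvec_of_self[OF assms, of \<xi>] fun_cong[OF that, of c] by (simp add: tzero_def)
  show "tvec_of A c p \<xi> = tzero" if "\<xi> = 0"
    using that assms by (auto simp: tzero_def tvec_of_def linear_0[OF dtransition_linear])
qed

lemma tangent_eq_tzero_iff: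
  assumes "c \<in> A" "p \<in> fst c" "v \<in> tangent_space A p"
  shows "v = tzero \<longleftrightarrow> v c = 0"
  using tvec_of_component[OF assms] tvec_of_eq_tzero_iff[OF assms(1,2), of "v c"] by simp

section \<open>Riemannian metrics in charts and their Levi-Civita connections\<close>

lemma riemann_chart_metric_rep:
  assumes g: "riemannian_metric_on A U g" and U: "openin M U" and c: "c \<in> A"
  shows "riemann_chart (snd c ` (U \<inter> fst c)) (metric_rep A g c)"
proof
  show "open (snd c ` (U \<inter> fst c))" by (rule image_open[OF c U])
  show "smooth_on (snd c ` (U \<inter> fst c)) (\<lambda>x. metric_rep A g c x u w)" for u w
    unfolding metric_rep_def using g c by (simp add: riemannian_metric_on_def)
  fix x assume "x \<in> snd c ` (U \<inter> fst c)"
  then obtain p where p: "x = snd c p" "p \<in> U" "p \<in> fst c" by blast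
  have rep: "metric_rep A g c x u w = g p (tvec_of A c p u) (tvec_of A c p w)" for u w
    by (simp add: metric_rep_def p cinv_chart[OF c])
  note T = tvec_of_tangent[OF c p(3)]
  have "g p (\<lambda>e. a *\<^sub>R tvec_of A c p u e + b *\<^sub>R tvec_of A c p v e) (tvec_of A c p w) =
      a * g p (tvec_of A c p u) (tvec_of A c p w) + b * g p (tvec_of A c p v) (tvec_of A c p w)" for a b u v w
    using g p(2) T by (simp add: riemannian_metric_on_def)
  then have lin: "metric_rep A g c x (a *\<^sub>R u + b *\<^sub>R v) w = a * metric_rep A g c x u w + b * metric_rep A g c x v w" for a b u v w
    by (simp add: rep tvec_of_lincomb[OF c p(3)])
  have sym: "metric_rep A g c x u w = metric_rep A g c x w u" for u w
    using g p(2) T by (simp add: rep riemannian_metric_on_def)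
  have 1: "linear (\<lambda>u. metric_rep A g c x u w)" for w
    using lin[of 1 _ 1] lin[of _ _ 0] by (intro linearI) simp_all
  have eq: "metric_rep A g c x w = (\<lambda>u. metric_rep A g c x u w)" for w using sym by blast
  have "linear (metric_rep A g c x w)" for w by (subst eq) (rule 1)
  moreover have "metric_rep A g c x v v > 0" if "v \<noteq> 0" for v
    using g p(2) T[of v] that tvec_of_eq_tzero_iff[OF c p(3), of v] by (simp add: rep riemannian_metric_on_def)
  ultimately show "inner_form (metric_rep A g c x)"
    using 1 sym by (simp add: inner_form_def bilinear_def)
qed

lemma metric_rep_transition:
  assumes "c \<in> A" "d \<in> A" "p \<in> fst c" "p \<in> fst d"
  shows "metric_rep A g c (snd c p) u w = metric_rep A g d (snd d p) (dtransition c d p u) (dtransition c d p w)"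
  using assms by (simp add: metric_rep_def cinv_chart tvec_of_dtransition)

text \<open>By uniqueness it suffices that the symbols pulled back from \<open>d\<close>, corrected
  by the second derivative of the transition map, are symmetric and compatible with the metric in
  \<open>c\<close>. Symmetry of the correction is symmetry of second derivatives.\<close>

lemma christoffel_transition:
  assumes g: "riemannian_metric_on A U g" and U: "openin M U" and c: "c \<in> A" and d: "d \<in> A"
    and p: "p \<in> U" "p \<in> fst c" "p \<in> fst d"
  shows "dtransition c d p (christoffel (metric_rep A g c) (snd c p) u w) =
    christoffel (metric_rep A g d) (snd d p) (dtransition c d p u) (dtransition c d p w) + d2transition c d p u w"
proof -
  interpret C: riemann_chart "snd c ` (U \<inter> fst c)" "metric_rep A g c"
    by (rule riemann_chart_metric_rep[OF g U c])
  interpret D: riemann_chart "snd d ` (U \<inter> fst d)" "metric_rep A g d"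
    by (rule riemann_chart_metric_rep[OF g U d])
  let ?\<phi> = "transition c d" and ?D = "dtransition c d p" and ?E = "dtransition d c p"
  let ?gc = "metric_rep A g c" and ?gd = "metric_rep A g d" and ?x = "snd c p" and ?y = "snd d p"
  let ?\<Gamma> = "christoffel ?gd ?y"
  have x: "?x \<in> snd c ` (U \<inter> fst c)" and y: "?y \<in> snd d ` (U \<inter> fst d)" using p by auto
  let ?T = "snd c ` ((U \<inter> fst d) \<inter> fst c)"
  have T: "open ?T" "?x \<in> ?T" using image_open[OF c, of "U \<inter> fst d"] U chart_open[OF d] p by auto
  have sub: "?T \<subseteq> snd c ` (fst c \<inter> fst d)" by auto
  note sm = smooth_on_subset[OF transition_smooth[OF c d] T(1) sub]
  have \<phi>T: "?\<phi> ` ?T \<subseteq> snd d ` (U \<inter> fst d)" using c by (auto simp: transition_apply)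
  have \<phi>x: "?\<phi> ?x = ?y" using c p by (simp add: transition_apply)
  have Dlin: "linear ?D" and Elin: "linear ?E" using dtransition_linear c d p by auto
  have DE: "?D (?E v) = v" "?E (?D v) = v" for v using dtransition_inverse c d p by auto
  define B where "B u w = ?E (?\<Gamma> (?D u) (?D w) + d2transition c d p u w)" for u w
  have "B u w = christoffel ?gc ?x u w" for u w
  proof (rule C.christoffel_unique[OF x])
    show "B u w = B w u" for u w
      unfolding B_def d2transition_def
      using D.christoffel_sym[OF y, of "?D u" "?D w"] smooth_on_schwarz[OF sm T(2), of w u] by simp
    fix u v w
    have DB: "?D (B u v) = ?\<Gamma> (?D u) (?D v) + d2transition c d p u v" for v
      by (simp add: B_def DE)
    \<comment> \<open>The transformation law of the metric is differentiated; the two terms with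
      second derivatives of the transition map are those that the correction in \<open>B\<close>
      accounts for.\<close>
    have "((\<lambda>x. ?gd (?\<phi> x) (fd ?\<phi> x v) (fd ?\<phi> x w)) has_derivative
        (\<lambda>u. fd (\<lambda>y. ?gd y (fd ?\<phi> ?x v) (fd ?\<phi> ?x w)) (?\<phi> ?x) (fd ?\<phi> ?x u)
          + ?gd (?\<phi> ?x) (fd ?\<phi> ?x v) (fd (\<lambda>x. fd ?\<phi> x w) ?x u)
          + ?gd (?\<phi> ?x) (fd (\<lambda>x. fd ?\<phi> x v) ?x u) (fd ?\<phi> ?x w))) (at ?x)"
      by (rule D.has_derivative_metric[OF T \<phi>T smooth_on_has_derivative[OF sm T(2)]
          smooth_on_has_derivative[OF smooth_on_fd[OF sm] T(2)] smooth_on_has_derivative[OF smooth_on_fd[OF sm] T(2)]])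
    then have "((\<lambda>x. ?gc x v w) has_derivative
        (\<lambda>u. fd (\<lambda>y. ?gd y (fd ?\<phi> ?x v) (fd ?\<phi> ?x w)) (?\<phi> ?x) (fd ?\<phi> ?x u)
          + ?gd (?\<phi> ?x) (fd ?\<phi> ?x v) (fd (\<lambda>x. fd ?\<phi> x w) ?x u)
          + ?gd (?\<phi> ?x) (fd (\<lambda>x. fd ?\<phi> x v) ?x u) (fd ?\<phi> ?x w))) (at ?x)"
    proof (rule has_derivative_transform_within_open[OF _ T])
      fix x assume "x \<in> ?T"
      then obtain q where q: "x = snd c q" "q \<in> fst c" "q \<in> fst d" by blast
      show "?gd (?\<phi> x) (fd ?\<phi> x v) (fd ?\<phi> x w) = ?gc x v w"
        using metric_rep_transition[OF c d q(2,3), of g v w] q c by (simp add: transition_apply dtransition_def)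
    qed
    then have "fd (\<lambda>x. ?gc x v w) ?x u = fd (\<lambda>y. ?gd y (?D v) (?D w)) ?y (?D u)
        + ?gd ?y (?D v) (d2transition c d p u w) + ?gd ?y (d2transition c d p u v) (?D w)"
      by (simp add: fd_eq \<phi>x dtransition_def d2transition_def)
    also have "\<dots> = ?gd ?y (?D (B u v)) (?D w) + ?gd ?y (?D v) (?D (B u w))"
      unfolding D.christoffel_compat[OF y] DB by (simp add: inner_form_simps[OF D.form[OF y]])
    also have "\<dots> = ?gc ?x (B u v) w + ?gc ?x v (B u w)"
      by (simp only: metric_rep_transition[OF c d p(2,3)])
    finally show "fd (\<lambda>x. ?gc x v w) ?x u = ?gc ?x (B u v) w + ?gc ?x v (B u w)" .
  qed
  from this[of u w] show ?thesis by (metis B_def DE(1))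
qed

theorem levi_civita_exists:
  assumes g: "riemannian_metric_on A U g" and U: "openin M U"
  shows "levi_civita_on A U g (\<lambda>c. christoffel (metric_rep A g c))"
  unfolding levi_civita_on_def affine_connection_def torsion_free_def
proof (intro conjI ballI allI)
  fix c assume c: "c \<in> A"
  interpret C: riemann_chart "snd c ` (U \<inter> fst c)" "metric_rep A g c"
    by (rule riemann_chart_metric_rep[OF g U c])
  show "smooth_on (snd c ` (U \<inter> fst c)) (\<lambda>x. christoffel (metric_rep A g c) x u w)" for u w
    by (rule C.smooth_christoffel)
  {
    fix p assume p: "p \<in> U \<inter> fst c"
    then have x: "snd c p \<in> snd c ` (U \<inter> fst c)" by blast
    show "bilinear (christoffel (metric_rep A g c) (snd c p))" by (rule C.bilinear_christoffel[OF x])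
    show "christoffel (metric_rep A g c) (snd c p) u w = christoffel (metric_rep A g c) (snd c p) w u" for u w
      by (rule C.christoffel_sym[OF x])
    show "fd (\<lambda>x. g (cinv c x) (tvec_of A c (cinv c x) v) (tvec_of A c (cinv c x) w)) (snd c p) u =
        g p (tvec_of A c p (christoffel (metric_rep A g c) (snd c p) u v)) (tvec_of A c p w) +
        g p (tvec_of A c p v) (tvec_of A c p (christoffel (metric_rep A g c) (snd c p) u w))" for u v w
      using C.christoffel_compat[OF x, of v w u] p by (simp add: metric_rep_def cinv_chart[OF c])
  }
next
  fix c d p u w assume "c \<in> A" "d \<in> A" "p \<in> U \<inter> fst c \<inter> fst d"
  then show "dtransition c d p (christoffel (metric_rep A g c) (snd c p) u w) =
    christoffel (metric_rep A g d) (snd d p) (dtransition c d p u) (dtransition c d p w) + d2transition c d p u w"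
    using christoffel_transition[OF g U] by blast
qed

section \<open>Curves and covariant derivatives in charts\<close>

lemma curve_chart:
  assumes \<gamma>: "smooth_curve M A I \<gamma>" and c: "c \<in> A" and t: "t \<in> I" "\<gamma> t \<in> fst c"
  shows "((\<lambda>s. snd c (\<gamma> s)) has_vector_derivative velocity A \<gamma> t c) (at t)"
proof -
  have sm: "smooth_on {t \<in> I. \<gamma> t \<in> fst c} (\<lambda>s. snd c (\<gamma> s))" using \<gamma> c by (simp add: smooth_curve_def)
  have "(\<lambda>s. snd c (\<gamma> s)) differentiable (at t)"
    using smooth_on_has_derivative[OF sm, of t] t unfolding differentiable_def by blast
  then have "((\<lambda>s. snd c (\<gamma> s)) has_vector_derivative vector_derivative (\<lambda>s. snd c (\<gamma> s)) (at t)) (at t)"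
    by (simp add: vector_derivative_works)
  then show ?thesis using c t by (simp add: velocity_def)
qed

lemma curve_near:
  assumes \<gamma>: "smooth_curve M A I \<gamma>" and c: "c \<in> A"
  shows "open {t \<in> I. \<gamma> t \<in> fst c}"
  using \<gamma> c smooth_on_open by (auto simp: smooth_curve_def)

lemma velocity_smooth:
  assumes \<gamma>: "smooth_curve M A I \<gamma>" and c: "c \<in> A"
  shows "smooth_on {t \<in> I. \<gamma> t \<in> fst c} (\<lambda>t. velocity A \<gamma> t c)"
proof (rule smooth_on_cong)
  have sm: "smooth_on {t \<in> I. \<gamma> t \<in> fst c} (\<lambda>s. snd c (\<gamma> s))" using \<gamma> c by (simp add: smooth_curve_def)
  show "smooth_on {t \<in> I. \<gamma> t \<in> fst c} (\<lambda>t. fd (\<lambda>s. snd c (\<gamma> s)) t 1)" by (rule smooth_on_fd[OF sm])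
  show "fd (\<lambda>s. snd c (\<gamma> s)) t 1 = velocity A \<gamma> t c" if "t \<in> {t \<in> I. \<gamma> t \<in> fst c}" for t
    using curve_chart[OF \<gamma> c, of t] that by (simp add: has_vector_derivative_def fd_eq)
qed

lemma velocity_tangent:
  assumes \<gamma>: "smooth_curve M A I \<gamma>" and t: "t \<in> I"
  shows "velocity A \<gamma> t \<in> tangent_space A (\<gamma> t)"
  unfolding tangent_space_def
proof (intro CollectI conjI allI ballI impI)
  show "velocity A \<gamma> t c = 0" if "c \<notin> A \<or> \<gamma> t \<notin> fst c" for c
    using that by (auto simp: velocity_def)
  fix c d assume c: "c \<in> A" and d: "d \<in> A" and p: "\<gamma> t \<in> fst c \<inter> fst d"
  have "((\<lambda>s. transition c d (snd c (\<gamma> s))) has_derivative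
      (\<lambda>h. dtransition c d (\<gamma> t) (h *\<^sub>R velocity A \<gamma> t c))) (at t)"
    by (rule has_derivative_compose[OF curve_chart[OF \<gamma> c t, unfolded has_vector_derivative_def] transition_has_derivative])
      (use c d p in auto)
  then have "((\<lambda>s. snd d (\<gamma> s)) has_derivative (\<lambda>h. dtransition c d (\<gamma> t) (h *\<^sub>R velocity A \<gamma> t c))) (at t)"
    by (rule has_derivative_transform_within_open[OF _ curve_near[OF \<gamma> c]])
      (use t p c in \<open>auto simp: transition_apply\<close>)
  moreover have "((\<lambda>s. snd d (\<gamma> s)) has_derivative (\<lambda>h. h *\<^sub>R velocity A \<gamma> t d)) (at t)"
    using curve_chart[OF \<gamma> d t] p by (simp add: has_vector_derivative_def)
  ultimately have "(\<lambda>h. dtransition c d (\<gamma> t) (h *\<^sub>R velocity A \<gamma> t c)) = (\<lambda>h. h *\<^sub>R velocity A \<gamma> t d)"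
    by (rule has_derivative_unique)
  from fun_cong[OF this, of 1] show "velocity A \<gamma> t d = dtransition c d (\<gamma> t) (velocity A \<gamma> t c)" by simp
qed

text \<open>Differentiating \<open>W s d\<close> as the image of \<open>W s c\<close> produces a
  second derivative of the transition map, which the transformation law of the symbols cancels. The
  vanishing of a covariant derivative can thus be checked in one chart.\<close>

lemma cov_deriv_along_transition:
  assumes \<Gamma>: "affine_connection A U \<Gamma>" and \<gamma>: "smooth_curve M A I \<gamma>" and W: "smooth_field_along A I \<gamma> W"
    and t: "t \<in> I" "\<gamma> t \<in> U" and c: "c \<in> A" "\<gamma> t \<in> fst c" and d: "d \<in> A" "\<gamma> t \<in> fst d"
  shows "cov_deriv_along A \<Gamma> \<gamma> W t d = dtransition c d (\<gamma> t) (cov_deriv_along A \<Gamma> \<gamma> W t c)"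
proof -
  let ?\<phi> = "transition c d" and ?p = "\<gamma> t" and ?x = "\<lambda>s. snd c (\<gamma> s)"
  let ?v = "velocity A \<gamma> t c" and ?T = "{s \<in> I. \<gamma> s \<in> fst c} \<inter> {s \<in> I. \<gamma> s \<in> fst d}"
  have T: "open ?T" "t \<in> ?T"
    using open_Int[OF curve_near[OF \<gamma> c(1)] curve_near[OF \<gamma> d(1)]] t c d by auto
  have W': "((\<lambda>s. W s c) has_vector_derivative vector_derivative (\<lambda>s. W s c) (at t)) (at t)" if "c \<in> A" "\<gamma> t \<in> fst c" for c
  proof -
    have "smooth_on {t \<in> I. \<gamma> t \<in> fst c} (\<lambda>t. W t c)" using W that by (simp add: smooth_field_along_def)
    then have "(\<lambda>s. W s c) differentiable (at t)"
      using smooth_on_has_derivative[of _ "\<lambda>s. W s c" t] t that unfolding differentiable_def by blast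
    then show ?thesis by (simp add: vector_derivative_works)
  qed
  let ?w = "W t c" and ?w' = "vector_derivative (\<lambda>s. W s c) (at t)"
  have xT: "?x s \<in> snd c ` (fst c \<inter> fst d)" if "s \<in> ?T" for s using that by blast
  note sm = transition_smooth[OF c(1) d(1)]
  have "((\<lambda>s. fd ?\<phi> (?x s) (W s c)) has_derivative
      (\<lambda>h. fd (\<lambda>y. fd ?\<phi> y ?w) (?x t) (h *\<^sub>R ?v) + fd ?\<phi> (?x t) (h *\<^sub>R ?w'))) (at t)"
  proof (rule has_derivative_apply_linear[where l = "\<lambda>s v. fd ?\<phi> (?x s) v", OF _ T])
    show "((\<lambda>s. fd ?\<phi> (?x s) v) has_derivative (\<lambda>h. fd (\<lambda>y. fd ?\<phi> y v) (?x t) (h *\<^sub>R ?v))) (at t)" for v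
      by (rule has_derivative_compose[OF curve_chart[OF \<gamma> c(1) t(1) c(2), unfolded has_vector_derivative_def]
          smooth_on_has_derivative[OF smooth_on_fd[OF sm] xT[OF T(2)]]])
    show "linear (fd ?\<phi> (?x s))" if "s \<in> ?T" for s by (rule smooth_on_linear_fd[OF sm xT[OF that]])
    show "((\<lambda>s. W s c) has_derivative (\<lambda>h. h *\<^sub>R ?w')) (at t)"
      using W'[OF c] by (simp add: has_vector_derivative_def)
  qed
  then have "((\<lambda>s. W s d) has_derivative
      (\<lambda>h. fd (\<lambda>y. fd ?\<phi> y ?w) (?x t) (h *\<^sub>R ?v) + fd ?\<phi> (?x t) (h *\<^sub>R ?w'))) (at t)"
  proof (rule has_derivative_transform_within_open[OF _ T])
    fix s assume "s \<in> ?T"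
    then have "W s \<in> tangent_space A (\<gamma> s)" "\<gamma> s \<in> fst c" "\<gamma> s \<in> fst d"
      using W by (auto simp: smooth_field_along_def)
    from tangent_component[OF this(1) c(1) d(1) this(2,3)]
    show "fd ?\<phi> (?x s) (W s c) = W s d"
      unfolding dtransition_def by (rule sym)
  qed
  moreover have "((\<lambda>s. W s d) has_derivative (\<lambda>h. h *\<^sub>R vector_derivative (\<lambda>s. W s d) (at t))) (at t)"
    using W'[OF d] by (simp add: has_vector_derivative_def)
  ultimately have "(\<lambda>h. fd (\<lambda>y. fd ?\<phi> y ?w) (?x t) (h *\<^sub>R ?v) + fd ?\<phi> (?x t) (h *\<^sub>R ?w'))
      = (\<lambda>h. h *\<^sub>R vector_derivative (\<lambda>s. W s d) (at t))"
    by (rule has_derivative_unique)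
  from fun_cong[OF this, of 1]
  have der: "vector_derivative (\<lambda>s. W s d) (at t) = d2transition c d ?p ?v ?w + dtransition c d ?p ?w'"
    by (simp add: d2transition_def dtransition_def)
  have tr: "velocity A \<gamma> t d = dtransition c d ?p ?v" "W t d = dtransition c d ?p ?w"
    using tangent_component[OF velocity_tangent[OF \<gamma> t(1)] c(1) d(1) c(2) d(2)]
      tangent_component[of "W t" ?p, OF _ c(1) d(1) c(2) d(2)] W t(1) unfolding smooth_field_along_def by blast+
  have "dtransition c d ?p (\<Gamma> c (?x t) ?v ?w) =
      \<Gamma> d (snd d ?p) (dtransition c d ?p ?v) (dtransition c d ?p ?w) + d2transition c d ?p ?v ?w"
    using \<Gamma> t c d by (simp add: affine_connection_def)
  then show ?thesis
    using t c d by (simp add: cov_deriv_along_def der tr linear_add[OF dtransition_linear])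
qed

lemma chart_curve:
  assumes c: "c \<in> A" and I: "open I" "is_interval I" and x: "smooth_on I x" "x ` I \<subseteq> cod c"
  defines "\<gamma> \<equiv> \<lambda>t. cinv c (x t)"
  shows "smooth_curve M A I \<gamma>" "t \<in> I \<Longrightarrow> \<gamma> t \<in> fst c" "t \<in> I \<Longrightarrow> snd c (\<gamma> t) = x t"
    "t \<in> I \<Longrightarrow> velocity A \<gamma> t c = fd x t 1"
proof -
  show \<gamma>c: "\<gamma> t \<in> fst c" and x\<gamma>: "snd c (\<gamma> t) = x t" if "t \<in> I" for t
    using x(2) that by (auto simp: \<gamma>_def chart_cinv cinv_in)
  have op: "open {t \<in> I. \<gamma> t \<in> U}" if "openin M U" for U
  proof -
    have "{t \<in> I. \<gamma> t \<in> U} = I \<inter> x -` (snd c ` (U \<inter> fst c))"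
      using image_chart_iff[OF c] x(2) by (auto simp: \<gamma>_def)
    then show ?thesis
      using continuous_open_preimage[OF smooth_on_continuous[OF x(1)] I(1) image_open[OF c that]] by simp
  qed
  have "continuous_map (top_of_set I) M \<gamma>"
    unfolding continuous_map
    using op \<gamma>c chart_subset[OF c] I(1) by (auto simp: openin_open_eq)
  moreover have "smooth_on {t \<in> I. \<gamma> t \<in> fst d} (\<lambda>t. snd d (\<gamma> t))" if d: "d \<in> A" for d
  proof (rule smooth_on_cong)
    show "smooth_on {t \<in> I. \<gamma> t \<in> fst d} (\<lambda>t. transition c d (x t))"
      by (rule smooth_on_compose[OF transition_smooth[OF c d] smooth_on_subset[OF x(1) op[OF chart_open[OF d]]]])
        (use \<gamma>c x\<gamma> in force)+
    show "transition c d (x t) = snd d (\<gamma> t)" if "t \<in> {t \<in> I. \<gamma> t \<in> fst d}" for t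
      by (simp add: transition_def \<gamma>_def)
  qed
  ultimately show \<gamma>: "smooth_curve M A I \<gamma>" using I by (simp add: smooth_curve_def)
  show "velocity A \<gamma> t c = fd x t 1" if t: "t \<in> I" for t
  proof -
    have "(x has_derivative (\<lambda>h. h *\<^sub>R velocity A \<gamma> t c)) (at t)"
      by (rule has_derivative_transform_within_open[OF curve_chart[OF \<gamma> c t \<gamma>c[OF t], unfolded has_vector_derivative_def] I(1) t])
        (rule x\<gamma>)
    then show ?thesis by (simp add: fd_eq)
  qed
qed

lemma smooth_tvec_of_along:
  assumes c: "c \<in> A" and S: "smooth_on S x" "x ` S \<subseteq> cod c" and w: "smooth_on S w" and d: "d \<in> A"
    and op: "open {t \<in> S. cinv c (x t) \<in> fst d}"
  shows "smooth_on {t \<in> S. cinv c (x t) \<in> fst d} (\<lambda>t. tvec_of A c (cinv c (x t)) (w t) d)"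
proof (rule smooth_on_cong)
  let ?S = "{t \<in> S. cinv c (x t) \<in> fst d}"
  have sub: "x ` ?S \<subseteq> snd c ` (fst c \<inter> fst d)"
    using S(2) image_chart_iff[OF c, of _ "fst d"] by (auto simp: Int_commute)
  show "smooth_on ?S (\<lambda>t. fd (transition c d) (x t) (w t))"
    by (rule smooth_on_fd_dir[OF transition_smooth[OF c d] smooth_on_subset[OF S(1) op] smooth_on_subset[OF w op] sub]) auto
  show "fd (transition c d) (x t) (w t) = tvec_of A c (cinv c (x t)) (w t) d" if "t \<in> ?S" for t
    using that S(2) d by (auto simp: tvec_of_def dtransition_def chart_cinv)
qed

end

section \<open>Geodesics\<close>

text \<open>Boundedness on the unit sphere bundle over a compact ball, extended by homogeneity of
  degree two.\<close>

lemma (in finsler_chart) L_upper_bound: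
  assumes x0: "x0 \<in> U"
  obtains C r where "r > 0" "C \<ge> 0" "cball x0 r \<subseteq> U" "\<And>x v. x \<in> cball x0 r \<Longrightarrow> L (x, v) \<le> C * (norm v)\<^sup>2"
proof -
  obtain r where r: "r > 0" "cball x0 r \<subseteq> U"
    using open_contains_cball open_U x0 by metis
  have "compact (cball x0 r \<times> sphere (0::'e) 1)" by (intro compact_Times compact_cball compact_sphere)
  moreover have "continuous_on (cball x0 r \<times> sphere (0::'e) 1) L"
    by (rule continuous_on_subset[OF cont_L]) (use r in auto)
  ultimately have "bounded (L ` (cball x0 r \<times> sphere 0 1))"
    using compact_continuous_image compact_imp_bounded by blast
  then obtain C where C: "\<forall>y\<in>L ` (cball x0 r \<times> sphere 0 1). norm y \<le> C" unfolding bounded_iff by blast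
  have "L (x, v) \<le> \<bar>C\<bar> * (norm v)\<^sup>2" if x: "x \<in> cball x0 r" for x v
  proof (cases "v = 0")
    case True
    then show ?thesis using L_zero[of x] x r by auto
  next
    case False
    have xU: "x \<in> U" using x r by blast
    define u where "u = (1 / norm v) *\<^sub>R v"
    have "norm u = 1" using False by (simp add: u_def)
    then have "norm (L (x, u)) \<le> C" using C x by auto
    then have "L (x, u) \<le> \<bar>C\<bar>" by simp
    moreover have "L (x, v) = (norm v)\<^sup>2 * L (x, u)"
    proof -
      have "norm v *\<^sub>R u = v" using False by (simp add: u_def)
      then show ?thesis using hom_L[OF xU, of "norm v" u] by simp
    qed
    ultimately show ?thesis by (simp add: mult.commute[of _ "L (x, u)"] mult_right_mono)
  qed
  with r that[of r "\<bar>C\<bar>"] show thesis by simp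
qed

text \<open>Smoothness is assumed only off the zero section, but the quadratic bound on
  \<open>L\<close> suffices for one derivative there. Conservation of energy can then be formulated
  at instants of zero velocity, which the Euler-Lagrange equation alone does not exclude.\<close>

lemma (in finsler_chart) L_has_derivative_zero_section:
  assumes x0: "x0 \<in> U"
  shows "(L has_derivative (\<lambda>_. 0)) (at (x0, 0))"
  unfolding has_derivative_within_alt
proof (intro conjI allI impI bounded_linear_zero)
  fix e :: real assume e: "e > 0"
  obtain C r where C: "r > 0" "C \<ge> 0" "cball x0 r \<subseteq> U" "\<And>x v. x \<in> cball x0 r \<Longrightarrow> L (x, v) \<le> C * (norm v)\<^sup>2"
    using L_upper_bound[OF x0] by metis
  define d where "d = min r (e / (C + 1))"
  have d: "d > 0" using C e by (simp add: d_def)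
  have "norm (L z - L (x0, 0) - 0) \<le> e * norm (z - (x0, 0))" if z: "norm (z - (x0, 0)) < d" for z
  proof -
    obtain x v where zz: "z = (x, v)" by fastforce
    let ?n = "norm (z - (x0, 0))"
    have nx: "norm (x - x0) \<le> ?n" and nv: "norm v \<le> ?n"
      using norm_fst_le[of "x - x0" v] norm_snd_le[of v "x - x0"] zz by auto
    have x: "x \<in> cball x0 r" using nx z by (simp add: d_def dist_norm norm_minus_commute)
    have xU: "x \<in> U" using x C(3) by blast
    have nonneg: "0 \<le> L (x, v)" using pos_L[OF xU, of v] L_zero[OF xU] by (cases "v = 0") auto
    have "C * ?n \<le> e"
    proof -
      have "C * ?n \<le> (C + 1) * (e / (C + 1))"
        using z C(2) unfolding d_def by (intro mult_mono) auto
      then show ?thesis using C(2) by simp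
    qed
    have "L (x, v) \<le> C * (norm v)\<^sup>2" by (rule C(4)[OF x])
    also have "\<dots> \<le> C * ?n\<^sup>2" using nv C(2) by (intro mult_left_mono power_mono) auto
    also have "\<dots> = (C * ?n) * ?n" by (simp add: power2_eq_square)
    also have "\<dots> \<le> e * ?n" using \<open>C * ?n \<le> e\<close> by (rule mult_right_mono) simp
    finally show ?thesis using nonneg zz L_zero[OF x0] by simp
  qed
  then show "\<exists>d>0. \<forall>z\<in>UNIV. norm (z - (x0, 0)) < d \<longrightarrow> norm (L z - L (x0, 0) - 0) \<le> e * norm (z - (x0, 0))"
    using d by blast
qed

text \<open>The condition is put on \<open>F\<^sup>2\<close> in charts, so that the given Finsler
  metric and the norm of a Riemannian metric fall under the same results.\<close>

locale finsler_mfd = smooth_mfd M A for M :: "'a topology" and A :: "('a, 'e::euclidean_space) chart set" +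
  fixes F :: "'a \<Rightarrow> ('a, 'e) tvec \<Rightarrow> real"
  assumes charts: "c \<in> A \<Longrightarrow> finsler_chart (cod c) (\<lambda>z. (local_rep A F c z)\<^sup>2)"
begin

abbreviation "Lc c \<equiv> \<lambda>z. (local_rep A F c z)\<^sup>2"

lemma Lc_apply: "c \<in> A \<Longrightarrow> p \<in> fst c \<Longrightarrow> Lc c (snd c p, \<xi>) = (F p (tvec_of A c p \<xi>))\<^sup>2"
  by (simp add: local_rep_def cinv_chart)

lemma Lc_velocity:
  assumes "smooth_curve M A I \<gamma>" "t \<in> I" "c \<in> A" "\<gamma> t \<in> fst c"
  shows "Lc c (snd c (\<gamma> t), velocity A \<gamma> t c) = (F (\<gamma> t) (velocity A \<gamma> t))\<^sup>2"
  using Lc_apply[OF assms(3,4)] tvec_of_component[OF assms(3,4) velocity_tangent[OF assms(1,2)]] by simp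

lemma lift_has_derivative:
  assumes \<gamma>: "smooth_curve M A I \<gamma>" and t: "t \<in> I" "c \<in> A" "\<gamma> t \<in> fst c"
  shows "((\<lambda>s. (snd c (\<gamma> s), velocity A \<gamma> s c)) has_vector_derivative
    (velocity A \<gamma> t c, fd (\<lambda>s. velocity A \<gamma> s c) t 1)) (at t)"
    "((\<lambda>s. velocity A \<gamma> s c) has_vector_derivative fd (\<lambda>s. velocity A \<gamma> s c) t 1) (at t)"
proof -
  have T: "t \<in> {t \<in> I. \<gamma> t \<in> fst c}" using t by simp
  note sm = velocity_smooth[OF \<gamma> t(2)]
  have "fd (\<lambda>s. velocity A \<gamma> s c) t h = h *\<^sub>R fd (\<lambda>s. velocity A \<gamma> s c) t 1" for h
    using linear_scale[OF smooth_on_linear_fd[OF sm T], of h 1] by simp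
  then have "fd (\<lambda>s. velocity A \<gamma> s c) t = (\<lambda>h. h *\<^sub>R fd (\<lambda>s. velocity A \<gamma> s c) t 1)" by blast
  then show 2: "((\<lambda>s. velocity A \<gamma> s c) has_vector_derivative fd (\<lambda>s. velocity A \<gamma> s c) t 1) (at t)"
    using smooth_on_has_derivative[OF sm T] by (simp add: has_vector_derivative_def)
  show "((\<lambda>s. (snd c (\<gamma> s), velocity A \<gamma> s c)) has_vector_derivative
    (velocity A \<gamma> t c, fd (\<lambda>s. velocity A \<gamma> s c) t 1)) (at t)"
    using has_derivative_Pair[OF curve_chart[OF \<gamma> t(2,1,3), unfolded has_vector_derivative_def] 2[unfolded has_vector_derivative_def]]
    by (simp add: has_vector_derivative_def)
qed

text \<open>At nonzero velocity the Euler-Lagrange equation is the spray equation, which conserves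
  energy; at zero velocity the derivative of \<open>Lc c\<close> vanishes altogether.\<close>

lemma geodesic_energy_derivative:
  assumes g: "finsler_geodesic M A F I \<gamma>" and t: "t \<in> I"
  shows "((\<lambda>s. (F (\<gamma> s) (velocity A \<gamma> s))\<^sup>2) has_real_derivative 0) (at t)"
proof -
  have \<gamma>: "smooth_curve M A I \<gamma>" using g by (simp add: finsler_geodesic_def)
  have "\<gamma> t \<in> topspace M" using \<gamma> t unfolding smooth_curve_def continuous_map_def by auto
  then obtain c where c: "c \<in> A" "\<gamma> t \<in> fst c" using covered by blast
  interpret C: finsler_chart "cod c" "Lc c" by (rule charts[OF c(1)])
  let ?z = "\<lambda>s. (snd c (\<gamma> s), velocity A \<gamma> s c)"
  let ?v = "velocity A \<gamma> t c" and ?a = "fd (\<lambda>s. velocity A \<gamma> s c) t 1"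
  have z: "(?z has_vector_derivative (?v, ?a)) (at t)" using lift_has_derivative(1)[OF \<gamma> t c] .
  have "((\<lambda>s. Lc c (?z s)) has_real_derivative 0) (at t)"
  proof (cases "?v = 0")
    case True
    have "(Lc c has_derivative (\<lambda>_. 0)) (at (?z t))"
      using C.L_has_derivative_zero_section[of "snd c (\<gamma> t)"] c True by simp
    from has_derivative_compose[OF z[unfolded has_vector_derivative_def] this]
    show ?thesis by (simp add: has_field_derivative_def lambda_zero)
  next
    case False
    then have W: "?z t \<in> C.W" using c by auto
    have "\<forall>e. ((\<lambda>s. fd (Lc c) (?z s) (0, e)) has_real_derivative fd (Lc c) (?z t) (e, 0)) (at t)"
      using g c t by (simp add: finsler_geodesic_def Let_def)
    then have "?a = - 2 *\<^sub>R spray (Lc c) (?z t)"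
      using C.euler_lagrange_iff_spray[OF z refl W] by blast
    then show ?thesis using C.energy_derivative_spray[where z = ?z and t = t, OF _ refl W] z by simp
  qed
  then show ?thesis
  proof (rule DERIV_cong_ev[THEN iffD1, OF refl _ refl, rotated])
    have "\<forall>\<^sub>F s in nhds t. s \<in> {t \<in> I. \<gamma> t \<in> fst c}"
      using curve_near[OF \<gamma> c(1)] t c(2) by (intro eventually_nhds_in_open) auto
    then show "\<forall>\<^sub>F s in nhds t. Lc c (?z s) = (F (\<gamma> s) (velocity A \<gamma> s))\<^sup>2"
      by eventually_elim (use Lc_velocity[OF \<gamma> _ c(1)] in auto)
  qed
qed

text \<open>Conservation of energy spreads one zero of the velocity over the whole interval. The
  curve is then locally constant, hence constant on the connected interval, contrary to the
  definition of a geodesic.\<close>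

lemma geodesic_velocity_nonzero:
  assumes g: "finsler_geodesic M A F I \<gamma>" and t: "t \<in> I" "c \<in> A" "\<gamma> t \<in> fst c"
  shows "velocity A \<gamma> t c \<noteq> 0"
proof
  assume v0: "velocity A \<gamma> t c = 0"
  have \<gamma>: "smooth_curve M A I \<gamma>" using g by (simp add: finsler_geodesic_def)
  then have I: "open I" "convex I" "connected I"
    by (auto simp: smooth_curve_def is_interval_convex is_interval_connected)
  let ?E = "\<lambda>s. (F (\<gamma> s) (velocity A \<gamma> s))\<^sup>2"
  have "(?E has_real_derivative 0) (at s within I)" if "s \<in> I" for s
    using geodesic_energy_derivative[OF g that] by (rule has_field_derivative_at_within)
  then obtain k where k: "\<And>s. s \<in> I \<Longrightarrow> ?E s = k"
    using has_field_derivative_zero_constant[OF I(2), of ?E] by blast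
  have zero: "Lc d (x, 0) = 0" if "d \<in> A" "x \<in> cod d" for d x
    using finsler_chart.L_zero[OF charts] that by blast
  have "?E t = 0" using Lc_velocity[OF \<gamma> t(1,2,3)] v0 zero[OF t(2), of "snd c (\<gamma> t)"] t(3) by simp
  then have k0: "k = 0" using k t(1) by simp
  have vel: "velocity A \<gamma> s d = 0" if "s \<in> I" "d \<in> A" "\<gamma> s \<in> fst d" for s d
  proof (rule ccontr)
    assume "velocity A \<gamma> s d \<noteq> 0"
    then have "Lc d (snd d (\<gamma> s), velocity A \<gamma> s d) > 0"
      by (intro finsler_chart.pos_L[OF charts]) (use that in auto)
    then show False using Lc_velocity[OF \<gamma> that] k[OF that(1)] k0 by simp
  qed
  have "\<gamma> constant_on I"
  proof (rule locally_constant_imp_constant[OF I(3)])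
    fix s assume s: "s \<in> I"
    have "\<gamma> s \<in> topspace M" using \<gamma> s unfolding smooth_curve_def continuous_map_def by auto
    then obtain d where d: "d \<in> A" "\<gamma> s \<in> fst d" using covered by blast
    let ?T = "{t \<in> I. \<gamma> t \<in> fst d}"
    have "((\<lambda>s. snd d (\<gamma> s)) has_vector_derivative 0) (at r)" if "r \<in> ?T" for r
      using curve_chart[OF \<gamma> d(1), of r] vel[of r d] that d(1) by simp
    moreover obtain \<delta> where \<delta>: "\<delta> > 0" "ball s \<delta> \<subseteq> ?T"
      using curve_near[OF \<gamma> d(1)] s d(2) open_contains_ball by (metis (mono_tags, lifting) mem_Collect_eq)
    ultimately have "snd d (\<gamma> r) = snd d (\<gamma> s)" if "r \<in> ball s \<delta>" for r
      by (intro has_vector_derivative_zero_imp_eq[of "ball s \<delta>" "\<lambda>s. snd d (\<gamma> s)" r s])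
        (use that \<delta> in \<open>simp_all add: subset_iff\<close>)
    then have "\<gamma> r = \<gamma> s" if "r \<in> ball s \<delta>" for r
      using inj_onD[OF chart_inj[OF d(1)], of "\<gamma> r" "\<gamma> s"] subsetD[OF \<delta>(2) that] that d(2) by simp
    moreover have "openin (top_of_set I) (ball s \<delta>)"
      unfolding openin_open_eq[OF I(1)] using \<delta>(2) by (intro conjI open_ball) blast
    moreover have "s \<in> ball s \<delta>" using \<delta>(1) by simp
    ultimately show "\<exists>T. openin (top_of_set I) T \<and> s \<in> T \<and> (\<forall>x\<in>T. \<gamma> x = \<gamma> s)" by blast
  qed
  then show False using g by (simp add: finsler_geodesic_def)
qed

text \<open>A metric enters this description only through its sprays, so equality of sprays yields
  affine equivalence. The velocity is recorded as nonzero because \<open>spray\<close> is meaningful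
  only there.\<close>

theorem finsler_geodesic_iff:
  "finsler_geodesic M A F I \<gamma> \<longleftrightarrow> smooth_curve M A I \<gamma> \<and> \<not> \<gamma> constant_on I \<and>
    (\<forall>c\<in>A. \<forall>t\<in>I. \<gamma> t \<in> fst c \<longrightarrow> velocity A \<gamma> t c \<noteq> 0 \<and>
      ((\<lambda>s. velocity A \<gamma> s c) has_vector_derivative - 2 *\<^sub>R spray (Lc c) (snd c (\<gamma> t), velocity A \<gamma> t c)) (at t))"
    (is "?G \<longleftrightarrow> ?S")
proof
  assume g: ?G
  then have \<gamma>: "smooth_curve M A I \<gamma>" "\<not> \<gamma> constant_on I" by (auto simp: finsler_geodesic_def)
  have "((\<lambda>s. velocity A \<gamma> s c) has_vector_derivative - 2 *\<^sub>R spray (Lc c) (snd c (\<gamma> t), velocity A \<gamma> t c)) (at t)"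
    if t: "t \<in> I" "c \<in> A" "\<gamma> t \<in> fst c" for t c
  proof -
    interpret C: finsler_chart "cod c" "Lc c" by (rule charts[OF t(2)])
    let ?z = "\<lambda>s. (snd c (\<gamma> s), velocity A \<gamma> s c)"
    have "\<forall>e. ((\<lambda>s. fd (Lc c) (?z s) (0, e)) has_real_derivative fd (Lc c) (?z t) (e, 0)) (at t)"
      using g t by (simp add: finsler_geodesic_def Let_def)
    moreover have "?z t \<in> C.W" using geodesic_velocity_nonzero[OF g t] t by auto
    ultimately have "fd (\<lambda>s. velocity A \<gamma> s c) t 1 = - 2 *\<^sub>R spray (Lc c) (?z t)"
      using C.euler_lagrange_iff_spray[OF lift_has_derivative(1)[OF \<gamma>(1) t] refl] by blast
    then show ?thesis using lift_has_derivative(2)[OF \<gamma>(1) t] by simp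
  qed
  then show ?S using \<gamma> geodesic_velocity_nonzero[OF g] by blast
next
  assume S: ?S
  then have \<gamma>: "smooth_curve M A I \<gamma>" by blast
  have "((\<lambda>s. fd (Lc c) (snd c (\<gamma> s), velocity A \<gamma> s c) (0, e)) has_real_derivative
      fd (Lc c) (snd c (\<gamma> t), velocity A \<gamma> t c) (e, 0)) (at t)"
    if t: "t \<in> I" "c \<in> A" "\<gamma> t \<in> fst c" for t c e
  proof -
    interpret C: finsler_chart "cod c" "Lc c" by (rule charts[OF t(2)])
    let ?z = "\<lambda>s. (snd c (\<gamma> s), velocity A \<gamma> s c)"
    have v: "velocity A \<gamma> t c \<noteq> 0"
      and a: "((\<lambda>s. velocity A \<gamma> s c) has_vector_derivative - 2 *\<^sub>R spray (Lc c) (?z t)) (at t)"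
      using S t by blast+
    have "?z t \<in> C.W" using v t by auto
    moreover have "fd (\<lambda>s. velocity A \<gamma> s c) t 1 = - 2 *\<^sub>R spray (Lc c) (?z t)"
      using a by (simp add: has_vector_derivative_def fd_eq)
    ultimately show ?thesis
      using C.euler_lagrange_iff_spray[OF lift_has_derivative(1)[OF \<gamma> t] refl] by blast
  qed
  then show ?G using S by (simp add: finsler_geodesic_def Let_def)
qed

end

section \<open>Linearly parallel fields along geodesics\<close>

text \<open>The geodesic and the parallel field solve one autonomous system on
  \<open>W \<times> UNIV\<close>. The interval is shortened until \<open>v t \<bullet> v0\<close>
  stays positive, so that \<open>x t \<bullet> v0\<close> increases strictly and can serve as
  parameter for an extension of the velocity.\<close>

lemma (in finsler_chart) parallel_solution:
  assumes x0: "x0 \<in> U" and v0: "v0 \<noteq> 0"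
  obtains \<delta> x v w where "\<delta> > 0" "smooth_on {-\<delta><..<\<delta>} x" "smooth_on {-\<delta><..<\<delta>} v" "smooth_on {-\<delta><..<\<delta>} w"
    "x 0 = x0" "v 0 = v0" "w 0 = w0"
    "\<And>t. t \<in> {-\<delta><..<\<delta>} \<Longrightarrow> x t \<in> U \<and> v t \<noteq> 0 \<and> 0 < v t \<bullet> v0"
    "\<And>t. t \<in> {-\<delta><..<\<delta>} \<Longrightarrow> (x has_vector_derivative v t) (at t)"
    "\<And>t. t \<in> {-\<delta><..<\<delta>} \<Longrightarrow> (v has_vector_derivative - 2 *\<^sub>R spray L (x t, v t)) (at t)"
    "\<And>t. t \<in> {-\<delta><..<\<delta>} \<Longrightarrow> (w has_vector_derivative - ncon L (x t, v t) (w t)) (at t)"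
proof -
  let ?S = "W \<times> (UNIV :: 'e set)"
  define f :: "('e \<times> 'e) \<times> 'e \<Rightarrow> ('e \<times> 'e) \<times> 'e"
    where "f z = ((snd (fst z), - 2 *\<^sub>R spray L (fst z)), - ncon L (fst z) (snd z))" for z
  have id: "smooth_on ?S (\<lambda>z. z)" by (rule smooth_on_ident) (intro open_Times[OF open_W] open_UNIV)
  note f1 = smooth_on_fst[OF id] and f2 = smooth_on_snd[OF id]
  have sub: "fst ` ?S \<subseteq> W" by auto
  have sf: "smooth_on ?S f"
    unfolding f_def
  proof (intro smooth_on_Pair smooth_on_minus)
    show "smooth_on ?S (\<lambda>z. snd (fst z))" by (rule smooth_on_snd[OF f1])
    show "smooth_on ?S (\<lambda>z. - 2 *\<^sub>R spray L (fst z))"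
      by (rule smooth_on_linear[OF bounded_linear_scaleR_right smooth_on_compose[OF smooth_spray f1 sub]])
    show "smooth_on ?S (\<lambda>z. ncon L (fst z) (snd z))"
    proof (rule smooth_on_apply_linear[OF smooth_on_compose[OF smooth_ncon f1 sub] _ f2])
      fix z assume "z \<in> ?S"
      then have "fst z \<in> W" by auto
      then show "linear (ncon L (fst z))" by (rule linear_ncon)
    qed
  qed
  have z0: "((x0, v0), w0) \<in> ?S" using x0 v0 by simp
  obtain \<delta>' u where u: "0 < \<delta>'" "u 0 = ((x0, v0), w0)" "smooth_on {-\<delta>'<..<\<delta>'} u"
    "\<And>t. t \<in> {-\<delta>'<..<\<delta>'} \<Longrightarrow> u t \<in> ?S"
    "\<And>t. t \<in> {-\<delta>'<..<\<delta>'} \<Longrightarrow> (u has_vector_derivative f (u t)) (at t)"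
    by (rule smooth_ode_solution[OF sf z0]) (rule that)
  define x where "x t = fst (fst (u t))" for t
  define v where "v t = snd (fst (u t))" for t
  define w where "w t = snd (u t)" for t
  have ut: "u t = ((x t, v t), w t)" for t by (simp add: x_def v_def w_def)
  have sm: "smooth_on {-\<delta>'<..<\<delta>'} x" "smooth_on {-\<delta>'<..<\<delta>'} v" "smooth_on {-\<delta>'<..<\<delta>'} w"
    unfolding x_def[abs_def] v_def[abs_def] w_def[abs_def]
    by (rule smooth_on_fst[OF smooth_on_fst[OF u(3)]] smooth_on_snd[OF smooth_on_fst[OF u(3)]] smooth_on_snd[OF u(3)])+
  have d: "(x has_vector_derivative v t) (at t)" "(v has_vector_derivative - 2 *\<^sub>R spray L (x t, v t)) (at t)"
    "(w has_vector_derivative - ncon L (x t, v t) (w t)) (at t)" if "t \<in> {-\<delta>'<..<\<delta>'}" for t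
  proof -
    have 1: "(u has_vector_derivative ((v t, - 2 *\<^sub>R spray L (x t, v t)), - ncon L (x t, v t) (w t))) (at t)"
      using u(5)[OF that] by (simp add: f_def ut)
    note 2 = bounded_linear.has_vector_derivative[OF bounded_linear_fst 1]
    show "(x has_vector_derivative v t) (at t)"
      using bounded_linear.has_vector_derivative[OF bounded_linear_fst 2] by (simp add: x_def[abs_def])
    show "(v has_vector_derivative - 2 *\<^sub>R spray L (x t, v t)) (at t)"
      using bounded_linear.has_vector_derivative[OF bounded_linear_snd 2] by (simp add: v_def[abs_def])
    show "(w has_vector_derivative - ncon L (x t, v t) (w t)) (at t)"
      using bounded_linear.has_vector_derivative[OF bounded_linear_snd 1] by (simp add: w_def[abs_def])
  qed
  have "isCont (\<lambda>t. v t \<bullet> v0) 0"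
    using smooth_on_isCont[OF sm(2), of 0] u(1) by (intro continuous_intros) auto
  moreover have "v 0 \<bullet> v0 > 0" using v0 by (simp add: v_def u(2))
  ultimately obtain d0 where d0: "d0 > 0" "\<And>t. dist t 0 < d0 \<Longrightarrow> dist (v t \<bullet> v0) (v 0 \<bullet> v0) < v 0 \<bullet> v0"
    unfolding continuous_at_eps_delta by blast
  define \<delta> where "\<delta> = min \<delta>' d0"
  have \<delta>: "\<delta> > 0" using u(1) d0(1) by (simp add: \<delta>_def)
  have sub: "{-\<delta><..<\<delta>} \<subseteq> {-\<delta>'<..<\<delta>'}" by (auto simp: \<delta>_def)
  show thesis
  proof (rule that[OF \<delta>, of x v w])
    show "x t \<in> U \<and> v t \<noteq> 0 \<and> 0 < v t \<bullet> v0" if "t \<in> {-\<delta><..<\<delta>}" for t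
    proof -
      have "dist t 0 < d0" using that by (auto simp: \<delta>_def)
      from d0(2)[OF this] have "0 < v t \<bullet> v0" by (simp add: dist_real_def)
      then show ?thesis using u(4)[of t] sub that by (auto simp: ut)
    qed
    have sub': "t \<in> {-\<delta>'<..<\<delta>'}" if "t \<in> {-\<delta><..<\<delta>}" for t using sub that by blast
    show "(x has_vector_derivative v t) (at t)" "(v has_vector_derivative - 2 *\<^sub>R spray L (x t, v t)) (at t)"
      "(w has_vector_derivative - ncon L (x t, v t) (w t)) (at t)" if "t \<in> {-\<delta><..<\<delta>}" for t
      by (rule d[OF sub'[OF that]])+
    show "smooth_on {-\<delta><..<\<delta>} x" "smooth_on {-\<delta><..<\<delta>} v" "smooth_on {-\<delta><..<\<delta>} w"
      by (rule sm[THEN smooth_on_subset, OF open_greaterThanLessThan sub])+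
  qed (simp_all add: x_def v_def w_def u(2))
qed

section \<open>Metrics, vector fields and embedded curves read in a chart\<close>

context smooth_mfd
begin

lemma riemannian_metric_onI:
  assumes U: "U \<subseteq> topspace M"
    and form: "\<And>c p. c \<in> A \<Longrightarrow> p \<in> U \<Longrightarrow> p \<in> fst c \<Longrightarrow> inner_form (metric_rep A g c (snd c p))"
    and smooth: "\<And>c u w. c \<in> A \<Longrightarrow> smooth_on (snd c ` (U \<inter> fst c)) (\<lambda>x. metric_rep A g c x u w)"
  shows "riemannian_metric_on A U g"
proof -
  have rep: "\<exists>c\<in>A. p \<in> fst c \<and> inner_form (metric_rep A g c (snd c p)) \<and> (\<forall>u\<in>tangent_space A p. \<forall>w\<in>tangent_space A p.
      g p u w = metric_rep A g c (snd c p) (u c) (w c))" if p: "p \<in> U" for p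
  proof -
    obtain c where c: "c \<in> A" "p \<in> fst c" using covered U p by blast
    have "g p u w = metric_rep A g c (snd c p) (u c) (w c)" if "u \<in> tangent_space A p" "w \<in> tangent_space A p" for u w
      using that by (simp add: metric_rep_def cinv_chart c tvec_of_component[OF c])
    then show ?thesis using form[OF c(1) p c(2)] c by blast
  qed
  have lin: "(\<lambda>c. a *\<^sub>R u c + b *\<^sub>R v c) \<in> tangent_space A p" if uv: "u \<in> tangent_space A p" "v \<in> tangent_space A p" and p: "p \<in> U" for p u v a b
  proof -
    obtain c where c: "c \<in> A" "p \<in> fst c" using covered U p by blast
    have "(\<lambda>e. a *\<^sub>R u e + b *\<^sub>R v e) = tvec_of A c p (a *\<^sub>R u c + b *\<^sub>R v c)"
      using tvec_of_lincomb[OF c, of a "u c" b "v c"] tvec_of_component[OF c] uv by simp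
    then show ?thesis using tvec_of_tangent[OF c] by simp
  qed
  show ?thesis
    unfolding riemannian_metric_on_def
  proof (intro conjI ballI allI impI)
    fix p u w assume p: "p \<in> U" and u: "u \<in> tangent_space A p" and w: "w \<in> tangent_space A p"
    obtain c where c: "c \<in> A" "p \<in> fst c" "inner_form (metric_rep A g c (snd c p))"
      "\<And>u w. u \<in> tangent_space A p \<Longrightarrow> w \<in> tangent_space A p \<Longrightarrow> g p u w = metric_rep A g c (snd c p) (u c) (w c)"
      using rep[OF p] by blast
    show "g p u w = g p w u" using c(3) by (simp add: c(4) u w inner_form_def)
    fix v a b assume v: "v \<in> tangent_space A p"
    show "g p (\<lambda>c. a *\<^sub>R u c + b *\<^sub>R w c) v = a * g p u v + b * g p w v"
      by (simp add: c(4) u v w lin[OF u w p] inner_form_simps[OF c(3)])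
  next
    fix p u assume p: "p \<in> U" and u: "u \<in> tangent_space A p" "u \<noteq> tzero"
    obtain c where c: "c \<in> A" "p \<in> fst c" "inner_form (metric_rep A g c (snd c p))"
      "\<And>u w. u \<in> tangent_space A p \<Longrightarrow> w \<in> tangent_space A p \<Longrightarrow> g p u w = metric_rep A g c (snd c p) (u c) (w c)"
      using rep[OF p] by blast
    show "0 < g p u u" using c(3) tangent_eq_tzero_iff[OF c(1,2) u(1)] u by (simp add: c(4) inner_form_def)
  next
    show "smooth_on (snd c ` (U \<inter> fst c)) (\<lambda>x. g (cinv c x) (tvec_of A c (cinv c x) \<xi>) (tvec_of A c (cinv c x) \<eta>))"
      if "c \<in> A" for c \<xi> \<eta>
      using smooth[OF that, of \<xi> \<eta>] by (simp add: metric_rep_def)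
  qed
qed

lemma fundamental_tensor_rep:
  fixes F :: "'a \<Rightarrow> ('a, 'e) tvec \<Rightarrow> real"
  assumes c: "c \<in> A" "p \<in> fst c" and \<nu>: "\<nu> \<noteq> 0"
    and sm: "smooth_on (cod c \<times> (UNIV - {0})) (\<lambda>z. (local_rep A F c z)\<^sup>2)"
  shows "fundamental_tensor F p (tvec_of A c p \<nu>) (tvec_of A c p u) (tvec_of A c p w) =
    vhess (\<lambda>z. (local_rep A F c z)\<^sup>2) (snd c p, \<nu>) u w"
proof -
  let ?L = "\<lambda>z. (local_rep A F c z)\<^sup>2" and ?W = "cod c \<times> (UNIV - {0 :: 'e})"
  let ?x = "snd c p"
  have x: "?x \<in> cod c" using c by blast
  have "(\<lambda>e. tvec_of A c p \<nu> e + s *\<^sub>R tvec_of A c p u e + t *\<^sub>R tvec_of A c p w e) = tvec_of A c p (\<nu> + s *\<^sub>R u + t *\<^sub>R w)" for s t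
  proof
    fix e
    show "tvec_of A c p \<nu> e + s *\<^sub>R tvec_of A c p u e + t *\<^sub>R tvec_of A c p w e = tvec_of A c p (\<nu> + s *\<^sub>R u + t *\<^sub>R w) e"
      using fun_cong[OF tvec_of_lincomb[OF c, of 1 \<nu> s u], of e]
        fun_cong[OF tvec_of_lincomb[OF c, of 1 "\<nu> + s *\<^sub>R u" t w], of e] by simp
  qed
  then have L: "(F p (\<lambda>e. tvec_of A c p \<nu> e + s *\<^sub>R tvec_of A c p u e + t *\<^sub>R tvec_of A c p w e))\<^sup>2 = ?L (?x, \<nu> + s *\<^sub>R u + t *\<^sub>R w)" for s t
    by (simp add: local_rep_def cinv_chart c)
  have line: "((\<lambda>t. h (?x, \<mu> + t *\<^sub>R w)) has_real_derivative fd h (?x, \<mu>) (0, w)) (at 0)"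
    if "smooth_on ?W h" "\<mu> \<noteq> 0" for h :: "'e \<times> 'e \<Rightarrow> real" and \<mu> w
  proof -
    have W: "(?x, \<mu> + 0 *\<^sub>R w) \<in> ?W" using that x by simp
    have "((\<lambda>t. (?x, \<mu> + t *\<^sub>R w)) has_derivative (\<lambda>k. (0, k *\<^sub>R w))) (at 0)"
      by (intro has_derivative_Pair) (auto intro!: derivative_eq_intros)
    from has_derivative_compose[OF this smooth_on_has_derivative[OF that(1) W]]
    have "((\<lambda>t. h (?x, \<mu> + t *\<^sub>R w)) has_derivative (\<lambda>k. fd h (?x, \<mu>) (0, k *\<^sub>R w))) (at 0)" by simp
    moreover have "fd h (?x, \<mu>) (0, k *\<^sub>R w) = fd h (?x, \<mu>) (0, w) * k" for k
      using linear_scale[OF smooth_on_linear_fd[OF that(1) W], of k "(0, w)"] by simp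
    ultimately show ?thesis by (simp add: has_field_derivative_def)
  qed
  have inner: "deriv (\<lambda>t. ?L (?x, \<nu> + s *\<^sub>R u + t *\<^sub>R w)) 0 = fd (?L) (?x, \<nu> + s *\<^sub>R u) (0, w)" if "\<nu> + s *\<^sub>R u \<noteq> 0" for s
    by (rule DERIV_imp_deriv[OF line[OF sm that]])
  \<comment> \<open>\<open>inner\<close> needs a nonzero base vector, which is guaranteed for
    \<open>s\<close> near zero; the outer derivative at zero sees nothing else.\<close>
  have "isCont (\<lambda>s. \<nu> + s *\<^sub>R u) 0" by (intro continuous_intros)
  then have "\<forall>\<^sub>F s in nhds 0. \<nu> + s *\<^sub>R u \<noteq> 0"
    using \<nu> tendsto_imp_eventually_ne[of "\<lambda>s. \<nu> + s *\<^sub>R u" \<nu> "nhds (0::real)" 0]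
      tendsto_at_iff_tendsto_nhds[of "\<lambda>s. \<nu> + s *\<^sub>R u" "0::real"] by (simp add: isCont_def)
  then have "\<forall>\<^sub>F s in nhds 0. deriv (\<lambda>t. ?L (?x, \<nu> + s *\<^sub>R u + t *\<^sub>R w)) 0 = fd (?L) (?x, \<nu> + s *\<^sub>R u) (0, w)"
    by eventually_elim (rule inner)
  then have "deriv (\<lambda>s. deriv (\<lambda>t. ?L (?x, \<nu> + s *\<^sub>R u + t *\<^sub>R w)) 0) 0 = deriv (\<lambda>s. fd (?L) (?x, \<nu> + s *\<^sub>R u) (0, w)) 0"
    by (rule deriv_cong_ev) simp
  also have "\<dots> = fd (\<lambda>z. fd (?L) z (0, w)) (?x, \<nu>) (0, u)"
    by (rule DERIV_imp_deriv[OF line[OF smooth_on_fd[OF sm] \<nu>]])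
  finally show ?thesis unfolding fundamental_tensor_def L vhess_def by simp
qed

lemma chart_vector_field:
  assumes c: "c \<in> A" and V: "open U'" "U' \<subseteq> cod c" and vf: "smooth_on U' vf"
  shows "smooth_vector_field_on A (cinv c ` U') (\<lambda>q. tvec_of A c q (vf (snd c q)))"
  unfolding smooth_vector_field_on_def
proof (intro conjI ballI)
  show "tvec_of A c q (vf (snd c q)) \<in> tangent_space A q" if q: "q \<in> cinv c ` U'" for q
  proof -
    obtain z where "z \<in> U'" "q = cinv c z" using q by blast
    then show ?thesis using tvec_of_tangent[OF c, of q] cinv_in[of z c] V(2) by blast
  qed
  fix d assume d: "d \<in> A"
  let ?S = "snd d ` (cinv c ` U' \<inter> fst d)"
  have S: "open ?S" by (rule image_open[OF d cinv_image_open[OF c V]])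
  have q: "\<exists>q. y = snd d q \<and> q \<in> fst c \<and> q \<in> fst d \<and> snd c q \<in> U'" if y: "y \<in> ?S" for y
  proof -
    obtain z where z: "z \<in> U'" "y = snd d (cinv c z)" "cinv c z \<in> fst d" using y by blast
    then show ?thesis using V(2) cinv_in[of z c] chart_cinv[of z c] by (intro exI[of _ "cinv c z"]) auto
  qed
  have tr: "smooth_on ?S (transition d c)"
    by (rule smooth_on_subset[OF transition_smooth[OF d c] S]) (use q in blast)
  show "smooth_on ?S (\<lambda>y. tvec_of A c (cinv d y) (vf (snd c (cinv d y))) d)"
  proof (rule smooth_on_cong)
    show "smooth_on ?S (\<lambda>y. fd (transition c d) (transition d c y) (vf (transition d c y)))"
    proof (rule smooth_on_fd_dir[OF transition_smooth[OF c d] tr smooth_on_compose[OF vf tr]])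
      have *: "transition d c y \<in> U' \<inter> snd c ` (fst c \<inter> fst d)" if y: "y \<in> ?S" for y
      proof -
        obtain q where "y = snd d q" "q \<in> fst c" "q \<in> fst d" "snd c q \<in> U'" using q[OF y] by blast
        then show ?thesis by (simp add: transition_apply[OF d])
      qed
      show "transition d c ` ?S \<subseteq> U'" "transition d c ` ?S \<subseteq> snd c ` (fst c \<inter> fst d)"
        by (intro image_subsetI; use * in simp)+
    qed
    fix y assume "y \<in> ?S"
    then obtain q where "y = snd d q" "q \<in> fst c" "q \<in> fst d" using q by blast
    then show "fd (transition c d) (transition d c y) (vf (transition d c y)) = tvec_of A c (cinv d y) (vf (snd c (cinv d y))) d"
      by (simp add: transition_apply[OF d] cinv_chart[OF d] tvec_of_apply[OF d] dtransition_def)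
  qed
qed

text \<open>The parameter is recovered from the chart image by \<tau>, which makes the inverse of
  the curve continuous.\<close>

lemma chart_curve_embedding:
  fixes x :: "real \<Rightarrow> 'e"
  assumes c: "c \<in> A" and I: "open I" "is_interval I" and x: "smooth_on I x" "x ` I \<subseteq> cod c"
    and \<tau>: "continuous_on (x ` I) \<tau>" "\<And>t. t \<in> I \<Longrightarrow> \<tau> (x t) = t"
  shows "embedding_map (top_of_set I) M (\<lambda>t. cinv c (x t))"
proof -
  let ?\<gamma> = "\<lambda>t. cinv c (x t)"
  note cc = chart_curve[OF c I x]
  have sub: "?\<gamma> ` I \<subseteq> fst c" using cc(2) by blast
  have c1: "continuous_map (top_of_set I) M ?\<gamma>" using cc(1) by (simp add: smooth_curve_def)
  have "continuous_map (subtopology M (fst c)) (top_of_set (cod c)) (snd c)"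
    by (rule homeomorphic_imp_continuous_map[OF chart_homeo[OF c]])
  then have "continuous_map (subtopology M (fst c)) euclidean (snd c)"
    by (simp only: continuous_map_in_subtopology)
  then have "continuous_map (subtopology M (?\<gamma> ` I)) euclidean (snd c)"
    by (rule continuous_map_from_subtopology_mono[OF _ sub])
  then have c2: "continuous_map (subtopology M (?\<gamma> ` I)) (top_of_set (x ` I)) (snd c)"
    using cc(3) by (auto simp: continuous_map_in_subtopology)
  have "continuous_map (top_of_set (x ` I)) (top_of_set I) \<tau>"
    using \<tau> by (auto simp: continuous_map_subtopology_eu)
  from continuous_map_compose[OF c2 this]
  have c3: "continuous_map (subtopology M (?\<gamma> ` I)) (top_of_set I) (\<tau> \<circ> snd c)" .
  have "homeomorphic_maps (top_of_set I) (subtopology M (?\<gamma> ` I)) ?\<gamma> (\<tau> \<circ> snd c)"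
    unfolding homeomorphic_maps_def
    using c1 c3 cc(3) \<tau>(2) by (auto simp: continuous_map_in_subtopology)
  then show ?thesis
    unfolding embedding_map_def homeomorphic_map_maps by auto
qed

end

section \<open>Osculating metrics, and geodesics and parallel fields from solutions in a
  chart\<close>

context finsler_mfd
begin

lemma osculating_metric_rep:
  assumes V: "smooth_vector_field_on A U V" "\<forall>p\<in>U. V p \<noteq> tzero" and d: "d \<in> A" and p: "p \<in> U" "p \<in> fst d"
  shows "metric_rep A (osculating_metric F V) d (snd d p) u w = vhess (Lc d) (snd d p, V p d) u w" "V p d \<noteq> 0"
proof -
  have Vp: "V p \<in> tangent_space A p" using V(1) p unfolding smooth_vector_field_on_def by blast
  then show "V p d \<noteq> 0" using tangent_eq_tzero_iff[OF d p(2)] V(2) p(1) by blast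
  from fundamental_tensor_rep[OF d p(2) this finsler_chart.smooth_L[OF charts[OF d]], of u w]
  show "metric_rep A (osculating_metric F V) d (snd d p) u w = vhess (Lc d) (snd d p, V p d) u w"
    by (simp add: metric_rep_def osculating_metric_def cinv_chart[OF d p(2)] tvec_of_component[OF d p(2) Vp])
qed

text \<open>In a chart the osculating metric is \<open>vhess\<close> evaluated on the graph of
  \<open>V\<close>, a composite of smooth maps that stays off the zero section.\<close>

lemma osculating_metric_riemannian:
  assumes U: "openin M U" and V: "smooth_vector_field_on A U V" "\<forall>p\<in>U. V p \<noteq> tzero"
  shows "riemannian_metric_on A U (osculating_metric F V)"
proof (rule riemannian_metric_onI)
  show "U \<subseteq> topspace M" by (rule openin_subset[OF U])
  note rep = osculating_metric_rep[OF V]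
  show "inner_form (metric_rep A (osculating_metric F V) d (snd d p))" if "d \<in> A" "p \<in> U" "p \<in> fst d" for d p
  proof -
    have "metric_rep A (osculating_metric F V) d (snd d p) = vhess (Lc d) (snd d p, V p d)"
      using rep(1)[OF that] by blast
    then show ?thesis using finsler_chart.inner_form_vhess[OF charts[OF that(1)]] rep(2)[OF that] that by auto
  qed
  show "smooth_on (snd d ` (U \<inter> fst d)) (\<lambda>x. metric_rep A (osculating_metric F V) d x u w)" if d: "d \<in> A" for d u w
  proof (rule smooth_on_cong)
    let ?S = "snd d ` (U \<inter> fst d)"
    have "smooth_on ?S (\<lambda>x. (x, V (cinv d x) d))"
      using V(1) d by (intro smooth_on_Pair smooth_on_ident image_open[OF d U]) (simp add: smooth_vector_field_on_def)
    then show "smooth_on ?S (\<lambda>x. vhess (Lc d) (x, V (cinv d x) d) u w)"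
      by (rule smooth_on_compose[OF finsler_chart.smooth_vhess[OF charts[OF d]]])
        (use rep(2)[OF d] in \<open>auto simp: cinv_chart[OF d]\<close>)
    show "vhess (Lc d) (x, V (cinv d x) d) u w = metric_rep A (osculating_metric F V) d x u w" if "x \<in> ?S" for x
      using that rep(1)[OF d] by (auto simp: cinv_chart[OF d])
  qed
qed

text \<open>The spray equation gives the Euler-Lagrange equation in the chart \<open>c\<close>; the
  definition asks for it in every chart that meets the curve, and
  \<open>euler_lagrange_transform\<close> carries it there along the transition maps.\<close>

lemma chart_geodesic:
  assumes c: "c \<in> A" and I: "open I" "is_interval I" "t0 \<in> I" and x: "smooth_on I x" "x ` I \<subseteq> cod c"
    and xv: "\<And>t. t \<in> I \<Longrightarrow> (x has_vector_derivative v t) (at t)" "\<And>t. t \<in> I \<Longrightarrow> v t \<noteq> 0"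
    and vs: "\<And>t. t \<in> I \<Longrightarrow> (v has_vector_derivative - 2 *\<^sub>R spray (Lc c) (x t, v t)) (at t)"
  shows "finsler_geodesic M A F I (\<lambda>t. cinv c (x t))"
proof -
  let ?\<gamma> = "\<lambda>t. cinv c (x t)"
  interpret C: finsler_chart "cod c" "Lc c" by (rule charts[OF c])
  note cc = chart_curve[OF c I(1,2) x]
  have vel: "velocity A ?\<gamma> t c = v t" if "t \<in> I" for t
    using cc(4)[OF that] fd_eq[OF xv(1)[OF that, unfolded has_vector_derivative_def]] by simp
  have nconst: "\<not> ?\<gamma> constant_on I"
  proof
    assume "?\<gamma> constant_on I"
    then obtain p where "\<And>t. t \<in> I \<Longrightarrow> ?\<gamma> t = p" by (auto simp: constant_on_def)
    then have "x t = snd c p" if "t \<in> I" for t using cc(3)[OF that] that by simp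
    then have "(x has_vector_derivative 0) (at t0)"
      using has_vector_derivative_transform_within_open[OF has_vector_derivative_const I(1,3), of "snd c p" x] by simp
    then show False using xv[OF I(3)] vector_derivative_unique_at by blast
  qed
  have "((\<lambda>s. fd (Lc d) (snd d (?\<gamma> s), velocity A ?\<gamma> s d) (0, e)) has_real_derivative
      fd (Lc d) (snd d (?\<gamma> t), velocity A ?\<gamma> t d) (e, 0)) (at t)" if d: "d \<in> A" and t: "t \<in> I" "?\<gamma> t \<in> fst d" for d t e
  proof -
    interpret D: finsler_chart "cod d" "Lc d" by (rule charts[OF d])
    let ?\<psi> = "transition d c" and ?O = "snd d ` (fst d \<inter> fst c)"
    let ?T = "{s \<in> I. ?\<gamma> s \<in> fst d}"
    note sm = transition_smooth[OF d c]
    have pull: "?\<psi> (snd d (?\<gamma> s)) = x s \<and> fd ?\<psi> (snd d (?\<gamma> s)) (velocity A ?\<gamma> s d) = v s" if s: "s \<in> ?T" for s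
      using tangent_component[OF velocity_tangent[OF cc(1)] d c, of s] s cc(2,3)[of s] vel[of s]
      by (auto simp: transition_apply[OF d] dtransition_def)
    show ?thesis
    proof (rule euler_lagrange_transform[where T = ?T and \<psi> = ?\<psi> and ?L1.0 = "Lc c" and ?O2.0 = ?O
          and ?W1.0 = C.W and ?W2.0 = "?O \<times> (UNIV - {0})"])
      show "open (?O \<times> (UNIV - {0 :: 'e}))" using smooth_on_open[OF sm] by (intro open_Times) auto
      show "open ?T" by (rule curve_near[OF cc(1) d])
      show "t \<in> ?T" using t by simp
      show "y \<in> ?O \<and> (?\<psi> y, fd ?\<psi> y u) \<in> C.W \<and> Lc d (y, u) = Lc c (?\<psi> y, fd ?\<psi> y u)"
        if yu: "(y, u) \<in> ?O \<times> (UNIV - {0})" for y u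
      proof -
        obtain q where q: "y = snd d q" "q \<in> fst d" "q \<in> fst c" and u: "u \<noteq> 0" using yu by blast
        have D: "fd ?\<psi> (snd d q) u = dtransition d c q u" by (simp add: dtransition_def)
        have "dtransition d c q u \<noteq> 0"
          using dtransition_inverse[OF d c q(2,3), of u] u linear_0[OF dtransition_linear[OF c d q(3,2)]] by metis
        then show ?thesis
          using q by (simp add: D transition_apply[OF d] Lc_apply[OF d] Lc_apply[OF c] tvec_of_dtransition[OF d c])
      qed
      show "(snd d (?\<gamma> s), velocity A ?\<gamma> s d) \<in> ?O \<times> (UNIV - {0})" if "s \<in> ?T" for s
      proof -
        have "velocity A ?\<gamma> s d \<noteq> 0"
        proof
          assume "velocity A ?\<gamma> s d = 0"
          then have "velocity A ?\<gamma> s = tzero"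
            using tangent_eq_tzero_iff[OF d _ velocity_tangent[OF cc(1)], of s] that by simp
          then show False using vel[of s] xv(2)[of s] that by (simp add: tzero_def)
        qed
        then show ?thesis using that cc(2)[of s] by auto
      qed
      show "((\<lambda>s. snd d (?\<gamma> s)) has_vector_derivative velocity A ?\<gamma> t d) (at t)"
        by (rule curve_chart[OF cc(1) d t])
      show "((\<lambda>s. fd (Lc c) (?\<psi> (snd d (?\<gamma> s)), fd ?\<psi> (snd d (?\<gamma> s)) (velocity A ?\<gamma> s d)) (0, e)) has_real_derivative
          fd (Lc c) (?\<psi> (snd d (?\<gamma> t)), fd ?\<psi> (snd d (?\<gamma> t)) (velocity A ?\<gamma> t d)) (e, 0)) (at t)" for e
      proof -
        have z: "((\<lambda>s. (x s, v s)) has_vector_derivative (v t, - 2 *\<^sub>R spray (Lc c) (x t, v t))) (at t)"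
          using has_derivative_Pair[OF xv(1)[OF t(1), unfolded has_vector_derivative_def] vs[OF t(1), unfolded has_vector_derivative_def]]
          by (simp add: has_vector_derivative_def)
        have "(x t, v t) \<in> C.W" using x(2) xv(2) t by auto
        then have "((\<lambda>s. fd (Lc c) (x s, v s) (0, e)) has_real_derivative fd (Lc c) (x t, v t) (e, 0)) (at t)"
          using C.euler_lagrange_iff_spray[OF z refl] by blast
        then have "((\<lambda>s. fd (Lc c) (?\<psi> (snd d (?\<gamma> s)), fd ?\<psi> (snd d (?\<gamma> s)) (velocity A ?\<gamma> s d)) (0, e)) has_real_derivative
            fd (Lc c) (x t, v t) (e, 0)) (at t)"
        proof (rule DERIV_cong_ev[THEN iffD1, OF refl _ refl, rotated])
          have "\<forall>\<^sub>F s in nhds t. s \<in> ?T"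
            using curve_near[OF cc(1) d] t by (intro eventually_nhds_in_open) auto
          then show "\<forall>\<^sub>F s in nhds t. fd (Lc c) (x s, v s) (0, e) =
              fd (Lc c) (?\<psi> (snd d (?\<gamma> s)), fd ?\<psi> (snd d (?\<gamma> s)) (velocity A ?\<gamma> s d)) (0, e)"
            by eventually_elim (simp add: pull)
        qed
        then show ?thesis using pull[of t] t by simp
      qed
    qed (rule sm C.smooth_L)+
  qed
  then show ?thesis using cc(1) nconst by (simp add: finsler_geodesic_def Let_def)
qed

text \<open>An osculating field is built explicitly: the velocity is extended to be constant on the
  hyperplanes orthogonal to \<open>v0\<close>, each of which the curve meets at most once. For its
  Levi-Civita connection, parallelism becomes the equation \<open>wn\<close>, and one osculating
  field serves for the whole interval.\<close>

lemma chart_linearly_parallel: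
  assumes c: "c \<in> A" and I: "open I" "is_interval I" and x: "smooth_on I x" "x ` I \<subseteq> cod c"
    and v: "smooth_on I v" and w: "smooth_on I w"
    and xv: "\<And>t. t \<in> I \<Longrightarrow> (x has_vector_derivative v t) (at t)" "\<And>t. t \<in> I \<Longrightarrow> v t \<noteq> 0 \<and> 0 < v t \<bullet> v0"
    and vs: "\<And>t. t \<in> I \<Longrightarrow> (v has_vector_derivative - 2 *\<^sub>R spray (Lc c) (x t, v t)) (at t)"
    and wn: "\<And>t. t \<in> I \<Longrightarrow> (w has_vector_derivative - ncon (Lc c) (x t, v t) (w t)) (at t)"
  shows "linearly_parallel M A F I (\<lambda>t. cinv c (x t)) (\<lambda>t. tvec_of A c (cinv c (x t)) (w t))"
proof -
  let ?\<gamma> = "\<lambda>t. cinv c (x t)" and ?W = "\<lambda>t. tvec_of A c (cinv c (x t)) (w t)"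
  interpret C: finsler_chart "cod c" "Lc c" by (rule charts[OF c])
  note cc = chart_curve[OF c I x]
  have vel: "velocity A ?\<gamma> t c = v t" if "t \<in> I" for t
    using cc(4)[OF that] fd_eq[OF xv(1)[OF that, unfolded has_vector_derivative_def]] by simp
  have W: "smooth_field_along A I ?\<gamma> ?W"
    unfolding smooth_field_along_def
  proof (intro conjI ballI)
    show "?W t \<in> tangent_space A (?\<gamma> t)" if "t \<in> I" for t by (rule tvec_of_tangent[OF c cc(2)[OF that]])
    show "smooth_on {t \<in> I. ?\<gamma> t \<in> fst d} (\<lambda>t. ?W t d)" if "d \<in> A" for d
      by (rule smooth_tvec_of_along[OF c x w that curve_near[OF cc(1) that]])
  qed
  define s where "s t = x t \<bullet> v0" for t
  have ss: "smooth_on I s" unfolding s_def[abs_def] by (rule smooth_on_linear[OF bounded_linear_inner_left x(1)])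
  have "fd s t 1 > 0" if "t \<in> I" for t
  proof -
    have "(s has_derivative (\<lambda>h. (h *\<^sub>R v t) \<bullet> v0)) (at t)"
      unfolding s_def[abs_def] by (rule has_derivative_inner_left[OF xv(1)[OF that, unfolded has_vector_derivative_def]])
    then show ?thesis using xv(2)[OF that] by (simp add: fd_eq)
  qed
  note inv = smooth_on_inverse_function_real[OF I ss this]
  define \<tau> where "\<tau> y = inv_into I s (y \<bullet> v0)" for y
  \<comment> \<open>The slab of chart points whose level is attained on the curve; there \<tau>
    takes values in \<open>I\<close> and the extension is defined.\<close>
  define U' where "U' = cod c \<inter> {y. y \<bullet> v0 \<in> s ` I}"
  have "open {y. y \<bullet> v0 \<in> s ` I}"
    using open_vimage[OF inv(2), of "\<lambda>y. y \<bullet> v0"] by (simp add: vimage_def continuous_intros)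
  then have U': "open U'" "U' \<subseteq> cod c" using cod_open[OF c] by (auto simp: U'_def)
  have xU': "x t \<in> U'" if "t \<in> I" for t using that x(2) by (auto simp: U'_def s_def)
  have \<tau>x: "\<tau> (x t) = t" if "t \<in> I" for t
    using inv_into_f_f[OF inv(1) that] by (simp add: \<tau>_def s_def)
  have \<tau>I: "\<tau> y \<in> I" if "y \<in> U'" for y using that by (auto simp: \<tau>_def U'_def intro: inv_into_into)
  have s\<tau>: "smooth_on U' \<tau>"
    unfolding \<tau>_def[abs_def]
    by (rule smooth_on_compose[OF inv(3) smooth_on_linear[OF bounded_linear_inner_left smooth_on_ident[OF U'(1)]]])
      (auto simp: U'_def)
  define vf where "vf y = v (\<tau> y)" for y
  have svf: "smooth_on U' vf" unfolding vf_def[abs_def] by (rule smooth_on_compose[OF v s\<tau>]) (use \<tau>I in blast)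
  have vfx: "vf (x t) = v t" if "t \<in> I" for t by (simp add: vf_def \<tau>x[OF that])
  define V where "V q = tvec_of A c q (vf (snd c q))" for q
  let ?U = "cinv c ` U'"
  have U: "openin M ?U" by (rule cinv_image_open[OF c U'])
  have inU: "q \<in> fst c \<and> snd c q \<in> U'" if q: "q \<in> ?U" for q
  proof -
    obtain y where "y \<in> U'" "q = cinv c y" using q by blast
    then show ?thesis using U'(2) cinv_in[of y c] chart_cinv[of y c] by auto
  qed
  have sV: "smooth_vector_field_on A ?U V" unfolding V_def[abs_def] by (rule chart_vector_field[OF c U' svf])
  have Vnz: "\<forall>q\<in>?U. V q \<noteq> tzero"
  proof
    fix q assume "q \<in> ?U"
    then have "q \<in> fst c" "snd c q \<in> U'" using inU by blast+
    then show "V q \<noteq> tzero"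
      using tvec_of_eq_tzero_iff[OF c] xv(2)[OF \<tau>I] by (simp add: V_def vf_def)
  qed
  have V\<gamma>: "V (?\<gamma> t) = velocity A ?\<gamma> t" if "t \<in> I" for t
    using tvec_of_component[OF c cc(2)[OF that] velocity_tangent[OF cc(1) that]] vel[OF that]
    by (simp add: V_def cc(3)[OF that] vfx[OF that])
  have "continuous_on (x ` I) \<tau>"
    by (rule continuous_on_subset[OF smooth_on_continuous[OF s\<tau>]]) (use xU' in blast)
  then have "embedding_map (top_of_set I) M ?\<gamma>" by (rule chart_curve_embedding[OF c I x _ \<tau>x])
  then have osc: "osculating_field M A I ?\<gamma> ?U V"
    using U sV Vnz V\<gamma> xU' by (auto simp: osculating_field_def)
  let ?g = "osculating_metric F V" and ?\<Gamma> = "\<lambda>d. christoffel (metric_rep A (osculating_metric F V) d)"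
  note g = osculating_metric_riemannian[OF U sV Vnz]
  have lc: "levi_civita_on A ?U ?g ?\<Gamma>" by (rule levi_civita_exists[OF g U])
  interpret R: riemann_chart "snd c ` (?U \<inter> fst c)" "metric_rep A ?g c"
    by (rule riemann_chart_metric_rep[OF g U c])
  have img: "snd c ` (?U \<inter> fst c) = U'"
  proof
    show "snd c ` (?U \<inter> fst c) \<subseteq> U'" using inU by blast
    show "U' \<subseteq> snd c ` (?U \<inter> fst c)"
    proof
      fix y assume "y \<in> U'"
      then show "y \<in> snd c ` (?U \<inter> fst c)" using image_chart_iff[OF c, of y ?U] U'(2) by blast
    qed
  qed
  have rep: "metric_rep A ?g c y p q = vhess (Lc c) (y, vf y) p q" if "y \<in> U'" for y p q
  proof -
    have y: "y \<in> cod c" using that U'(2) by blast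
    have m: "cinv c y \<in> ?U" "cinv c y \<in> fst c" using that cinv_in[OF y] by auto
    have "V (cinv c y) c = vf y" by (simp add: V_def tvec_of_self[OF c m(2)] chart_cinv[OF y])
    then show ?thesis
      using osculating_metric_rep(1)[OF sV Vnz c m, of p q] by (simp only: chart_cinv[OF y])
  qed
  have cov: "cov_deriv_along A ?\<Gamma> ?\<gamma> ?W t = tzero" if t: "t \<in> I" for t
  proof -
    note tc = cc(2)[OF t]
    have y: "x t \<in> snd c ` (?U \<inter> fst c)" using xU'[OF t] img by simp
    have "?\<Gamma> c (x t) (v t) (w t) = ncon (Lc c) (x t, v t) (w t)"
    proof (rule C.osculating_christoffel_eq_ncon)
      show "(x t, v t) \<in> C.W" using x(2) xv(2) t by auto
      show "(vf has_derivative fd vf (x t)) (at (x t))" by (rule smooth_on_has_derivative[OF svf xU'[OF t]])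
      show "vf (x t) = v t" by (rule vfx[OF t])
      \<comment> \<open>Along the curve \<open>vf\<close> is the velocity, so its derivative in the
        direction of the curve is the acceleration.\<close>
      show "fd vf (x t) (v t) = - 2 *\<^sub>R spray (Lc c) (x t, v t)"
      proof -
        have "((\<lambda>t. vf (x t)) has_derivative (\<lambda>h. fd vf (x t) (h *\<^sub>R v t))) (at t)"
          by (rule has_derivative_compose[OF xv(1)[OF t, unfolded has_vector_derivative_def] smooth_on_has_derivative[OF svf xU'[OF t]]])
        then have "(v has_derivative (\<lambda>h. fd vf (x t) (h *\<^sub>R v t))) (at t)"
          by (rule has_derivative_transform_within_open[OF _ I(1) t]) (rule vfx)
        from has_derivative_unique[OF this vs[OF t, unfolded has_vector_derivative_def]]
        show ?thesis by (auto dest: fun_cong[where x = 1])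
      qed
      show "?\<Gamma> c (x t) p q = ?\<Gamma> c (x t) q p" for p q by (rule R.christoffel_sym[OF y])
      show "fd (\<lambda>y. vhess (Lc c) (y, vf y) p q) (x t) u = vhess (Lc c) (x t, v t) (?\<Gamma> c (x t) u p) q
          + vhess (Lc c) (x t, v t) p (?\<Gamma> c (x t) u q)" for u p q
      proof -
        have "fd (\<lambda>y. vhess (Lc c) (y, vf y) p q) (x t) = fd (\<lambda>y. metric_rep A ?g c y p q) (x t)"
          by (rule fd_cong[OF U'(1) xU'[OF t]]) (simp add: rep)
        then show ?thesis
          using R.christoffel_compat[OF y, of p q u] by (simp add: rep[OF xU'[OF t]] vfx[OF t])
      qed
    qed
    moreover have "vector_derivative (\<lambda>s. ?W s c) (at t) = - ncon (Lc c) (x t, v t) (w t)"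
    proof (rule vector_derivative_at)
      show "((\<lambda>s. ?W s c) has_vector_derivative - ncon (Lc c) (x t, v t) (w t)) (at t)"
        by (rule has_vector_derivative_transform_within_open[OF wn[OF t] I(1) t]) (simp add: tvec_of_self[OF c cc(2)])
    qed
    ultimately have c0: "cov_deriv_along A ?\<Gamma> ?\<gamma> ?W t c = 0"
      using c tc vel[OF t] cc(3)[OF t] by (simp add: cov_deriv_along_def tvec_of_self)
    \<comment> \<open>It remains to pass from \<open>c\<close> to the other charts around the point;
      in all further charts the components vanish by convention.\<close>
    have aff: "affine_connection A ?U ?\<Gamma>" using lc by (simp add: levi_civita_on_def)
    show ?thesis
    proof
      fix d
      show "cov_deriv_along A ?\<Gamma> ?\<gamma> ?W t d = tzero d"
      proof (cases "d \<in> A \<and> ?\<gamma> t \<in> fst d")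
        case True
        then have "cov_deriv_along A ?\<Gamma> ?\<gamma> ?W t d = dtransition c d (?\<gamma> t) (cov_deriv_along A ?\<Gamma> ?\<gamma> ?W t c)"
          by (intro cov_deriv_along_transition[OF aff cc(1) W t _ c tc]) (use xU'[OF t] in auto)
        then show ?thesis
          unfolding c0 using linear_0[OF dtransition_linear[OF c _ tc]] True by (simp add: tzero_def)
      qed (auto simp: cov_deriv_along_def tzero_def)
    qed
  qed
  show ?thesis
    unfolding linearly_parallel_def
  proof (intro conjI W ballI)
    fix t assume t: "t \<in> I"
    show "\<exists>J U V \<Gamma>. open J \<and> is_interval J \<and> t \<in> J \<and> J \<subseteq> I \<and> osculating_field M A J ?\<gamma> U V \<and>
        levi_civita_on A U (osculating_metric F V) \<Gamma> \<and> (\<forall>s\<in>J. cov_deriv_along A \<Gamma> ?\<gamma> ?W s = tzero)"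
      by (rule exI[of _ I], rule exI[of _ ?U], rule exI[of _ V], rule exI[of _ ?\<Gamma>]) (simp add: I t osc lc cov)
  qed
qed

end

section \<open>Charts with norm-preserving linear parallel transport\<close>

locale parallel_chart = finsler_chart +
  assumes parallel: "x \<in> U \<Longrightarrow> v \<noteq> 0 \<Longrightarrow> w \<noteq> 0 \<Longrightarrow> fd L (x, w) (v, - ncon L (x, v) w) = 0"
begin

text \<open>
  \<open>P\<close> is linear parallel transport with reference vector \<open>v\<close> along the coordinate line through \<open>x\<close>,
  which need not be a geodesic; \<open>Q\<close> is its inverse.
\<close>

lemma transport:
  assumes x: "x \<in> U" and v: "v \<noteq> 0"
  obtains \<delta> Q where "\<delta> > 0" "\<And>t. \<bar>t\<bar> < \<delta> \<Longrightarrow> linear (Q t) \<and> inj (Q t)"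
    "\<And>t w. \<bar>t\<bar> < \<delta> \<Longrightarrow> L (x + t *\<^sub>R v, w) = L (x, Q t w)" "\<And>w. Q 0 w = w"
    "\<And>w. ((\<lambda>t. Q t w) has_vector_derivative ncon L (x, v) w) (at 0)"
proof -
  obtain r where r: "r > 0" "cball x r \<subseteq> U" using open_contains_cball open_U x by metis
  define T where "T = r / norm v"
  have T: "T > 0" using r v by (simp add: T_def)
  have inU: "x + t *\<^sub>R v \<in> U" if "t \<in> {-T..T}" for t
  proof -
    have "\<bar>t\<bar> * norm v \<le> r" using that v by (auto simp: T_def field_simps abs_le_iff)
    then have "x + t *\<^sub>R v \<in> cball x r" by (simp add: dist_norm)
    then show ?thesis using r by blast
  qed
  then have inW: "(x + t *\<^sub>R v, v) \<in> W" if "t \<in> {-T..T}" for t using that v by simp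
  define N where "N t = Blinfun (ncon L (x + t *\<^sub>R v, v))" for t
  have N: "blinfun_apply (N t) = ncon L (x + t *\<^sub>R v, v)" if "t \<in> {-T..T}" for t
    unfolding N_def using linear_ncon[OF inW[OF that]]
    by (simp add: bounded_linear_Blinfun_apply linear_conv_bounded_linear)
  have cN: "continuous_on {-T..T} N"
  proof (rule continuous_on_blinfun_componentwise)
    fix i :: 'a
    have "continuous_on {-T..T} (\<lambda>t. ncon L (x + t *\<^sub>R v, v) i)"
    proof (rule continuous_on_compose2[OF smooth_on_continuous[OF smooth_ncon]])
      show "continuous_on {-T..T} (\<lambda>t. (x + t *\<^sub>R v, v))" by (intro continuous_intros)
      show "(\<lambda>t. (x + t *\<^sub>R v, v)) ` {-T..T} \<subseteq> W" using inW by blast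
    qed
    then show "continuous_on {-T..T} (\<lambda>t. N t i)"
      by (rule continuous_on_eq) (simp only: N)
  qed
  then have "compact (N ` {-T..T})" by (rule compact_continuous_image) simp
  then have "bounded (N ` {-T..T})" by (rule compact_imp_bounded)
  then obtain K where "\<forall>t\<in>{-T..T}. norm (N t) \<le> K" by (auto simp: bounded_iff)
  then have K: "norm (N t) \<le> K" if "t \<in> {-T..T}" for t using that by blast
  have K0: "K \<ge> 0" using K[of 0] T norm_ge_zero[of "N 0"] by (meson atLeastAtMost_iff less_imp_le neg_le_0_iff_le order_trans)
  \<comment> \<open>The pair solves \<open>P' = - N P\<close> and \<open>Q' = Q N\<close>. Then
    \<open>Q P\<close> is constant, which makes \<open>Q\<close> the inverse of \<open>P\<close>
    without determinants; one application of the existence theorem provides both.\<close>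
  define f :: "real \<Rightarrow> ('a \<Rightarrow>\<^sub>L 'a) \<times> ('a \<Rightarrow>\<^sub>L 'a) \<Rightarrow> ('a \<Rightarrow>\<^sub>L 'a) \<times> ('a \<Rightarrow>\<^sub>L 'a)"
    where "f t X = (- (N t o\<^sub>L fst X), snd X o\<^sub>L N t)" for t X
  let ?u0 = "(id_blinfun, id_blinfun) :: ('a \<Rightarrow>\<^sub>L 'a) \<times> ('a \<Rightarrow>\<^sub>L 'a)"
  have fb: "norm (f t X) \<le> 2 * K * norm X" if t: "t \<in> {-T..T}" for t X
  proof -
    have "norm (f t X) \<le> norm (N t o\<^sub>L fst X) + norm (snd X o\<^sub>L N t)"
      unfolding f_def using norm_Pair_le[of "- (N t o\<^sub>L fst X)" "snd X o\<^sub>L N t"] by simp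
    also have "\<dots> \<le> norm (N t) * norm (fst X) + norm (snd X) * norm (N t)"
      by (intro add_mono norm_blinfun_compose)
    also have "\<dots> \<le> K * norm X + norm X * K"
      using K[OF t] K0 norm_fst_le[of "fst X" "snd X"] norm_snd_le[of "snd X" "fst X"]
      by (intro add_mono mult_mono) auto
    finally show ?thesis by simp
  qed
  have fdiff: "f t X - f t Y = f t (X - Y)" for t X Y
    by (simp add: f_def bounded_bilinear.diff_left[OF bounded_bilinear_blinfun_compose]
        bounded_bilinear.diff_right[OF bounded_bilinear_blinfun_compose])
  have fc: "continuous_on ({-T..T} \<times> cball ?u0 1) (\<lambda>(t, X). f t X)"
  proof -
    have "continuous_on ({-T..T} \<times> cball ?u0 1) (\<lambda>z. N (fst z))"
      by (rule continuous_on_compose2[OF cN]) (auto intro!: continuous_intros)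
    then show ?thesis unfolding f_def case_prod_unfold by (intro continuous_intros)
  qed
  obtain \<delta> u where u: "0 < \<delta>" "\<delta> \<le> T" "u 0 = ?u0"
    "\<And>t. t \<in> {-\<delta><..<\<delta>} \<Longrightarrow> (u has_vector_derivative f t (u t)) (at t)"
  proof (rule Picard_Lindeloef[OF T zero_less_one fc])
    show "norm (f t X - f t Y) \<le> (2 * K) * norm (X - Y)" if "t \<in> {-T..T}" for t X Y
      using fb[OF that] by (simp add: fdiff)
    show "norm (f t X) \<le> 2 * K * (norm ?u0 + 1)" if "t \<in> {-T..T}" "X \<in> cball ?u0 1" for t X
    proof -
      have "norm X \<le> norm ?u0 + 1"
        using that(2) norm_triangle_sub[of X ?u0] by (simp add: dist_norm norm_minus_commute)
      then show ?thesis using fb[OF that(1), of X] mult_left_mono[of "norm X" "norm ?u0 + 1" "2 * K"] K0 by simp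
    qed
  qed (rule that)
  define P where "P t = fst (u t)" for t
  define Q where "Q t = snd (u t)" for t
  let ?I = "{-\<delta><..<\<delta>}"
  have IT: "t \<in> {-T..T}" if "t \<in> ?I" for t using that u(2) by auto
  have dP: "(P has_vector_derivative - (N t o\<^sub>L P t)) (at t)" if "t \<in> ?I" for t
    using bounded_linear.has_vector_derivative[OF bounded_linear_fst u(4)[OF that]] by (simp add: P_def[abs_def] f_def)
  have dQ: "(Q has_vector_derivative Q t o\<^sub>L N t) (at t)" if "t \<in> ?I" for t
    using bounded_linear.has_vector_derivative[OF bounded_linear_snd u(4)[OF that]] by (simp add: Q_def[abs_def] f_def)
  have const: "h t = h 0" if "\<And>t. t \<in> ?I \<Longrightarrow> (h has_vector_derivative 0) (at t)" "t \<in> ?I"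
    for h :: "real \<Rightarrow> 'z::real_normed_vector" and t
    by (rule has_vector_derivative_zero_imp_eq[of ?I]) (use that u(1) in auto)
  have QP: "Q t o\<^sub>L P t = id_blinfun" if t: "t \<in> ?I" for t
  proof -
    have "((\<lambda>t. Q t o\<^sub>L P t) has_vector_derivative 0) (at t)" if "t \<in> ?I" for t
    proof -
      have "(Q t o\<^sub>L (- (N t o\<^sub>L P t))) + ((Q t o\<^sub>L N t) o\<^sub>L P t) = 0"
        by (rule blinfun_eqI) (simp add: blinfun.bilinear_simps)
      then show ?thesis
        using bounded_bilinear.has_vector_derivative[OF bounded_bilinear_blinfun_compose dQ[OF that] dP[OF that]] by simp
    qed
    moreover have "id_blinfun o\<^sub>L id_blinfun = (id_blinfun :: 'a \<Rightarrow>\<^sub>L 'a)" by (rule blinfun_eqI) simp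
    ultimately show ?thesis using const[of "\<lambda>t. Q t o\<^sub>L P t" t] t by (simp add: P_def Q_def u(3))
  qed
  have lin: "linear (blinfun_apply B)" for B :: "'a \<Rightarrow>\<^sub>L 'a"
    using blinfun.bounded_linear_right linear_conv_bounded_linear by blast
  have QP': "Q t (P t w) = w" if "t \<in> ?I" for t w
  proof -
    have "(Q t o\<^sub>L P t) w = w" using QP[OF that] by simp
    then show ?thesis by simp
  qed
  have PQ': "P t (Q t w) = w" if "t \<in> ?I" for t w
  proof -
    have "blinfun_apply (Q t) \<circ> blinfun_apply (P t) = id" using QP'[OF that] by auto
    then have "blinfun_apply (P t) \<circ> blinfun_apply (Q t) = id" using linear_inverse_left[OF lin lin] by blast
    then show ?thesis by (metis comp_apply id_apply)
  qed
  have LP: "L (x + t *\<^sub>R v, P t w) = L (x, w)" if t: "t \<in> ?I" for t w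
  proof (cases "w = 0")
    case True
    then show ?thesis using L_zero[OF inU[OF IT[OF t]]] L_zero[OF x] by simp
  next
    case False
    \<comment> \<open>\<open>parallel\<close> is applied at every point of the line with the same
      reference vector \<open>v\<close>; a nonzero \<open>w\<close> stays nonzero because
      \<open>Q t\<close> inverts \<open>P t\<close>.\<close>
    have "((\<lambda>t. L (x + t *\<^sub>R v, P t w)) has_vector_derivative 0) (at t)" if t: "t \<in> ?I" for t
    proof -
      have Pw: "P t w \<noteq> 0" using QP'[OF t, of w] False by (metis blinfun.zero_right)
      have "((\<lambda>t. P t w) has_vector_derivative - ncon L (x + t *\<^sub>R v, v) (P t w)) (at t)"
        using bounded_linear.has_vector_derivative[OF blinfun.bounded_linear_left dP[OF t], of w]
        by (simp add: blinfun.bilinear_simps N[OF IT[OF t]])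
      then have "((\<lambda>t. (x + t *\<^sub>R v, P t w)) has_derivative (\<lambda>h. h *\<^sub>R (v, - ncon L (x + t *\<^sub>R v, v) (P t w)))) (at t)"
        unfolding has_vector_derivative_def scaleR_Pair by (intro has_derivative_Pair) (auto intro!: derivative_eq_intros)
      from has_derivative_compose[OF this smooth_on_has_derivative[OF smooth_L]]
      have "((\<lambda>t. L (x + t *\<^sub>R v, P t w)) has_derivative
          (\<lambda>h. fd L (x + t *\<^sub>R v, P t w) (h *\<^sub>R (v, - ncon L (x + t *\<^sub>R v, v) (P t w))))) (at t)"
        using inU[OF IT[OF t]] Pw by simp
      moreover have "fd L (x + t *\<^sub>R v, P t w) (h *\<^sub>R (v, - ncon L (x + t *\<^sub>R v, v) (P t w))) = 0" for h
      proof -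
        have l: "linear (fd L (x + t *\<^sub>R v, P t w))"
          by (rule smooth_on_linear_fd[OF smooth_L]) (use inU[OF IT[OF t]] Pw in simp)
        show ?thesis unfolding linear_scale[OF l] parallel[OF inU[OF IT[OF t]] v Pw] by simp
      qed
      ultimately show ?thesis by (simp add: has_vector_derivative_def)
    qed
    from const[OF this t] show ?thesis by (simp add: P_def u(3))
  qed
  show thesis
  proof (rule that[of \<delta> "\<lambda>t. blinfun_apply (Q t)"])
    show "linear (blinfun_apply (Q t)) \<and> inj (blinfun_apply (Q t))" if "\<bar>t\<bar> < \<delta>" for t
    proof -
      have "t \<in> ?I" using that by auto
      then have "inj (blinfun_apply (Q t))"
        by (intro inj_on_inverseI[where g = "blinfun_apply (P t)"]) (rule PQ')
      then show ?thesis using lin by blast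
    qed
    show "L (x + t *\<^sub>R v, w) = L (x, Q t w)" if "\<bar>t\<bar> < \<delta>" for t w
    proof -
      have "t \<in> ?I" using that by auto
      from LP[OF this, of "Q t w"] show ?thesis by (simp only: PQ'[OF \<open>t \<in> ?I\<close>])
    qed
    show "Q 0 w = w" for w by (simp add: Q_def u(3))
    have "0 \<in> ?I" using u(1) by simp
    from bounded_linear.has_vector_derivative[OF blinfun.bounded_linear_left dQ[OF this]] N[OF IT[OF this]]
    show "((\<lambda>t. Q t w) has_vector_derivative ncon L (x, v) w) (at 0)" for w
      by (simp add: Q_def u(3))
  qed (rule u(1))
qed

section \<open>Regularity of the canonical inner product in a chart\<close>

definition chart_form :: "'a \<Rightarrow> 'a \<Rightarrow> 'a \<Rightarrow> real" where
  "chart_form x = canonical_form (\<lambda>v. L (x, v))"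

lemma inner_form_chart_form: "x \<in> U \<Longrightarrow> inner_form (chart_form x)"
  unfolding chart_form_def by (rule inner_form_canonical_form[OF quadratic_gauge_L])

text \<open>Equivariance converts the transport of norms into the statement that
  \<open>chart_form (x + t *\<^sub>R v)\<close> is the pullback of \<open>chart_form x\<close> along
  \<open>Q t\<close>. All dependence on \<open>t\<close> now sits in the linear map
  \<open>Q t\<close>, and the product rule applies.\<close>

lemma chart_form_directional:
  assumes x: "x \<in> U" and v: "v \<noteq> 0"
  shows "((\<lambda>t. chart_form (x + t *\<^sub>R v) u w) has_real_derivative
    chart_form x (ncon L (x, v) u) w + chart_form x u (ncon L (x, v) w)) (at 0)"
proof -
  obtain \<delta> Q where Q: "\<delta> > 0" "\<And>t. \<bar>t\<bar> < \<delta> \<Longrightarrow> linear (Q t) \<and> inj (Q t)"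
    "\<And>t w. \<bar>t\<bar> < \<delta> \<Longrightarrow> L (x + t *\<^sub>R v, w) = L (x, Q t w)" "\<And>w. Q 0 w = w"
    "\<And>w. ((\<lambda>t. Q t w) has_vector_derivative ncon L (x, v) w) (at 0)"
    using transport[OF x v] by blast
  have "bilinear (chart_form x)" using inner_form_chart_form[OF x] by (simp add: inner_form_def)
  then have bb: "bounded_bilinear (chart_form x)" by (simp add: bilinear_conv_bounded_bilinear)
  have "((\<lambda>t. chart_form x (Q t u) (Q t w)) has_vector_derivative
      chart_form x (Q 0 u) (ncon L (x, v) w) + chart_form x (ncon L (x, v) u) (Q 0 w)) (at 0)"
    by (rule bounded_bilinear.has_vector_derivative[OF bb Q(5,5)])
  then have "((\<lambda>t. chart_form (x + t *\<^sub>R v) u w) has_vector_derivative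
      chart_form x (Q 0 u) (ncon L (x, v) w) + chart_form x (ncon L (x, v) u) (Q 0 w)) (at 0)"
  proof (rule has_vector_derivative_transform_within_open[where S = "{-\<delta><..<\<delta>}"])
    fix t assume "t \<in> {-\<delta><..<\<delta>}"
    then have t: "\<bar>t\<bar> < \<delta>" by auto
    have "chart_form (x + t *\<^sub>R v) = canonical_form (\<lambda>w. L (x, Q t w))"
      unfolding chart_form_def using Q(3)[OF t] by simp
    then show "chart_form x (Q t u) (Q t w) = chart_form (x + t *\<^sub>R v) u w"
      using canonical_form_compose[OF quadratic_gauge_L[OF x], of "Q t"] Q(2)[OF t] by (simp add: chart_form_def)
  qed (use Q(1) in auto)
  then show ?thesis
    by (simp add: has_real_derivative_iff_has_vector_derivative Q(4) add.commute)
qed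

lemma chart_form_directional_at:
  assumes "x + s *\<^sub>R v \<in> U" "v \<noteq> 0"
  shows "((\<lambda>t. chart_form (x + t *\<^sub>R v) u w) has_real_derivative
    chart_form (x + s *\<^sub>R v) (ncon L (x + s *\<^sub>R v, v) u) w + chart_form (x + s *\<^sub>R v) u (ncon L (x + s *\<^sub>R v, v) w)) (at s)"
proof -
  have "((\<lambda>t. chart_form (x + (s + t) *\<^sub>R v) u w) has_real_derivative
    chart_form (x + s *\<^sub>R v) (ncon L (x + s *\<^sub>R v, v) u) w + chart_form (x + s *\<^sub>R v) u (ncon L (x + s *\<^sub>R v, v) w)) (at 0)"
    using chart_form_directional[OF assms, of u w] by (simp add: scaleR_add_left add.assoc)
  then show ?thesis using DERIV_shift[of "\<lambda>t. chart_form (x + t *\<^sub>R v) u w" _ 0 s] by (simp add: add.commute)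
qed

text \<open>Unit directions form a compact set, so the bound is uniform over all segments issuing
  from \<open>x0\<close>.\<close>

lemma ncon_bound_near:
  assumes x0: "x0 \<in> U"
  obtains r K where "r > 0" "cball x0 r \<subseteq> U" "K \<ge> 0"
    "\<And>x v i. x \<in> cball x0 r \<Longrightarrow> norm v = 1 \<Longrightarrow> i \<in> Basis \<Longrightarrow> norm (ncon L (x, v) i) \<le> K"
proof -
  obtain r where r: "r > 0" "cball x0 r \<subseteq> U" using open_contains_cball open_U x0 by metis
  have "\<exists>K. \<forall>z\<in>cball x0 r \<times> sphere (0::'a) 1. norm (ncon L z i) \<le> K" for i
  proof -
    have "compact (cball x0 r \<times> sphere (0::'a) 1)" by (intro compact_Times compact_cball compact_sphere)
    moreover have "continuous_on (cball x0 r \<times> sphere (0::'a) 1) (\<lambda>z. ncon L z i)"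
      by (rule continuous_on_subset[OF smooth_on_continuous[OF smooth_ncon]]) (use r in auto)
    ultimately have "bounded ((\<lambda>z. ncon L z i) ` (cball x0 r \<times> sphere 0 1))"
      using compact_continuous_image compact_imp_bounded by blast
    then show ?thesis by (auto simp: bounded_iff)
  qed
  then obtain K where K: "\<And>i z. z \<in> cball x0 r \<times> sphere (0::'a) 1 \<Longrightarrow> norm (ncon L z i) \<le> K i" by metis
  have "norm (ncon L (x, v) i) \<le> (\<Sum>i\<in>Basis. \<bar>K i\<bar>)" if "x \<in> cball x0 r" "norm v = 1" "i \<in> Basis" for x v i
  proof -
    have "norm (ncon L (x, v) i) \<le> \<bar>K i\<bar>" using K[of "(x, v)" i] that by fastforce
    also have "\<dots> \<le> (\<Sum>i\<in>Basis. \<bar>K i\<bar>)" using that(3) by (intro member_le_sum) auto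
    finally show ?thesis .
  qed
  then show thesis using that[OF r, of "\<Sum>i\<in>Basis. \<bar>K i\<bar>"] by (simp add: sum_nonneg)
qed

text \<open>Gronwall's inequality along the segments issuing from \<open>x0\<close>.\<close>

lemma chart_form_Lipschitz_near:
  assumes x0: "x0 \<in> U"
  obtains r B where "r > 0" "\<And>y i j. y \<in> cball x0 r \<Longrightarrow> i \<in> Basis \<Longrightarrow> j \<in> Basis \<Longrightarrow>
    \<bar>chart_form y i j - chart_form x0 i j\<bar> \<le> B * norm (y - x0)"
proof -
  obtain r K where r: "r > 0" "cball x0 r \<subseteq> U" "K \<ge> 0"
    and K: "\<And>x v i. x \<in> cball x0 r \<Longrightarrow> norm v = 1 \<Longrightarrow> i \<in> Basis \<Longrightarrow> norm (ncon L (x, v) i) \<le> K"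
    using ncon_bound_near[OF x0] by metis
  define n where "n = real DIM('a)"
  \<comment> \<open>The squared norm of the matrix of the form. The derivative formula bounds its
    derivative along a segment by a multiple of itself.\<close>
  define D where "D x = (\<Sum>i\<in>Basis. \<Sum>j\<in>Basis. (chart_form x i j)\<^sup>2)" for x
  have D0: "D x \<ge> 0" for x by (simp add: D_def sum_nonneg)
  have bD: "\<bar>chart_form x i j\<bar> \<le> sqrt (D x)" if "i \<in> Basis" "j \<in> Basis" for x i j
  proof (rule real_le_rsqrt)
    have "(chart_form x i j)\<^sup>2 \<le> (\<Sum>j\<in>Basis. (chart_form x i j)\<^sup>2)" using that by (intro member_le_sum) auto
    also have "\<dots> \<le> D x" unfolding D_def using that by (intro member_le_sum) (auto intro: sum_nonneg)
    finally show "\<bar>chart_form x i j\<bar>\<^sup>2 \<le> D x" by simp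
  qed
  define \<beta>' where "\<beta>' x v i j = chart_form x (ncon L (x, v) i) j + chart_form x i (ncon L (x, v) j)" for x v i j
  have bN: "\<bar>\<beta>' x v i j\<bar> \<le> 2 * n * K * sqrt (D x)"
    if x: "x \<in> cball x0 r" and v: "norm v = 1" and ij: "i \<in> Basis" "j \<in> Basis" for x v i j
  proof -
    have xU: "x \<in> U" using x r by blast
    have 1: "\<bar>chart_form x (ncon L (x, v) i) j\<bar> \<le> n * (K * sqrt (D x))" if ij: "i \<in> Basis" "j \<in> Basis" for i j
    proof -
      have "chart_form x (ncon L (x, v) i) j = (\<Sum>k\<in>Basis. (ncon L (x, v) i \<bullet> k) * chart_form x k j)"
        using linear_eq_sum_Basis[OF inner_form_linear(2)[OF inner_form_chart_form[OF xU], of j], of "ncon L (x, v) i"] by simp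
      also have "\<bar>\<dots>\<bar> \<le> (\<Sum>k\<in>Basis. \<bar>(ncon L (x, v) i \<bullet> k) * chart_form x k j\<bar>)" by (rule sum_abs)
      also have "\<dots> \<le> (\<Sum>k\<in>(Basis::'a set). K * sqrt (D x))"
        unfolding abs_mult
        using K[OF x v ij(1)] bD ij r(3) by (intro sum_mono mult_mono) (auto intro: order_trans[OF Basis_le_norm])
      finally show ?thesis by (simp add: n_def)
    qed
    have "chart_form x i (ncon L (x, v) j) = chart_form x (ncon L (x, v) j) i"
      using inner_form_chart_form[OF xU] by (simp add: inner_form_def)
    then show ?thesis using 1[OF ij] 1[OF ij(2,1)] by (simp add: \<beta>'_def)
  qed
  \<comment> \<open>The derivative of \<open>D\<close> has \<open>n\<^sup>2\<close> terms, each at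
    most \<open>4 * n * K\<close> times \<open>D\<close>. The constant \<open>B\<close> below is the
    bound \<open>bN\<close> with \<open>D\<close> replaced by its exponential bound.\<close>
  define c where "c = 4 * n ^ 3 * K"
  define B where "B = 2 * n * K * sqrt (D x0 * exp (c * r))"
  have c0: "c \<ge> 0" using r by (simp add: c_def n_def)
  have main: "\<bar>chart_form (x0 + s *\<^sub>R v) i j - chart_form x0 i j\<bar> \<le> B * s"
    if v: "norm v = 1" and s: "0 \<le> s" "s \<le> r" and ij: "i \<in> Basis" "j \<in> Basis" for v s i j
  proof -
    have v0: "v \<noteq> 0" using v by auto
    have inb: "x0 + t *\<^sub>R v \<in> cball x0 r" if "0 \<le> t" "t \<le> r" for t
      using that v by (simp add: dist_norm)
    have inU: "x0 + t *\<^sub>R v \<in> U" if "0 \<le> t" "t \<le> r" for t using inb[OF that] r by blast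
    have d: "((\<lambda>t. chart_form (x0 + t *\<^sub>R v) i j) has_real_derivative \<beta>' (x0 + t *\<^sub>R v) v i j) (at t)"
      if "0 \<le> t" "t \<le> r" for t i j
      unfolding \<beta>'_def by (rule chart_form_directional_at[OF inU[OF that] v0])
    define D' where "D' t = (\<Sum>i\<in>Basis. \<Sum>j\<in>Basis. 2 * chart_form (x0 + t *\<^sub>R v) i j * \<beta>' (x0 + t *\<^sub>R v) v i j)" for t
    have dD: "((\<lambda>t. D (x0 + t *\<^sub>R v)) has_real_derivative D' t) (at t)" if "0 \<le> t" "t \<le> r" for t
      unfolding D_def D'_def
    proof (intro DERIV_sum)
      fix i j :: 'a
      have "((\<lambda>t. (chart_form (x0 + t *\<^sub>R v) i j)\<^sup>2) has_real_derivative
          real 2 * (\<beta>' (x0 + t *\<^sub>R v) v i j * chart_form (x0 + t *\<^sub>R v) i j ^ (2 - Suc 0))) (at t)"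
        by (rule DERIV_power[OF d[OF that]])
      then show "((\<lambda>t. (chart_form (x0 + t *\<^sub>R v) i j)\<^sup>2) has_real_derivative
          2 * chart_form (x0 + t *\<^sub>R v) i j * \<beta>' (x0 + t *\<^sub>R v) v i j) (at t)"
        by (simp add: ac_simps)
    qed
    have D'_le: "D' t \<le> c * D (x0 + t *\<^sub>R v)" if t: "0 \<le> t" "t \<le> r" for t
    proof -
      let ?x = "x0 + t *\<^sub>R v"
      have "D' t \<le> (\<Sum>i\<in>(Basis::'a set). \<Sum>j\<in>(Basis::'a set). 2 * sqrt (D ?x) * (2 * n * K * sqrt (D ?x)))"
        unfolding D'_def
      proof (intro sum_mono)
        fix i j :: 'a assume ij: "i \<in> Basis" "j \<in> Basis"
        have "chart_form ?x i j * \<beta>' ?x v i j \<le> \<bar>chart_form ?x i j\<bar> * \<bar>\<beta>' ?x v i j\<bar>"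
          using abs_ge_self[of "chart_form ?x i j * \<beta>' ?x v i j"] by (simp only: abs_mult)
        also have "\<dots> \<le> sqrt (D ?x) * (2 * n * K * sqrt (D ?x))"
          by (rule mult_mono[OF bD[OF ij] bN[OF inb[OF t] v ij]]) (simp_all add: D0)
        finally have "2 * (chart_form ?x i j * \<beta>' ?x v i j) \<le> 2 * (sqrt (D ?x) * (2 * n * K * sqrt (D ?x)))"
          by (rule mult_left_mono) simp
        then show "2 * chart_form ?x i j * \<beta>' ?x v i j \<le> 2 * sqrt (D ?x) * (2 * n * K * sqrt (D ?x))"
          by (simp only: mult.assoc)
      qed
      also have "\<dots> = n * n * (4 * n * K * (sqrt (D ?x) * sqrt (D ?x)))" by (simp add: n_def)
      also have "\<dots> = c * D ?x" using D0[of ?x] by (simp add: c_def power3_eq_cube)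
      finally show ?thesis .
    qed
    have Dle: "D (x0 + t *\<^sub>R v) \<le> D x0 * exp (c * r)" if t: "0 \<le> t" "t \<le> r" for t
    proof -
      \<comment> \<open>With this integrating factor the product has nonpositive derivative.\<close>
      have "D (x0 + t *\<^sub>R v) * exp (- (c * t)) \<le> D (x0 + 0 *\<^sub>R v) * exp (- (c * 0))"
      proof (rule DERIV_nonpos_imp_nonincreasing[OF t(1)])
        fix s assume s: "0 \<le> s" "s \<le> t"
        have "((\<lambda>t. D (x0 + t *\<^sub>R v) * exp (- (c * t))) has_real_derivative
            D' s * exp (- (c * s)) + (exp (- (c * s)) * - c) * D (x0 + s *\<^sub>R v)) (at s)"
          using s t by (intro DERIV_mult dD) (auto intro!: derivative_eq_intros)
        moreover have "D' s * exp (- (c * s)) + (exp (- (c * s)) * - c) * D (x0 + s *\<^sub>R v) \<le> 0"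
          using mult_right_mono[OF D'_le[of s], of "exp (- (c * s))"] s t by (simp add: mult_ac)
        ultimately show "\<exists>y. ((\<lambda>t. D (x0 + t *\<^sub>R v) * exp (- (c * t))) has_real_derivative y) (at s) \<and> y \<le> 0"
          by blast
      qed
      then have "D (x0 + t *\<^sub>R v) \<le> D x0 * exp (c * t)"
        by (simp add: exp_minus field_simps)
      also have "\<dots> \<le> D x0 * exp (c * r)"
        using t c0 D0 by (intro mult_left_mono) (auto intro: mult_left_mono)
      finally show ?thesis .
    qed
    have "norm (chart_form (x0 + s *\<^sub>R v) i j - chart_form (x0 + 0 *\<^sub>R v) i j) \<le> B * norm (s - 0)"
    proof (rule field_differentiable_bound[of "{0..s}"])
      show "((\<lambda>t. chart_form (x0 + t *\<^sub>R v) i j) has_field_derivative \<beta>' (x0 + t *\<^sub>R v) v i j) (at t within {0..s})"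
        if "t \<in> {0..s}" for t
        using d[of t i j] that s by (intro has_field_derivative_at_within[OF d]) auto
      show "norm (\<beta>' (x0 + t *\<^sub>R v) v i j) \<le> B" if "t \<in> {0..s}" for t
      proof -
        have t: "0 \<le> t" "t \<le> r" using that s by auto
        have "norm (\<beta>' (x0 + t *\<^sub>R v) v i j) \<le> 2 * n * K * sqrt (D (x0 + t *\<^sub>R v))"
          using bN[OF inb[OF t] v ij] by simp
        also have "\<dots> \<le> B"
          unfolding B_def using Dle[OF t] r(3) by (intro mult_left_mono real_sqrt_le_mono) (auto simp: n_def)
        finally show ?thesis .
      qed
    qed (use s in auto)
    then show ?thesis using s by simp
  qed
  have "\<bar>chart_form y i j - chart_form x0 i j\<bar> \<le> B * norm (y - x0)" if y: "y \<in> cball x0 r" and ij: "i \<in> Basis" "j \<in> Basis" for y i j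
  proof (cases "y = x0")
    case False
    have "norm ((1 / norm (y - x0)) *\<^sub>R (y - x0)) = 1" using False by simp
    moreover have "x0 + norm (y - x0) *\<^sub>R ((1 / norm (y - x0)) *\<^sub>R (y - x0)) = y" using False by simp
    ultimately show ?thesis
      using main[of "(1 / norm (y - x0)) *\<^sub>R (y - x0)" "norm (y - x0)" i j] y ij
      by (simp add: dist_norm norm_minus_commute)
  qed simp
  with r that show thesis by blast
qed

lemma chart_form_expand:
  assumes "x \<in> U"
  shows "chart_form x u w = (\<Sum>i\<in>Basis. \<Sum>j\<in>Basis. (u \<bullet> i) * (w \<bullet> j) * chart_form x i j)"
proof -
  have "chart_form x u w = (\<Sum>i\<in>Basis. (u \<bullet> i) * chart_form x i w)"
    using linear_eq_sum_Basis[OF inner_form_linear(2)[OF inner_form_chart_form[OF assms], of w], of u] by simp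
  also have "\<dots> = (\<Sum>i\<in>Basis. (u \<bullet> i) * (\<Sum>j\<in>Basis. (w \<bullet> j) * chart_form x i j))"
  proof (rule sum.cong[OF refl])
    show "(u \<bullet> i) * chart_form x i w = (u \<bullet> i) * (\<Sum>j\<in>Basis. (w \<bullet> j) * chart_form x i j)" for i
      using linear_eq_sum_Basis[OF inner_form_linear(1)[OF inner_form_chart_form[OF assms], of i], of w] by simp
  qed
  finally show ?thesis by (simp add: sum_distrib_left mult.assoc)
qed

lemma chart_form_continuous: "continuous_on U (\<lambda>x. chart_form x u w)"
proof -
  have "isCont (\<lambda>x. chart_form x i j) x0" if x0: "x0 \<in> U" and ij: "i \<in> Basis" "j \<in> Basis" for x0 i j
  proof -
    obtain r B where r: "r > 0" "\<And>y i j. y \<in> cball x0 r \<Longrightarrow> i \<in> Basis \<Longrightarrow> j \<in> Basis \<Longrightarrow>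
        \<bar>chart_form y i j - chart_form x0 i j\<bar> \<le> B * norm (y - x0)"
      using chart_form_Lipschitz_near[OF x0] by blast
    have "\<forall>\<^sub>F y in at x0. y \<in> ball x0 r" using r(1) by (intro eventually_at_in_open') auto
    then have "\<forall>\<^sub>F y in at x0. norm (chart_form y i j - chart_form x0 i j) \<le> B * norm (y - x0)"
      by eventually_elim (use r(2) ij in auto)
    moreover have "((\<lambda>y. B * norm (y - x0)) \<longlongrightarrow> B * norm (x0 - x0)) (at x0)" by (intro tendsto_intros)
    then have "((\<lambda>y. B * norm (y - x0)) \<longlongrightarrow> 0) (at x0)" by simp
    ultimately have "((\<lambda>y. chart_form y i j - chart_form x0 i j) \<longlongrightarrow> 0) (at x0)" by (rule Lim_null_comparison)
    then show ?thesis by (simp add: isCont_def LIM_zero_iff)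
  qed
  then have "continuous_on U (\<lambda>x. chart_form x i j)" if "i \<in> Basis" "j \<in> Basis" for i j
    using that by (simp add: continuous_at_imp_continuous_on)
  then have "continuous_on U (\<lambda>x. \<Sum>i\<in>Basis. \<Sum>j\<in>Basis. (u \<bullet> i) * (w \<bullet> j) * chart_form x i j)"
    by (intro continuous_intros) auto
  then show ?thesis
    by (rule continuous_on_cong[THEN iffD1, OF refl, rotated]) (rule chart_form_expand[symmetric])
qed

lemma Ck_on_chart_form_apply:
  assumes b: "\<And>u w. Ck_on k (\<lambda>x. chart_form x u w) U" and \<xi>: "Ck_on k \<xi> U"
  shows "Ck_on k (\<lambda>x. chart_form x (\<xi> x) w) U"
proof (rule Ck_on_cong[OF open_U])
  show "Ck_on k (\<lambda>x. \<Sum>i\<in>Basis. (\<xi> x \<bullet> i) * chart_form x i w) U"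
    by (intro Ck_on_sum[OF open_U] Ck_on_bilinear[OF open_U bounded_bilinear_mult] b
        Ck_on_linear[OF open_U bounded_linear_inner_left \<xi>])
  show "(\<Sum>i\<in>Basis. (\<xi> x \<bullet> i) * chart_form x i w) = chart_form x (\<xi> x) w" if "x \<in> U" for x
    using linear_eq_sum_Basis[OF inner_form_linear(2)[OF inner_form_chart_form[OF that], of w], of "\<xi> x"] by simp
qed

text \<open>Each partial derivative is an expression in the form itself with coefficients
  \<open>ncon L (x, i)\<close> that are smooth in \<open>x\<close>. Continuity therefore gives class
  C^1, and every order yields the next.\<close>

lemma smooth_chart_form: "smooth_on U (\<lambda>x. chart_form x u w)"
proof -
  have sN: "Ck_on k (\<lambda>x. ncon L (x, i) u) U" if "i \<noteq> 0" for i u k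
  proof -
    have "smooth_on U (\<lambda>x. ncon L (x, i) u)"
      by (rule smooth_on_compose[OF smooth_ncon smooth_on_Pair[OF smooth_on_ident[OF open_U] smooth_on_const[OF open_U]]])
        (use that in auto)
    then show ?thesis by (simp add: smooth_on_def)
  qed
  define b' where "b' u w x i = chart_form x (ncon L (x, i) u) w + chart_form x (ncon L (x, i) w) u" for u w x i
  have Cb': "Ck_on k (\<lambda>x. b' u w x i) U" if b: "\<And>u w. Ck_on k (\<lambda>x. chart_form x u w) U" and i: "i \<in> Basis" for k u w i
    unfolding b'_def
    by (rule Ck_on_add[OF open_U Ck_on_chart_form_apply[OF b sN[OF nonzero_Basis[OF i]]]
        Ck_on_chart_form_apply[OF b sN[OF nonzero_Basis[OF i]]]])
  have c0: "Ck_on 0 (\<lambda>x. chart_form x u w) U" for u w using chart_form_continuous by simp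
  have der: "((\<lambda>x. chart_form x u w) has_derivative (\<lambda>h. \<Sum>i\<in>Basis. (h \<bullet> i) * b' u w x i)) (at x)" if x: "x \<in> U" for x u w
  proof (rule has_derivative_continuous_partials[OF open_U x])
    fix y i :: 'a assume y: "y \<in> U" "i \<in> Basis"
    have "chart_form y u (ncon L (y, i) w) = chart_form y (ncon L (y, i) w) u"
      using inner_form_chart_form[OF y(1)] by (simp add: inner_form_def)
    then show "((\<lambda>t. chart_form (y + t *\<^sub>R i) u w) has_real_derivative b' u w y i) (at 0)"
      using chart_form_directional[OF y(1) nonzero_Basis[OF y(2)], of u w] by (simp add: b'_def)
  next
    show "continuous_on U (\<lambda>x. b' u w x i)" if "i \<in> Basis" for i
      using Cb'[OF c0 that] by simp
  qed
  have "Ck_on k (\<lambda>x. chart_form x u w) U" for k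
  proof (induction k arbitrary: u w)
    case 0
    show ?case by (rule c0)
  next
    case (Suc k)
    show ?case
    proof (rule Ck_on_SucI[OF open_U der])
      show "Ck_on k (\<lambda>x. \<Sum>i\<in>Basis. (h \<bullet> i) * b' u w x i) U" for h
        by (intro Ck_on_sum[OF open_U] Ck_on_linear[OF open_U bounded_linear_mult_right] Cb' Suc.IH)
    qed
  qed
  then show ?thesis using open_U by (simp add: smooth_on_def)
qed

sublocale chart_form: riemann_chart U chart_form
proof
  show "open U" by (rule open_U)
  show "inner_form (chart_form x)" if "x \<in> U" for x by (rule inner_form_chart_form[OF that])
  show "smooth_on U (\<lambda>x. chart_form x u w)" for u w by (rule smooth_chart_form)
qed

text \<open>The derivative of \<open>chart_form y w w\<close> in direction \<open>v\<close> is
  computed twice, by transport and by compatibility of the Levi-Civita connection. The difference of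
  \<open>ncon L (x, v)\<close> and the Christoffel operator is thus skew, as
  \<open>spray_eq_if_skew\<close> requires.\<close>

theorem spray_eq_christoffel:
  assumes x: "x \<in> U" and v: "v \<noteq> 0"
  shows "spray L (x, v) = (1/2) *\<^sub>R christoffel chart_form x v v"
proof (rule spray_eq_if_skew[OF inner_form_chart_form[OF x] x chart_form.bilinear_christoffel[OF x] chart_form.christoffel_sym[OF x] _ v])
  fix v w :: 'a assume v: "v \<noteq> 0"
  have "((\<lambda>t. chart_form (x + t *\<^sub>R v) w w) has_derivative (\<lambda>h. fd (\<lambda>y. chart_form y w w) (x + 0 *\<^sub>R v) (h *\<^sub>R v))) (at 0)"
    by (rule has_derivative_compose[where f = "\<lambda>t. x + t *\<^sub>R v"])
      (use smooth_on_has_derivative[OF smooth_chart_form x] in \<open>auto intro!: derivative_eq_intros\<close>)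
  moreover have "((\<lambda>t. chart_form (x + t *\<^sub>R v) w w) has_derivative
      (*) (chart_form x (ncon L (x, v) w) w + chart_form x w (ncon L (x, v) w))) (at 0)"
    using chart_form_directional[OF x v] by (simp add: has_field_derivative_def)
  ultimately have "(\<lambda>h. fd (\<lambda>y. chart_form y w w) (x + 0 *\<^sub>R v) (h *\<^sub>R v)) =
      (*) (chart_form x (ncon L (x, v) w) w + chart_form x w (ncon L (x, v) w))"
    by (rule has_derivative_unique)
  from fun_cong[OF this, of 1]
  have "fd (\<lambda>y. chart_form y w w) x v = chart_form x (ncon L (x, v) w) w + chart_form x w (ncon L (x, v) w)" by simp
  then show "chart_form x (ncon L (x, v) w - christoffel chart_form x v w) w = 0"
    unfolding chart_form.christoffel_compat[OF x] using chart_form.h_sym[OF x, of w]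
    by (simp add: inner_form_simps[OF inner_form_chart_form[OF x]])
qed

end

section \<open>The invariant Riemannian metric\<close>

lemma christoffel_cong:
  assumes "open S" "x \<in> S" "\<And>y. y \<in> S \<Longrightarrow> h y = h' y"
  shows "christoffel h x u w = christoffel h' x u w"
proof -
  have "fd (\<lambda>y. h y p q) x = fd (\<lambda>y. h' y p q) x" for p q
    by (rule fd_cong[OF assms(1,2)]) (simp add: assms(3))
  then show ?thesis by (simp add: christoffel_def assms(2,3))
qed

lemma finsler_mfd_if_metric:
  fixes M :: "'a topology" and A :: "('a, 'e::euclidean_space) chart set"
  assumes M: "smooth_manifold M A" and F: "finsler_metric M A F"
  shows "finsler_mfd M A F"
proof -
  interpret smooth_mfd M A by standard (rule M)
  have "finsler_chart (cod c) (\<lambda>z. (local_rep A F c z)\<^sup>2)" if c: "c \<in> A" for c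
  proof
    have F1: "F p v \<ge> 0" "v \<noteq> tzero \<Longrightarrow> F p v > 0" "r > 0 \<Longrightarrow> F p (\<lambda>c. r *\<^sub>R v c) = r * F p v"
      if "p \<in> fst c" "v \<in> tangent_space A p" for p v r
      using F that chart_subset[OF c] unfolding finsler_metric_def by blast+
    have sm: "smooth_on (cod c \<times> (UNIV - {0})) (local_rep A F c)" using F c unfolding finsler_metric_def by blast
    then show sm2: "smooth_on (cod c \<times> (UNIV - {0})) (\<lambda>z. (local_rep A F c z)\<^sup>2)"
      unfolding power2_eq_square by (intro smooth_on_mult)
    have "continuous_on (cod c \<times> UNIV) (local_rep A F c)" using F c unfolding finsler_metric_def by blast
    then show "continuous_on (cod c \<times> UNIV) (\<lambda>z. (local_rep A F c z)\<^sup>2)" by (intro continuous_intros)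
    show "open (cod c)" by (rule cod_open[OF c])
    fix x assume "x \<in> cod c"
    then obtain p where p: "x = snd c p" "p \<in> fst c" by blast
    have rep: "local_rep A F c (x, \<xi>) = F p (tvec_of A c p \<xi>)" for \<xi>
      by (simp add: local_rep_def p cinv_chart[OF c])
    note T = tvec_of_tangent[OF c p(2)]
    have scale: "F p (tvec_of A c p (r *\<^sub>R v)) = r * F p (tvec_of A c p v)" if "r > 0" for r v
      using F1(3)[OF p(2) T that, of v] tvec_of_lincomb[OF c p(2), of r v 0 v] by simp
    show "(local_rep A F c (x, r *\<^sub>R v))\<^sup>2 = r\<^sup>2 * (local_rep A F c (x, v))\<^sup>2" if "r \<ge> 0" for r v
    proof (cases "r = 0")
      case True
      \<comment> \<open>Homogeneity is given for positive factors only; scaling the zero vector by 2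
        shows that \<open>F\<close> vanishes on it.\<close>
      have "F p (tvec_of A c p 0) = 0" using scale[of 2 0] by simp
      then show ?thesis using True by (simp add: rep)
    next
      case False
      then show ?thesis using scale[of r v] that by (simp add: rep power_mult_distrib)
    qed
    fix v :: 'e assume v: "v \<noteq> 0"
    have nz: "tvec_of A c p u \<noteq> tzero" if "u \<noteq> 0" for u using tvec_of_eq_tzero_iff[OF c p(2)] that by blast
    show "0 < (local_rep A F c (x, v))\<^sup>2" using F1(2)[OF p(2) T nz[OF v]] by (simp add: rep)
    fix u :: 'e assume u: "u \<noteq> 0"
    have "fundamental_tensor F p (tvec_of A c p v) (tvec_of A c p u) (tvec_of A c p u) > 0"
      using F T nz[OF v] nz[OF u] chart_subset[OF c] p(2) unfolding finsler_metric_def by blast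
    then show "0 < vhess (\<lambda>z. (local_rep A F c z)\<^sup>2) (x, v) u u"
      by (simp add: fundamental_tensor_rep[OF c p(2) v sm2] p(1))
  qed
  then show ?thesis by (intro finsler_mfd.intro finsler_mfd_axioms.intro smooth_mfd.intro M)
qed

context finsler_mfd
begin

text \<open>A short geodesic with arbitrary initial data, together with the parallel field starting
  at \<open>w0\<close>, brings the hypothesis into play; constancy of \<open>F\<close> along it is
  differentiated at time zero.\<close>

lemma parallel_chart_if_preserved:
  assumes hyp: "\<And>I \<gamma> W. finsler_geodesic M A F I \<gamma> \<Longrightarrow> linearly_parallel M A F I \<gamma> W \<Longrightarrow>
      (\<lambda>t. F (\<gamma> t) (W t)) constant_on I"
    and c: "c \<in> A"
  shows "parallel_chart (cod c) (Lc c)"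
proof (intro parallel_chart.intro parallel_chart_axioms.intro charts[OF c])
  interpret C: finsler_chart "cod c" "Lc c" by (rule charts[OF c])
  fix x0 v0 w0 :: 'e assume x0: "x0 \<in> cod c" and v0: "v0 \<noteq> 0" and w0: "w0 \<noteq> 0"
  obtain \<delta> x v w where \<delta>: "\<delta> > 0" and sm: "smooth_on {-\<delta><..<\<delta>} x" "smooth_on {-\<delta><..<\<delta>} v" "smooth_on {-\<delta><..<\<delta>} w"
    and init: "x 0 = x0" "v 0 = v0" "w 0 = w0"
    and pos: "\<And>t. t \<in> {-\<delta><..<\<delta>} \<Longrightarrow> x t \<in> cod c \<and> v t \<noteq> 0 \<and> 0 < v t \<bullet> v0"
    and dx: "\<And>t. t \<in> {-\<delta><..<\<delta>} \<Longrightarrow> (x has_vector_derivative v t) (at t)"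
    and dv: "\<And>t. t \<in> {-\<delta><..<\<delta>} \<Longrightarrow> (v has_vector_derivative - 2 *\<^sub>R spray (Lc c) (x t, v t)) (at t)"
    and dw: "\<And>t. t \<in> {-\<delta><..<\<delta>} \<Longrightarrow> (w has_vector_derivative - ncon (Lc c) (x t, v t) (w t)) (at t)"
    by (rule C.parallel_solution[OF x0 v0]) (rule that)
  let ?I = "{-\<delta><..<\<delta>}" and ?\<gamma> = "\<lambda>t. cinv c (x t)" and ?W = "\<lambda>t. tvec_of A c (cinv c (x t)) (w t)"
  have I: "open ?I" "is_interval ?I" "0 \<in> ?I" using \<delta> by (auto simp: is_interval_1)
  have xc: "x ` ?I \<subseteq> cod c" using pos by blast
  have "finsler_geodesic M A F ?I ?\<gamma>"
    by (rule chart_geodesic[OF c I sm(1) xc dx _ dv]) (use pos in blast)+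
  moreover have "linearly_parallel M A F ?I ?\<gamma> ?W"
    by (rule chart_linearly_parallel[OF c I(1,2) sm(1) xc sm(2,3) dx _ dv dw]) (use pos in blast)+
  ultimately have "(\<lambda>t. F (?\<gamma> t) (?W t)) constant_on ?I" by (rule hyp)
  then obtain k where k: "\<And>t. t \<in> ?I \<Longrightarrow> F (?\<gamma> t) (?W t) = k" unfolding constant_on_def by blast
  have 0: "((\<lambda>t. Lc c (x t, w t)) has_derivative (\<lambda>h. 0)) (at 0)"
  proof (rule has_derivative_transform_within_open[OF has_derivative_const I(1,3)])
    show "k\<^sup>2 = Lc c (x t, w t)" if "t \<in> ?I" for t using k[OF that] by (simp add: local_rep_def)
  qed
  have W: "(x 0, w 0) \<in> C.W" using init x0 w0 by simp
  have "((\<lambda>t. (x t, w t)) has_derivative (\<lambda>h. (h *\<^sub>R v 0, h *\<^sub>R - ncon (Lc c) (x 0, v 0) (w 0)))) (at 0)"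
    by (rule has_derivative_Pair[OF dx[OF I(3), unfolded has_vector_derivative_def] dw[OF I(3), unfolded has_vector_derivative_def]])
  from has_derivative_compose[OF this smooth_on_has_derivative[OF C.smooth_L W]]
  have "(\<lambda>h. fd (Lc c) (x 0, w 0) (h *\<^sub>R v 0, h *\<^sub>R - ncon (Lc c) (x 0, v 0) (w 0))) = (\<lambda>h. 0)"
    by (rule has_derivative_unique[OF _ 0])
  from fun_cong[OF this, of 1] show "fd (Lc c) (x0, w0) (v0, - ncon (Lc c) (x0, v0) w0) = 0"
    by (simp add: init)
qed

text \<open>The chart is an arbitrary choice at each point; equivariance makes the value on tangent
  vectors independent of it. The value 0 off the manifold keeps the form nonnegative at every
  argument.\<close>

definition invariant_metric :: "'a \<Rightarrow> ('a, 'e) tvec \<Rightarrow> ('a, 'e) tvec \<Rightarrow> real" where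
  "invariant_metric p u w = (if p \<in> topspace M then
     let c = SOME c. c \<in> A \<and> p \<in> fst c in canonical_form (\<lambda>\<xi>. Lc c (snd c p, \<xi>)) (u c) (w c) else 0)"

text \<open>The differential of a transition map is a linear isomorphism that intertwines the
  squared norms of the two charts, so \<open>canonical_form_compose\<close> applies.\<close>

lemma invariant_metric_chart:
  assumes c: "c \<in> A" "p \<in> fst c" and u: "u \<in> tangent_space A p" and w: "w \<in> tangent_space A p"
  shows "invariant_metric p u w = canonical_form (\<lambda>\<xi>. Lc c (snd c p, \<xi>)) (u c) (w c)"
proof -
  define d where "d = (SOME c. c \<in> A \<and> p \<in> fst c)"
  have d: "d \<in> A" "p \<in> fst d" using someI[of "\<lambda>c. c \<in> A \<and> p \<in> fst c" c] c by (auto simp: d_def)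
  interpret D: finsler_chart "cod d" "Lc d" by (rule charts[OF d(1)])
  let ?D = "dtransition c d p"
  have lin: "linear ?D" by (rule dtransition_linear[OF c(1) d(1) c(2) d(2)])
  have "inj ?D" by (rule inj_on_inverseI[where g = "dtransition d c p"]) (rule dtransition_inverse[OF c(1) d(1) c(2) d(2)])
  from canonical_form_compose[OF D.quadratic_gauge_L lin this, of "snd d p"]
  have "canonical_form (\<lambda>v. Lc d (snd d p, ?D v)) (u c) (w c) = canonical_form (\<lambda>v. Lc d (snd d p, v)) (?D (u c)) (?D (w c))"
    using d(2) by simp
  moreover have "(\<lambda>v. Lc d (snd d p, ?D v)) = (\<lambda>\<xi>. Lc c (snd c p, \<xi>))"
    by (simp add: Lc_apply[OF c] Lc_apply[OF d] tvec_of_dtransition[OF c(1) d(1) c(2) d(2)])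
  moreover have "p \<in> topspace M" using chart_subset[OF c(1)] c(2) by blast
  ultimately show ?thesis
    using tangent_component[OF u c(1) d(1) c(2) d(2)] tangent_component[OF w c(1) d(1) c(2) d(2)]
    by (simp add: invariant_metric_def d_def[symmetric])
qed

text \<open>All arguments are covered, tangent or not, because squaring
  \<open>riemannian_norm\<close> must undo the square root also where \<open>local_rep\<close> is
  evaluated outside the chart.\<close>

lemma invariant_metric_nonneg: "invariant_metric p u u \<ge> 0"
proof (cases "p \<in> topspace M")
  case True
  define d where "d = (SOME c. c \<in> A \<and> p \<in> fst c)"
  have d: "d \<in> A \<and> p \<in> fst d" unfolding d_def by (rule someI_ex) (use covered[OF True] in blast)
  then have f: "inner_form (canonical_form (\<lambda>\<xi>. Lc d (snd d p, \<xi>)))"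
    by (intro inner_form_canonical_form finsler_chart.quadratic_gauge_L[OF charts]) auto
  have "canonical_form (\<lambda>\<xi>. Lc d (snd d p, \<xi>)) v v \<ge> 0" for v
    using f inner_form_simps(9)[OF f] by (cases "v = 0") (auto simp: inner_form_def less_imp_le)
  then show ?thesis using True by (simp add: invariant_metric_def d_def[symmetric])
qed (simp add: invariant_metric_def)

end

locale parallel_mfd = finsler_mfd +
  assumes parallel_charts: "c \<in> A \<Longrightarrow> parallel_chart (cod c) (\<lambda>z. (local_rep A F c z)\<^sup>2)"
begin

lemma metric_rep_invariant:
  assumes c: "c \<in> A" and x: "x \<in> cod c"
  shows "metric_rep A invariant_metric c x = parallel_chart.chart_form (Lc c) x"
proof (intro ext)
  fix u w
  obtain p where p: "x = snd c p" "p \<in> fst c" using x by blast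
  show "metric_rep A invariant_metric c x u w = parallel_chart.chart_form (Lc c) x u w"
    using invariant_metric_chart[OF c p(2) tvec_of_tangent[OF c p(2)] tvec_of_tangent[OF c p(2)], of u w]
    by (simp add: metric_rep_def p cinv_chart[OF c] parallel_chart.chart_form_def[OF parallel_charts[OF c]] tvec_of_self[OF c])
qed

lemma riemannian_invariant: "riemannian_metric_on A (topspace M) invariant_metric"
proof (rule riemannian_metric_onI[OF order_refl])
  show "inner_form (metric_rep A invariant_metric c (snd c p))" if "c \<in> A" "p \<in> fst c" for c p
  proof -
    have "snd c p \<in> cod c" using that by blast
    then show ?thesis
      using metric_rep_invariant[OF that(1)] parallel_chart.inner_form_chart_form[OF parallel_charts[OF that(1)]] by simp
  qed
  show "smooth_on (snd c ` (topspace M \<inter> fst c)) (\<lambda>x. metric_rep A invariant_metric c x u w)" if c: "c \<in> A" for c u w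
  proof -
    have "topspace M \<inter> fst c = fst c" using chart_subset[OF c] by blast
    moreover have "smooth_on (cod c) (\<lambda>x. metric_rep A invariant_metric c x u w)"
      by (rule smooth_on_cong[OF parallel_chart.smooth_chart_form[OF parallel_charts[OF c], of u w]])
        (simp add: metric_rep_invariant[OF c])
    ultimately show ?thesis by simp
  qed
qed

lemma riemann_chart_invariant:
  assumes c: "c \<in> A"
  shows "riemann_chart (cod c) (metric_rep A invariant_metric c)"
proof -
  have "topspace M \<inter> fst c = fst c" using chart_subset[OF c] by blast
  then show ?thesis using riemann_chart_metric_rep[OF riemannian_invariant openin_topspace c] by simp
qed

lemma spray_invariant:
  assumes c: "c \<in> A" and x: "x \<in> cod c" and v: "v \<noteq> 0"
  shows "spray (Lc c) (x, v) = (1/2) *\<^sub>R christoffel (metric_rep A invariant_metric c) x v v"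
proof -
  have "christoffel (metric_rep A invariant_metric c) x v v = christoffel (parallel_chart.chart_form (Lc c)) x v v"
    by (rule christoffel_cong[OF cod_open[OF c] x]) (rule metric_rep_invariant[OF c])
  then show ?thesis using parallel_chart.spray_eq_christoffel[OF parallel_charts[OF c] x v] by simp
qed

lemma local_rep_invariant:
  assumes c: "c \<in> A"
  shows "(\<lambda>z. (local_rep A (riemannian_norm invariant_metric) c z)\<^sup>2) = riemann_chart.energy (metric_rep A invariant_metric c)"
proof
  interpret R: riemann_chart "cod c" "metric_rep A invariant_metric c" by (rule riemann_chart_invariant[OF c])
  show "(local_rep A (riemannian_norm invariant_metric) c z)\<^sup>2 = R.energy z" for z
    by (cases z) (simp add: local_rep_def riemannian_norm_def R.energy_def metric_rep_def invariant_metric_nonneg)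
qed

lemma finsler_mfd_invariant: "finsler_mfd M A (riemannian_norm invariant_metric)"
proof (intro finsler_mfd.intro finsler_mfd_axioms.intro smooth_mfd_axioms)
  show "finsler_chart (cod c) (\<lambda>z. (local_rep A (riemannian_norm invariant_metric) c z)\<^sup>2)" if c: "c \<in> A" for c
    unfolding local_rep_invariant[OF c] by (rule riemann_chart.finsler_chart_energy[OF riemann_chart_invariant[OF c]])
qed

text \<open>Both metrics have the spray of the Levi-Civita connection, and
  \<open>finsler_geodesic_iff\<close> sees a metric only through its spray.\<close>

lemma affinely_equivalent_invariant: "affinely_equivalent M A F (riemannian_norm invariant_metric)"
proof -
  interpret G: finsler_mfd M A "riemannian_norm invariant_metric" by (rule finsler_mfd_invariant)
  have "spray (Lc c) (x, v) = spray (G.Lc c) (x, v)" if c: "c \<in> A" and x: "x \<in> cod c" and v: "v \<noteq> 0" for c x v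
    unfolding local_rep_invariant[OF c] riemann_chart.spray_energy[OF riemann_chart_invariant[OF c] x v]
    by (rule spray_invariant[OF c x v])
  then have "(velocity A \<gamma> t c \<noteq> 0 \<and> ((\<lambda>s. velocity A \<gamma> s c) has_vector_derivative
        - 2 *\<^sub>R spray (Lc c) (snd c (\<gamma> t), velocity A \<gamma> t c)) (at t)) \<longleftrightarrow>
      (velocity A \<gamma> t c \<noteq> 0 \<and> ((\<lambda>s. velocity A \<gamma> s c) has_vector_derivative
        - 2 *\<^sub>R spray (G.Lc c) (snd c (\<gamma> t), velocity A \<gamma> t c)) (at t))"
    if "c \<in> A" "\<gamma> t \<in> fst c" for \<gamma> t c
    using that by fastforce
  then show ?thesis
    unfolding affinely_equivalent_def finsler_geodesic_iff G.finsler_geodesic_iff by blast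
qed

text \<open>With \<open>spray\<close> equal to half of \<open>christoffel\<close> on the diagonal,
  \<open>x'' = - 2 spray\<close> is the geodesic equation of the Levi-Civita connection of
  \<open>invariant_metric\<close>.\<close>

lemma berwald_invariant: "berwald M A F"
proof -
  let ?\<Gamma> = "\<lambda>c. christoffel (metric_rep A invariant_metric c)"
  have "levi_civita_on A (topspace M) invariant_metric ?\<Gamma>"
    by (rule levi_civita_exists[OF riemannian_invariant openin_topspace])
  moreover have "connection_geodesic M A ?\<Gamma> I \<gamma>" if g: "finsler_geodesic M A F I \<gamma>" for I \<gamma>
  proof -
    have "cov_deriv_along A ?\<Gamma> \<gamma> (velocity A \<gamma>) t c = tzero c" if t: "t \<in> I" for t c
    proof (cases "c \<in> A \<and> \<gamma> t \<in> fst c")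
      case True
      then have v: "velocity A \<gamma> t c \<noteq> 0" and a: "((\<lambda>s. velocity A \<gamma> s c) has_vector_derivative
          - 2 *\<^sub>R spray (Lc c) (snd c (\<gamma> t), velocity A \<gamma> t c)) (at t)"
        using g t unfolding finsler_geodesic_iff by blast+
      have "snd c (\<gamma> t) \<in> cod c" using True by blast
      then show ?thesis
        using True vector_derivative_at[OF a] spray_invariant[OF _ _ v] by (simp add: cov_deriv_along_def tzero_def)
    qed (auto simp: cov_deriv_along_def tzero_def)
    then show ?thesis using g unfolding connection_geodesic_def finsler_geodesic_iff by blast
  qed
  ultimately show ?thesis unfolding berwald_def levi_civita_on_def by blast
qed

end

theorem proposition4p2:
  fixes M :: "'a topology"
    and A :: "('a, 'e::euclidean_space) chart set"
    and F :: "'a \<Rightarrow> ('a, 'e) tvec \<Rightarrow> real"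
  assumes "smooth_manifold M A"
    and "finsler_metric M A F"
    and "\<And>I \<gamma> W. finsler_geodesic M A F I \<gamma> \<Longrightarrow> linearly_parallel M A F I \<gamma> W \<Longrightarrow>
           (\<lambda>t. F (\<gamma> t) (W t)) constant_on I"
  shows "(\<exists>g. riemannian_metric_on A (topspace M) g \<and>
              affinely_equivalent M A F (riemannian_norm g)) \<and>
         berwald M A F"
proof -
  interpret finsler_mfd M A F by (rule finsler_mfd_if_metric[OF assms(1,2)])
  interpret parallel_mfd M A F
    by (intro parallel_mfd.intro parallel_mfd_axioms.intro finsler_mfd_axioms
        parallel_chart_if_preserved[OF assms(3)])
  show ?thesis using riemannian_invariant affinely_equivalent_invariant berwald_invariant by blast
qed

end
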